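(* Let $\mathcal{M}=(\mathbb{R}^m,g)$ be a generalized plane wave manifold, with usual coordinates $x=(x_1,\dots,x_m)$. Then: \begin{enumerate} \item $\mathcal{M}$ is complete and strongly geodesically convex. \item For all $\nu\ge 0$ and all indices, $$\nabla_{\partial_{x_{j_1}}}\cdots\nabla_{\partial_{x_{j_\nu}}}R(\partial_{x_{i_1}},\partial_{x_{i_2}})\partial_{x_{i_3}}=\sum_{k>\max(i_1,i_2,i_3,j_1,\dots,j_\nu)}R_{i_1i_2i_3}{}^{k}{}_{;j_1\dots j_\nu}(x_1,\dots,x_{k-1})\,\partial_{x_k},$$ i.e. the component $R_{i_1i_2i_3}{}^{k}{}_{;j_1\dots j_\nu}$ vanishes unless $k>\max(i_1,i_2,i_3,j_1,\dots,j_\nu)$, and it depends only on $x_1,\dots,x_{k-1}$. \item $\mathcal{M}$ is nilpotent Osserman, nilpotent Ivanov-Petrova, and nilpotent Szab\'o. \item $\mathcal{M}$ is Ricci flat and Einstein. \item $\mathcal{M}$ is VSI. \item If $\gamma$ is a smooth curve in $\mathbb{R}^m$, then for each $i$ there are real constants $a^j$ (depending on $\gamma$ and $i$) with $P_\gamma\partial_{x_i}=\partial_{x_i}+\sum_{j>i}a^j\partial_{x_j}$. \item For every $P\in\mathbb{R}^m$, the holonomy group satisfies $\mathcal{H}_P(\mathcal{M})\subset\mathcal{T}$. \end{enumerate}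
   Context: Let $g$ be a pseudo-Riemannian metric on $\mathbb{R}^m$ of signature $(p,q)$, $p+q=m$, with Levi-Civita connection $\nabla$. $\mathcal{M}=(\mathbb{R}^m,g)$ is a generalized plane wave manifold if, in the usual coordinates, $$\nabla_{\partial_{x_i}}\partial_{x_j}=\sum_{k>\max(i,j)}\Gamma_{ij}{}^k(x_1,\dots,x_{k-1})\,\partial_{x_k},$$ i.e. the Christoffel symbol $\Gamma_{ij}{}^k$ vanishes unless $k>\max(i,j)$, and it depends only on $x_1,\dots,x_{k-1}$. Complete: all geodesics extend for infinite time. Strongly geodesically convex: there is a unique geodesic between any two points (a unique geodesic $\gamma:[0,1]\to M$ with $\gamma(0)=P$, $\gamma(1)=Q$). $R$ is the curvature operator, and the expression $\nabla_{\partial_{x_{j_1}}}\cdots\nabla_{\partial_{x_{j_\nu}}}R(\partial_{x_{i_1}},\partial_{x_{i_2}})\partial_{x_{i_3}}=R_{i_1i_2i_3}{}^{i_4}{}_{;j_1\dots j_\nu}\partial_{x_{i_4}}$ (sum over $i_4$) denotes the components of the tensor $\nabla^\nu R$, the $\nu$-th covariant derivative of $R$. For a tangent vector $\xi$, the Jacobi operator is $J(\xi):x\mapsto R(x,\xi)\xi$ and the Szab\'o operator is $\mathcal{S}(\xi):x\mapsto(\nabla_\xi R)(x,\xi)\xi$. For an oriented spacelike or timelike $2$-plane $\pi$ with oriented orthonormal basis $\{e_1,e_2\}$, the skew-symmetric curvature operator is $\mathcal{R}(\pi):x\mapsto R(e_1,e_2)x$. $\mathcal{M}$ is nilpotent Osserman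 if $0$ is the only eigenvalue of $J$, equivalently $J(\xi)^m=0$ for every tangent vector $\xi$; nilpotent Szab\'o and nilpotent Ivanov-Petrova are defined similarly, using $\mathcal{S}(\xi)$ for all $\xi$, respectively $\mathcal{R}(\pi)$ for all oriented spacelike or timelike $2$-planes $\pi$. Weyl (scalar) invariants are the scalars formed by using $g^{ij}$ and $g_{ij}$ to fully contract all indices in products of the components of $R$ and its covariant derivatives (with at least one curvature factor), and linear combinations of these; e.g. $\tau=g^{ij}R_{kij}{}^k$. $\mathcal{M}$ is VSI (vanishing scalar invariants) if all such invariants vanish. For a smooth curve $\gamma$ with parameter in $[0,1]$, $P_\gamma:T_{\gamma(0)}M\to T_{\gamma(1)}M$ is parallel translation along $\gamma$. $\mathcal{H}_P(\mathcal{M})$ is the group of all $P_\gamma$ with $\gamma(0)=\gamma(1)=P$. $\mathcal{T}$ is the group of upper triangular real $m\times m$ matrices with all diagonal entries $1$; a linear map $H$ of $T_P\mathbb{R}^m$ is regarded as a matrix in the coordinate frame whose $i$-th row consists of the coefficients of $H\partial_{x_i}$. *)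

theory Defs
  imports "HOL-Analysis.Analysis"
begin

text \<open>
  Points of $R^m$ and tangent vectors are elements of \<open>real^'n\<close>, where the index type \<open>'n\<close> is
  finite and linearly ordered, hence order isomorphic to $1 < \dots < m$ with \<open>m = CARD('n)\<close>.
  A metric is the matrix-valued function with entries $g_{ij}(x)$ = \<open>g x $ i $ j\<close>.
\<close>

type_synonym 'n metric = "real^'n \<Rightarrow> real^'n^'n"
type_synonym 'n vector_field = "real^'n \<Rightarrow> real^'n"


subsection \<open>Smoothness\<close>

definition partial :: "'n::finite \<Rightarrow> (real^'n \<Rightarrow> real) \<Rightarrow> real^'n \<Rightarrow> real" where
  "partial i f x = frechet_derivative f (at x) (axis i 1)"

text \<open>Differentiability of every iterated partial derivative also gives its continuity,
  so this is $C^\infty$.\<close>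

definition smooth :: "(real^'n::finite \<Rightarrow> real) \<Rightarrow> bool" where
  "smooth f \<longleftrightarrow> (\<forall>is x. foldr partial is f differentiable (at x))"

text \<open>The set \<open>S\<close> is meant to be an interval with nonempty interior; derivatives at an endpoint
  belonging to \<open>S\<close> are one-sided.\<close>

definition smooth_curve_on :: "real set \<Rightarrow> (real \<Rightarrow> real^'n::finite) \<Rightarrow> bool" where
  "smooth_curve_on S \<gamma> \<longleftrightarrow> (\<exists>D :: nat \<Rightarrow> real \<Rightarrow> real^'n.
     (\<forall>t\<in>S. D 0 t = \<gamma> t) \<and>
     (\<forall>r. \<forall>t\<in>S. (D r has_vector_derivative D (Suc r) t) (at t within S)))"


subsection \<open>Pseudo-Riemannian metrics\<close>

text \<open>The columns of \<open>A\<close> form an orthonormal basis with \<open>p\<close> timelike and \<open>q\<close> spacelike vectors.\<close>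

definition has_signature :: "real^'n^'n::finite \<Rightarrow> nat \<Rightarrow> nat \<Rightarrow> bool" where
  "has_signature G p q \<longleftrightarrow> (\<exists>(A :: real^'n^'n) (\<epsilon> :: 'n \<Rightarrow> real).
     invertible A \<and> (\<forall>i. \<epsilon> i = -1 \<or> \<epsilon> i = 1) \<and>
     card {i. \<epsilon> i = -1} = p \<and> card {i. \<epsilon> i = 1} = q \<and>
     transpose A ** G ** A = (\<chi> i j. if i = j then \<epsilon> i else 0))"

definition pseudo_riemannian :: "nat \<Rightarrow> nat \<Rightarrow> 'n::finite metric \<Rightarrow> bool" where
  "pseudo_riemannian p q g \<longleftrightarrow>
     (\<forall>i j. smooth (\<lambda>x. g x $ i $ j)) \<and>
     (\<forall>x. transpose (g x) = g x) \<and>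
     (\<forall>x. has_signature (g x) p q)"

definition metric_at :: "'n::finite metric \<Rightarrow> real^'n \<Rightarrow> real^'n \<Rightarrow> real^'n \<Rightarrow> real" where
  "metric_at g P u v = (\<Sum>i\<in>UNIV. \<Sum>j\<in>UNIV. g P $ i $ j * u $ i * v $ j)"

definition inverse_metric :: "'n::finite metric \<Rightarrow> 'n metric" where
  "inverse_metric g x = matrix_inv (g x)"


subsection \<open>Levi-Civita connection\<close>

text \<open>\<open>christoffel g i j k\<close> is $\Gamma_{ij}{}^k$.\<close>

definition christoffel :: "'n::finite metric \<Rightarrow> 'n \<Rightarrow> 'n \<Rightarrow> 'n \<Rightarrow> real^'n \<Rightarrow> real" where
  "christoffel g i j k x = (1/2) * (\<Sum>l\<in>UNIV. inverse_metric g x $ k $ l *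
     (partial i (\<lambda>y. g y $ j $ l) x + partial j (\<lambda>y. g y $ i $ l) x
      - partial l (\<lambda>y. g y $ i $ j) x))"

definition coord_field :: "'n::finite \<Rightarrow> 'n vector_field" where
  "coord_field i = (\<lambda>x. axis i 1)"

definition cov_deriv :: "'n::finite metric \<Rightarrow> 'n vector_field \<Rightarrow> 'n vector_field \<Rightarrow> 'n vector_field"
  where "cov_deriv g X Y x = (\<chi> k. \<Sum>i\<in>UNIV. X x $ i *
     (partial i (\<lambda>y. Y y $ k) x + (\<Sum>j\<in>UNIV. christoffel g i j k x * Y x $ j)))"

definition lie_bracket :: "'n::finite vector_field \<Rightarrow> 'n vector_field \<Rightarrow> 'n vector_field" where
  "lie_bracket X Y x = (\<chi> k. \<Sum>i\<in>UNIV.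
     X x $ i * partial i (\<lambda>y. Y y $ k) x - Y x $ i * partial i (\<lambda>y. X y $ k) x)"

definition depends_only_below ::
  "'n \<Rightarrow> (real^('n::{finite,linorder}) \<Rightarrow> real) \<Rightarrow> bool" where
  "depends_only_below k f \<longleftrightarrow> (\<forall>x y. (\<forall>l<k. x $ l = y $ l) \<longrightarrow> f x = f y)"

definition generalized_plane_wave :: "'n::{finite,linorder} metric \<Rightarrow> bool" where
  "generalized_plane_wave g \<longleftrightarrow> (\<forall>i j k.
     (\<not> k > max i j \<longrightarrow> (\<forall>x. cov_deriv g (coord_field i) (coord_field j) x $ k = 0)) \<and>
     depends_only_below k (\<lambda>x. cov_deriv g (coord_field i) (coord_field j) x $ k))"

lemma partial_const [simp]: "partial i (\<lambda>x. c) = (\<lambda>x. 0)"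
  by (simp add: partial_def fun_eq_iff)

lemma cov_deriv_coord_field:
  "cov_deriv g (coord_field i) (coord_field j) x $ k = christoffel g i j k x"
proof -
  have ite: "(if b then 1 else 0) * z = (if b then z else 0)"
    "z * (if b then 1 else 0) = (if b then z else 0)" for b and z :: real
    by auto
  show ?thesis by (simp add: cov_deriv_def coord_field_def axis_def ite)
qed

lemma pseudo_riemannian_sym:
  assumes "pseudo_riemannian p q g"
  shows "g x $ i $ j = g x $ j $ i"
proof -
  have "transpose (g x) = g x" using assms by (simp add: pseudo_riemannian_def)
  from arg_cong[OF this, of "\<lambda>M. M $ j $ i"] show ?thesis by (simp add: transpose_def)
qed

text \<open>The two properties characterising the Levi-Civita connection, in the coordinate frame.\<close>

lemma christoffel_torsion_free:
  assumes "pseudo_riemannian p q g"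
  shows "christoffel g i j k x = christoffel g j i k x"
proof -
  have "(\<lambda>y. g y $ i $ j) = (\<lambda>y. g y $ j $ i)"
    by (rule ext, rule pseudo_riemannian_sym[OF assms])
  then show ?thesis unfolding christoffel_def by (simp add: add.commute)
qed

lemma has_signature_imp_invertible:
  assumes "has_signature (G :: real^'n::finite^'n) p q"
  shows "invertible G"
proof -
  obtain A :: "real^'n^'n" and e :: "'n \<Rightarrow> real" where e: "\<And>i. e i = -1 \<or> e i = 1"
    and A: "transpose A ** G ** A = (\<chi> i j. if i = j then e i else 0)"
    using assms by (auto simp: has_signature_def)
  have "det (transpose A ** G ** A) = (\<Prod>i\<in>UNIV. e i)"
    unfolding A by (subst det_diagonal) auto
  also have "\<dots> \<noteq> 0"
  proof -
    have "e i \<noteq> 0" for i using e[of i] by auto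
    then show ?thesis by simp
  qed
  finally show ?thesis by (auto simp: det_mul invertible_det_nz)
qed

lemma christoffel_metric:
  assumes "pseudo_riemannian p q g"
  shows "partial k (\<lambda>y. g y $ i $ j) x =
    (\<Sum>l\<in>UNIV. christoffel g k i l x * g x $ l $ j) + (\<Sum>l\<in>UNIV. christoffel g k j l x * g x $ i $ l)"
proof -
  have sym: "g y $ a $ b = g y $ b $ a" for y a b
    by (rule pseudo_riemannian_sym[OF assms])
  have "invertible (g x)"
    using assms has_signature_imp_invertible unfolding pseudo_riemannian_def by blast
  then have inv: "g x ** inverse_metric g x = mat 1"
    unfolding inverse_metric_def invertible_def matrix_inv_def by (metis (mono_tags, lifting) someI_ex)
  have lower: "(\<Sum>l\<in>UNIV. christoffel g a b l x * g x $ c $ l) =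
      (1/2) * (partial a (\<lambda>y. g y $ b $ c) x + partial b (\<lambda>y. g y $ a $ c) x
               - partial c (\<lambda>y. g y $ a $ b) x)" for a b c
  proof -
    define T where "T l = partial a (\<lambda>y. g y $ b $ l) x + partial b (\<lambda>y. g y $ a $ l) x
               - partial l (\<lambda>y. g y $ a $ b) x" for l
    have d: "(\<Sum>l\<in>UNIV. g x $ c $ l * inverse_metric g x $ l $ n) = (if c = n then 1 else 0)" for n
      using arg_cong[OF inv, of "\<lambda>M. M $ c $ n"] by (simp add: matrix_matrix_mult_def mat_def)
    have "(\<Sum>l\<in>UNIV. christoffel g a b l x * g x $ c $ l) =
        (\<Sum>l\<in>UNIV. \<Sum>n\<in>UNIV. (1/2) * (g x $ c $ l * inverse_metric g x $ l $ n * T n))"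
      unfolding christoffel_def T_def[symmetric]
      by (simp add: sum_distrib_left sum_distrib_right mult_ac)
    also have "\<dots> = (\<Sum>n\<in>UNIV. (1/2) * ((\<Sum>l\<in>UNIV. g x $ c $ l * inverse_metric g x $ l $ n) * T n))"
      by (subst sum.swap) (simp add: sum_distrib_left sum_distrib_right)
    also have "\<dots> = (1/2) * T c"
      by (simp add: d if_distrib[of "\<lambda>z. z * _"] sum_divide_distrib[symmetric] cong: if_cong)
    finally show ?thesis by (simp add: T_def)
  qed
  have swap: "(\<lambda>y. g y $ a $ b) = (\<lambda>y. g y $ b $ a)" for a b
    by (rule ext, rule sym)
  have *: "(\<Sum>l\<in>UNIV. christoffel g k i l x * g x $ l $ j) =
      (\<Sum>l\<in>UNIV. christoffel g k i l x * g x $ j $ l)"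
    by (subst sym) (rule refl)
  have "a = (1/2) * (a + b - c) + (1/2) * (a + c - b)" for a b c :: real
    by argo
  then show ?thesis
    unfolding * lower swap[of j i] swap[of i k] swap[of j k] .
qed


subsection \<open>Curvature\<close>

definition curvature ::
  "'n::finite metric \<Rightarrow> 'n vector_field \<Rightarrow> 'n vector_field \<Rightarrow> 'n vector_field \<Rightarrow> 'n vector_field"
  where "curvature g X Y Z x =
     cov_deriv g X (cov_deriv g Y Z) x - cov_deriv g Y (cov_deriv g X Z) x
     - cov_deriv g (lie_bracket X Y) Z x"

text \<open>The argument \<open>T\<close> is a tensor field with one upper index, \<open>T is k\<close> being the component with
  lower indices \<open>is\<close> and upper index \<open>k\<close>; the value \<open>tensor_deriv g T j is k\<close> is the component
  of $\nabla_{\partial_j} T$.\<close>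

definition tensor_deriv :: "'n::finite metric \<Rightarrow> ('n list \<Rightarrow> 'n \<Rightarrow> real^'n \<Rightarrow> real) \<Rightarrow>
    'n \<Rightarrow> 'n list \<Rightarrow> 'n \<Rightarrow> real^'n \<Rightarrow> real" where
  "tensor_deriv g T j is k x = partial j (T is k) x
     + (\<Sum>a\<in>UNIV. christoffel g j a k x * T is a x)
     - (\<Sum>r<length is. \<Sum>a\<in>UNIV. christoffel g j (is ! r) a x * T (is[r := a]) k x)"

text \<open>\<open>nabla_curvature g \<nu>\<close> is the tensor $\nabla^\nu R$, with lower indices
  $[j_1, \dots, j_\nu, i_1, i_2, i_3]$, the outermost derivative coming first.\<close>

primrec nabla_curvature :: "'n::finite metric \<Rightarrow> nat \<Rightarrow> 'n list \<Rightarrow> 'n \<Rightarrow> real^'n \<Rightarrow> real" where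
  "nabla_curvature g 0 = (\<lambda>is k x.
     curvature g (coord_field (is ! 0)) (coord_field (is ! 1)) (coord_field (is ! 2)) x $ k)"
| "nabla_curvature g (Suc \<nu>) = (\<lambda>is. tensor_deriv g (nabla_curvature g \<nu>) (hd is) (tl is))"

text \<open>\<open>curv_comp g i\<^sub>1 i\<^sub>2 i\<^sub>3 k js\<close> is $R_{i_1i_2i_3}{}^k{}_{;j_1 \dots j_\nu}$.\<close>

definition curv_comp ::
  "'n::finite metric \<Rightarrow> 'n \<Rightarrow> 'n \<Rightarrow> 'n \<Rightarrow> 'n \<Rightarrow> 'n list \<Rightarrow> real^'n \<Rightarrow> real" where
  "curv_comp g i\<^sub>1 i\<^sub>2 i\<^sub>3 k js = nabla_curvature g (length js) (js @ [i\<^sub>1, i\<^sub>2, i\<^sub>3]) k"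

text \<open>The tensors $R(u,v)w$ and $(\nabla_\xi R)(u,v)w$ on tangent vectors at \<open>P\<close>.\<close>

definition curvature_at ::
  "'n::finite metric \<Rightarrow> real^'n \<Rightarrow> real^'n \<Rightarrow> real^'n \<Rightarrow> real^'n \<Rightarrow> real^'n" where
  "curvature_at g P u v w = (\<chi> k. \<Sum>a\<in>UNIV. \<Sum>b\<in>UNIV. \<Sum>c\<in>UNIV.
     u $ a * v $ b * w $ c * curv_comp g a b c k [] P)"

definition nabla_curvature_at ::
  "'n::finite metric \<Rightarrow> real^'n \<Rightarrow> real^'n \<Rightarrow> real^'n \<Rightarrow> real^'n \<Rightarrow> real^'n \<Rightarrow> real^'n" where
  "nabla_curvature_at g P \<xi> u v w = (\<chi> k. \<Sum>j\<in>UNIV. \<Sum>a\<in>UNIV. \<Sum>b\<in>UNIV. \<Sum>c\<in>UNIV.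
     \<xi> $ j * u $ a * v $ b * w $ c * curv_comp g a b c k [j] P)"

definition jacobi_operator :: "'n::finite metric \<Rightarrow> real^'n \<Rightarrow> real^'n \<Rightarrow> real^'n \<Rightarrow> real^'n" where
  "jacobi_operator g P \<xi> = (\<lambda>x. curvature_at g P x \<xi> \<xi>)"

definition szabo_operator :: "'n::finite metric \<Rightarrow> real^'n \<Rightarrow> real^'n \<Rightarrow> real^'n \<Rightarrow> real^'n" where
  "szabo_operator g P \<xi> = (\<lambda>x. nabla_curvature_at g P \<xi> x \<xi> \<xi>)"

definition skew_curvature_operator ::
  "'n::finite metric \<Rightarrow> real^'n \<Rightarrow> real^'n \<Rightarrow> real^'n \<Rightarrow> real^'n \<Rightarrow> real^'n" where
  "skew_curvature_operator g P e\<^sub>1 e\<^sub>2 = (\<lambda>x. curvature_at g P e\<^sub>1 e\<^sub>2 x)"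

definition nilpotent_operator :: "(real^'n::finite \<Rightarrow> real^'n) \<Rightarrow> bool" where
  "nilpotent_operator A \<longleftrightarrow> (\<forall>x. (A ^^ CARD('n)) x = 0)"

definition nilpotent_osserman :: "'n::finite metric \<Rightarrow> bool" where
  "nilpotent_osserman g \<longleftrightarrow> (\<forall>P \<xi>. nilpotent_operator (jacobi_operator g P \<xi>))"

definition nilpotent_szabo :: "'n::finite metric \<Rightarrow> bool" where
  "nilpotent_szabo g \<longleftrightarrow> (\<forall>P \<xi>. nilpotent_operator (szabo_operator g P \<xi>))"

text \<open>Oriented orthonormal bases of spacelike (\<open>c = 1\<close>) and timelike (\<open>c = -1\<close>) 2-planes.\<close>

definition nilpotent_ivanov_petrova :: "'n::finite metric \<Rightarrow> bool" where
  "nilpotent_ivanov_petrova g \<longleftrightarrow> (\<forall>P e\<^sub>1 e\<^sub>2. \<forall>c\<in>{1, -1}.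
     metric_at g P e\<^sub>1 e\<^sub>1 = c \<and> metric_at g P e\<^sub>2 e\<^sub>2 = c \<and> metric_at g P e\<^sub>1 e\<^sub>2 = 0 \<longrightarrow>
     nilpotent_operator (skew_curvature_operator g P e\<^sub>1 e\<^sub>2))"

definition ricci :: "'n::finite metric \<Rightarrow> 'n \<Rightarrow> 'n \<Rightarrow> real^'n \<Rightarrow> real" where
  "ricci g i j x = (\<Sum>k\<in>UNIV. curv_comp g k i j k [] x)"

definition ricci_flat :: "'n::finite metric \<Rightarrow> bool" where
  "ricci_flat g \<longleftrightarrow> (\<forall>i j x. ricci g i j x = 0)"

definition einstein :: "'n::finite metric \<Rightarrow> bool" where
  "einstein g \<longleftrightarrow> (\<exists>c::real. \<forall>i j x. ricci g i j x = c * g x $ i $ j)"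


subsection \<open>Weyl scalar invariants\<close>

text \<open>
  A monomial is a list of factors with formal index names in \<open>nat\<close>: \<open>Curv i\<^sub>1 i\<^sub>2 i\<^sub>3 k js\<close> stands for
  $R_{i_1i_2i_3}{}^k{}_{;js}$, \<open>GUp i j\<close> for $g^{ij}$ and \<open>GLow i j\<close> for $g_{ij}$. All indices are
  contracted when every name occurs exactly once in an upper and once in a lower position, and the
  value is then the Einstein sum. For instance $\tau = g^{ij} R_{kij}{}^k$ is
  \<open>[GUp 0 1, Curv 2 0 1 2 []]\<close>.
\<close>

datatype factor =
    Curv nat nat nat nat "nat list"
  | GUp nat nat
  | GLow nat nat

fun upper_names :: "factor \<Rightarrow> nat list" where
  "upper_names (Curv i\<^sub>1 i\<^sub>2 i\<^sub>3 k js) = [k]"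
| "upper_names (GUp i j) = [i, j]"
| "upper_names (GLow i j) = []"

fun lower_names :: "factor \<Rightarrow> nat list" where
  "lower_names (Curv i\<^sub>1 i\<^sub>2 i\<^sub>3 k js) = [i\<^sub>1, i\<^sub>2, i\<^sub>3] @ js"
| "lower_names (GUp i j) = []"
| "lower_names (GLow i j) = [i, j]"

fun factor_value :: "'n::finite metric \<Rightarrow> real^'n \<Rightarrow> (nat \<Rightarrow> 'n) \<Rightarrow> factor \<Rightarrow> real" where
  "factor_value g P \<sigma> (Curv i\<^sub>1 i\<^sub>2 i\<^sub>3 k js) =
     curv_comp g (\<sigma> i\<^sub>1) (\<sigma> i\<^sub>2) (\<sigma> i\<^sub>3) (\<sigma> k) (map \<sigma> js) P"
| "factor_value g P \<sigma> (GUp i j) = inverse_metric g P $ \<sigma> i $ \<sigma> j"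
| "factor_value g P \<sigma> (GLow i j) = g P $ \<sigma> i $ \<sigma> j"

definition weyl_monomial :: "factor list \<Rightarrow> bool" where
  "weyl_monomial fs \<longleftrightarrow>
     distinct (concat (map upper_names fs)) \<and>
     distinct (concat (map lower_names fs)) \<and>
     set (concat (map upper_names fs)) = set (concat (map lower_names fs)) \<and>
     (\<exists>i\<^sub>1 i\<^sub>2 i\<^sub>3 k js. Curv i\<^sub>1 i\<^sub>2 i\<^sub>3 k js \<in> set fs)"

definition monomial_value :: "'n::finite metric \<Rightarrow> factor list \<Rightarrow> real^'n \<Rightarrow> real" where
  "monomial_value g fs P =
     (\<Sum>\<sigma> \<in> PiE (set (concat (map upper_names fs))) (\<lambda>_. UNIV).
        prod_list (map (factor_value g P \<sigma>) fs))"

text \<open>Linear combinations of monomials, as lists of coefficients and monomials.\<close>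

definition weyl_invariant :: "'n::finite metric \<Rightarrow> (real^'n \<Rightarrow> real) \<Rightarrow> bool" where
  "weyl_invariant g W \<longleftrightarrow> (\<exists>cs :: (real \<times> factor list) list.
     (\<forall>(c, fs) \<in> set cs. weyl_monomial fs) \<and>
     W = (\<lambda>P. \<Sum>(c, fs)\<leftarrow>cs. c * monomial_value g fs P))"

definition vsi :: "'n::finite metric \<Rightarrow> bool" where
  "vsi g \<longleftrightarrow> (\<forall>W. weyl_invariant g W \<longrightarrow> (\<forall>P. W P = 0))"


subsection \<open>Parallel translation, geodesics, holonomy\<close>

definition christoffel_map :: "'n::finite metric \<Rightarrow> real^'n \<Rightarrow> real^'n \<Rightarrow> real^'n \<Rightarrow> real^'n" where
  "christoffel_map g P u v = (\<chi> k. \<Sum>i\<in>UNIV. \<Sum>j\<in>UNIV. christoffel g i j k P * u $ i * v $ j)"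

text \<open>The condition is $V' + \Gamma(\gamma', V) = 0$, that is, $\nabla_{\gamma'} V = 0$.\<close>

definition parallel_along ::
  "'n::finite metric \<Rightarrow> real set \<Rightarrow> (real \<Rightarrow> real^'n) \<Rightarrow> (real \<Rightarrow> real^'n) \<Rightarrow> bool" where
  "parallel_along g S \<gamma> V \<longleftrightarrow> (\<forall>t\<in>S.
     (V has_vector_derivative
        - christoffel_map g (\<gamma> t) (vector_derivative \<gamma> (at t within S)) (V t)) (at t within S))"

definition geodesic_on :: "'n::finite metric \<Rightarrow> real set \<Rightarrow> (real \<Rightarrow> real^'n) \<Rightarrow> bool" where
  "geodesic_on g S \<gamma> \<longleftrightarrow> smooth_curve_on S \<gamma> \<and>
     parallel_along g S \<gamma> (\<lambda>t. vector_derivative \<gamma> (at t within S))"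

definition complete_metric :: "'n::finite metric \<Rightarrow> bool" where
  "complete_metric g \<longleftrightarrow> (\<forall>S \<gamma>. is_interval S \<and> interior S \<noteq> {} \<and> geodesic_on g S \<gamma> \<longrightarrow>
     (\<exists>\<eta>. geodesic_on g UNIV \<eta> \<and> (\<forall>t\<in>S. \<eta> t = \<gamma> t)))"

definition strongly_geodesically_convex :: "'n::finite metric \<Rightarrow> bool" where
  "strongly_geodesically_convex g \<longleftrightarrow> (\<forall>P Q. \<exists>\<gamma>.
     geodesic_on g {0..1} \<gamma> \<and> \<gamma> 0 = P \<and> \<gamma> 1 = Q \<and>
     (\<forall>\<eta>. geodesic_on g {0..1} \<eta> \<and> \<eta> 0 = P \<and> \<eta> 1 = Q \<longrightarrow> (\<forall>t\<in>{0..1}. \<eta> t = \<gamma> t)))"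

definition parallel_translation ::
  "'n::finite metric \<Rightarrow> (real \<Rightarrow> real^'n) \<Rightarrow> real^'n \<Rightarrow> real^'n" where
  "parallel_translation g \<gamma> v = (THE w. \<exists>V. parallel_along g {0..1} \<gamma> V \<and> V 0 = v \<and> V 1 = w)"

definition holonomy :: "'n::finite metric \<Rightarrow> real^'n \<Rightarrow> (real^'n \<Rightarrow> real^'n) set" where
  "holonomy g P = {parallel_translation g \<gamma> | \<gamma>. smooth_curve_on {0..1} \<gamma> \<and> \<gamma> 0 = P \<and> \<gamma> 1 = P}"

text \<open>The transpose of \<open>matrix H\<close>: row \<open>i\<close> consists of the coefficients of $H \partial_i$.\<close>

definition row_matrix :: "(real^'n \<Rightarrow> real^'n) \<Rightarrow> real^'n^'n::finite" where
  "row_matrix H = (\<chi> i j. H (axis i 1) $ j)"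

definition unipotent_upper :: "(real^('n::{finite,linorder})^('n::{finite,linorder})) set" where
  "unipotent_upper = {A. \<forall>i j. (j < i \<longrightarrow> A $ i $ j = 0) \<and> A $ i $ i = 1}"

end

theory Submission
  imports Defs
begin

text \<open>
  Let \<open>V\<^sub>k\<close> be the span of \<open>\<partial>\<^sub>k, \<dots>, \<partial>\<^sub>m\<close>. The hypothesis on the Christoffel symbols makes every
  system of equations attached to the connection triangular with respect to this flag: the
  equation for the \<open>k\<close>-th component involves only components and coordinates with smaller index.

  For parallel transport and for geodesics this reduces the differential equations to repeated
  integration. Given the components below \<open>k\<close>, the \<open>k\<close>-th component has a known first,
  respectively second, derivative, so solutions exist for all times, and they are unique because the
  difference of two solutions that agree below \<open>k\<close> is constant, respectively affine, in the \<open>k\<close>-th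
  component (\<open>parallel_along_exists\<close>, \<open>geodesic_exists\<close>, \<open>geodesic_difference_affine\<close>). Two constants
  of integration per coordinate can be adapted to initial values, which gives completeness, or to
  the two end points, which gives strong convexity. A component that starts at zero together with all
  earlier ones remains zero, so parallel transport is unipotent, and with it the holonomy.

  Triangularity is preserved by covariant differentiation (\<open>triangular_tensor_deriv\<close>). It makes
  the Jacobi, Szabo and skew-symmetric curvature operators strictly triangular, hence nilpotent,
  and leaves only zeros on the diagonal over which the Ricci tensor sums.

  The vanishing of the Weyl invariants is the deeper part, since \<open>g\<close> itself need not respect the
  flag. The argument is pointwise. Gram-Schmidt orthogonalisation adapted to the flag
  produces a basis \<open>e\<close>, triangular over the coordinate basis, in which \<open>g\<close> is monomial: \<open>e\<^sub>i\<close> pairs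
  nontrivially only with \<open>e\<^bsub>w i\<^esub>\<close> for an involution \<open>w\<close> (\<open>symmetric_triangular_congruence\<close>). In this basis
  assign to \<open>e\<^sub>i\<close> the weight \<open>K ^ i - K ^ (w i)\<close> with a large constant \<open>K\<close>, and to a tensor
  component the weights of its upper indices minus those of its lower indices. The nonzero
  components of \<open>g\<close> and of its inverse have weight zero because the weight is odd under \<open>w\<close>, and a full
  contraction is a sum of products of total weight zero. A nonzero component of \<open>\<nabla>\<^sup>\<nu>R\<close>, however, has
  positive weight (\<open>boost_weight_curvature\<close>): triangularity gives that its lower indices precede its
  upper index \<open>k\<close>, and skew-symmetry of \<open>R(X, Y)\<close> and of its derivatives with respect to \<open>g\<close>
  (\<open>curv_comp_skew\<close>) gives moreover \<open>w k < w i\<^sub>3\<close>. So each product contains a vanishing factor.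
\<close>

section \<open>Iterated partial derivatives\<close>

text \<open>
  Differentiability of all partial derivatives of order less than \<open>n\<close>. Peeling off the
  innermost derivative first lets closure properties be proved by induction on \<open>n\<close>, since the
  partial derivatives of a sum, product or inverse are again built from functions one level down.
\<close>

primrec cdiff :: "nat \<Rightarrow> (real^'n::finite \<Rightarrow> real) \<Rightarrow> bool" where
  "cdiff 0 f \<longleftrightarrow> True"
| "cdiff (Suc n) f \<longleftrightarrow> (\<forall>x. f differentiable at x) \<and> (\<forall>i. cdiff n (partial i f))"

lemma cdiff_iff_foldr:
  "cdiff n f \<longleftrightarrow> (\<forall>is x. length is < n \<longrightarrow> foldr partial is f differentiable at x)"
proof (induction n arbitrary: f)
  case 0
  then show ?case by simp
next
  case (Suc n)
  have *: "(\<forall>is x. length is < Suc n \<longrightarrow> foldr partial is f differentiable at x) \<longleftrightarrow>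
     (\<forall>x. f differentiable at x) \<and>
     (\<forall>i is x. length is < n \<longrightarrow> foldr partial is (partial i f) differentiable at x)" (is "?l \<longleftrightarrow> ?r")
  proof
    assume l: ?l
    have "foldr partial (is @ [i]) f differentiable at x" if "length is < n" for i "is" x
      using l[rule_format, of "is @ [i]" x] that by simp
    moreover have "f differentiable at x" for x
      using l[rule_format, of "[]" x] by simp
    ultimately show ?r by simp
  next
    assume r: ?r
    show ?l
    proof (intro allI impI)
      fix "is" :: "'a list" and x
      assume "length is < Suc n"
      then show "foldr partial is f differentiable at x"
        using r by (cases "is" rule: rev_cases) auto
    qed
  qed
  show ?case unfolding * by (simp add: Suc.IH)
qed

lemma smooth_iff_cdiff: "smooth f \<longleftrightarrow> (\<forall>n. cdiff n f)"
  unfolding smooth_def cdiff_iff_foldr by blast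

lemma smooth_differentiable: "smooth f \<Longrightarrow> f differentiable at x"
  unfolding smooth_def by (metis foldr_Nil id_apply)

lemma smooth_partial: "smooth f \<Longrightarrow> smooth (partial i f)"
  unfolding smooth_iff_cdiff by (metis cdiff.simps(2))

lemma smooth_continuous: "smooth f \<Longrightarrow> continuous (at x) f"
  by (simp add: differentiable_imp_continuous_within smooth_differentiable)

lemma cdiff_mono: "cdiff (Suc n) f \<Longrightarrow> cdiff n f"
  by (simp add: cdiff_iff_foldr)

lemma partial_eqI:
  "(f has_derivative f') (at x) \<Longrightarrow> partial i f x = f' (axis i 1)"
  unfolding partial_def using frechet_derivative_at by metis

lemma differentiable_has_derivative:
  "f differentiable at x \<Longrightarrow> (f has_derivative frechet_derivative f (at x)) (at x)"
  using frechet_derivative_works by blast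

lemma partial_add:
  assumes "f differentiable at x" "g differentiable at x"
  shows "partial i (\<lambda>x. f x + g x) x = partial i f x + partial i g x"
  using partial_eqI[OF has_derivative_add[OF assms[THEN differentiable_has_derivative]]]
  by (simp add: partial_def)

lemma partial_mult:
  assumes "f differentiable at x" "g differentiable at x"
  shows "partial i (\<lambda>x. f x * g x) x = partial i f x * g x + f x * partial i g x"
  using partial_eqI[OF has_derivative_mult[OF assms[THEN differentiable_has_derivative]]]
  by (simp add: partial_def)

lemma partial_sum:
  assumes "\<And>a. a \<in> A \<Longrightarrow> f a differentiable at x"
  shows "partial i (\<lambda>x. \<Sum>a\<in>A. f a x) x = (\<Sum>a\<in>A. partial i (f a) x)"
  using partial_eqI[OF has_derivative_sum[OF differentiable_has_derivative[OF assms]]]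
  by (simp add: partial_def)

lemma partial_inverse:
  assumes "f differentiable at x" "f x \<noteq> 0"
  shows "partial i (\<lambda>x. inverse (f x)) x = - (partial i f x * (inverse (f x) * inverse (f x)))"
  using partial_eqI[OF Deriv.has_derivative_inverse[OF assms(2) differentiable_has_derivative[OF assms(1)]]]
  by (simp add: partial_def algebra_simps)

lemma cdiff_const: "cdiff n (\<lambda>x. c)"
  by (induction n arbitrary: c) auto

lemma cdiff_add: "cdiff n f \<Longrightarrow> cdiff n g \<Longrightarrow> cdiff n (\<lambda>x. f x + g x)"
proof (induction n arbitrary: f g)
  case (Suc n)
  have "partial i (\<lambda>x. f x + g x) = (\<lambda>x. partial i f x + partial i g x)" for i
    using Suc.prems by (intro ext partial_add) auto
  then show ?case using Suc by (auto intro: differentiable_add)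
qed simp

lemma cdiff_mult: "cdiff n f \<Longrightarrow> cdiff n g \<Longrightarrow> cdiff n (\<lambda>x. f x * g x)"
proof (induction n arbitrary: f g)
  case (Suc n)
  have p: "partial i (\<lambda>x. f x * g x) = (\<lambda>x. partial i f x * g x + f x * partial i g x)" for i
    using Suc.prems by (intro ext partial_mult) auto
  have "cdiff n f" "cdiff n g"
    using Suc.prems by (auto intro: cdiff_mono simp del: cdiff.simps)
  then show ?case using Suc by (auto simp: p intro!: differentiable_mult cdiff_add)
qed simp

lemma cdiff_inverse:
  "cdiff n f \<Longrightarrow> (\<And>x. f x \<noteq> 0) \<Longrightarrow> cdiff n (\<lambda>x. inverse (f x))"
proof (induction n)
  case (Suc n)
  have p: "partial i (\<lambda>x. inverse (f x)) =
      (\<lambda>x. (-1) * (partial i f x * (inverse (f x) * inverse (f x))))" for i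
    using Suc.prems by (auto simp: partial_inverse)
  have "cdiff n (\<lambda>x. inverse (f x))"
    using Suc.prems by (intro Suc.IH) (auto intro: cdiff_mono simp del: cdiff.simps)
  then have "cdiff n (partial i (\<lambda>x. inverse (f x)))" for i
    using Suc.prems unfolding p by (intro cdiff_mult cdiff_const) auto
  then show ?case using Suc.prems by (auto intro: differentiable_inverse)
qed simp

lemma smooth_const [intro]: "smooth (\<lambda>x. c)"
  and smooth_add [intro]: "smooth f \<Longrightarrow> smooth g \<Longrightarrow> smooth (\<lambda>x. f x + g x)"
  and smooth_mult [intro]: "smooth f \<Longrightarrow> smooth g \<Longrightarrow> smooth (\<lambda>x. f x * g x)"
  and smooth_inverse: "smooth f \<Longrightarrow> (\<And>x. f x \<noteq> 0) \<Longrightarrow> smooth (\<lambda>x. inverse (f x))"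
  by (simp_all add: smooth_iff_cdiff cdiff_const cdiff_add cdiff_mult cdiff_inverse)

lemma smooth_diff [intro]: "smooth f \<Longrightarrow> smooth g \<Longrightarrow> smooth (\<lambda>x. f x - g x)"
  using smooth_add[OF _ smooth_mult[OF smooth_const[of "-1"]], of f g] by simp

lemma smooth_sum [intro]: "(\<And>a. a \<in> A \<Longrightarrow> smooth (f a)) \<Longrightarrow> smooth (\<lambda>x. \<Sum>a\<in>A. f a x)"
  by (induction A rule: infinite_finite_induct) auto

lemma smooth_prod [intro]: "(\<And>a. a \<in> A \<Longrightarrow> smooth (f a)) \<Longrightarrow> smooth (\<lambda>x. \<Prod>a\<in>A. f a x)"
  by (induction A rule: infinite_finite_induct) auto

text \<open>
  The Leibniz expansion is a polynomial in the entries.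
\<close>

lemma smooth_det:
  assumes "\<And>i j. smooth (\<lambda>x. M x $ i $ j)"
  shows "smooth (\<lambda>x. det (M x :: real^'m::finite^'m))"
  unfolding det_def by (intro smooth_sum smooth_mult smooth_const smooth_prod assms)

lemma has_derivative_along:
  assumes "f differentiable at (p + s *\<^sub>R axis i 1)"
  shows "((\<lambda>s. f (p + s *\<^sub>R axis i 1)) has_real_derivative partial i f (p + s *\<^sub>R axis i 1)) (at s)"
proof -
  let ?D = "frechet_derivative f (at (p + s *\<^sub>R axis i 1))"
  have D: "(f has_derivative ?D) (at (p + s *\<^sub>R axis i 1))"
    using assms by (rule differentiable_has_derivative)
  have l: "((\<lambda>s. p + s *\<^sub>R axis i 1) has_derivative (\<lambda>h. h *\<^sub>R axis i 1)) (at s)"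
    by (auto intro!: derivative_eq_intros)
  have "((\<lambda>s. f (p + s *\<^sub>R axis i 1)) has_derivative (\<lambda>h. ?D (h *\<^sub>R axis i 1))) (at s)"
    using has_derivative_compose[OF l D] .
  moreover have "(\<lambda>h. ?D (h *\<^sub>R axis i 1)) = (*) (partial i f (p + s *\<^sub>R axis i 1))"
    using linear_scale[OF has_derivative_linear[OF D]] by (auto simp: partial_def fun_eq_iff)
  ultimately show ?thesis by (simp add: has_field_derivative_def)
qed

text \<open>
  The mean value theorem, once in each direction, for the second difference of \<open>f\<close> over a small
  square. The left side is symmetric in the two directions, which is what Schwarz's theorem
  exploits.
\<close>

lemma second_difference_mvt:
  fixes f :: "real^'n::finite \<Rightarrow> real"
  assumes f: "smooth f" and h: "0 < h"
  shows "\<exists>s t. 0 < s \<and> s < h \<and> 0 < t \<and> t < h \<and>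
    f (x + h *\<^sub>R axis i 1 + h *\<^sub>R axis j 1) - f (x + h *\<^sub>R axis i 1)
      - f (x + h *\<^sub>R axis j 1) + f x
    = h * h * partial j (partial i f) (x + s *\<^sub>R axis i 1 + t *\<^sub>R axis j 1)"
proof -
  let ?i = "axis i 1 :: real^'n" and ?j = "axis j 1 :: real^'n"
  define F where "F s = f ((x + h *\<^sub>R ?j) + s *\<^sub>R ?i) - f (x + s *\<^sub>R ?i)" for s
  have F: "(F has_real_derivative
      partial i f ((x + h *\<^sub>R ?j) + s *\<^sub>R ?i) - partial i f (x + s *\<^sub>R ?i)) (at s)" for s
    unfolding F_def by (intro DERIV_diff has_derivative_along smooth_differentiable f)
  from MVT2[OF h F] obtain s where s: "0 < s" "s < h"
    and Fs: "F h - F 0 = h * (partial i f ((x + h *\<^sub>R ?j) + s *\<^sub>R ?i) - partial i f (x + s *\<^sub>R ?i))"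
    by auto
  define G where "G t = partial i f ((x + s *\<^sub>R ?i) + t *\<^sub>R ?j)" for t
  have G: "(G has_real_derivative partial j (partial i f) ((x + s *\<^sub>R ?i) + t *\<^sub>R ?j)) (at t)" for t
    unfolding G_def by (intro has_derivative_along smooth_differentiable smooth_partial f)
  from MVT2[OF h G] obtain t where t: "0 < t" "t < h"
    and Gt: "G h - G 0 = h * partial j (partial i f) ((x + s *\<^sub>R ?i) + t *\<^sub>R ?j)"
    by auto
  have "F h - F 0 = h * (G h - G 0)"
    unfolding Fs G_def by (simp add: add_ac)
  then show ?thesis
    unfolding Gt using s t by (intro exI[of _ s] exI[of _ t]) (simp add: F_def add_ac)
qed

text \<open>
  Schwarz's theorem: over squares shrinking to \<open>x\<close>, both mixed partial derivatives are limits of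
  the same second difference quotient, by continuity.
\<close>

lemma partial_commute:
  assumes f: "smooth f"
  shows "partial i (partial j f) x = partial j (partial i f) x"
proof (rule ccontr)
  let ?A = "partial j (partial i f)" and ?B = "partial i (partial j f)"
  assume ne: "?B x \<noteq> ?A x"
  define e where "e = \<bar>?B x - ?A x\<bar> / 2"
  have e: "e > 0" using ne by (simp add: e_def)
  have cA: "continuous (at x) ?A" and cB: "continuous (at x) ?B"
    by (intro smooth_continuous smooth_partial f)+
  obtain d1 where d1: "d1 > 0" "\<And>y. dist y x < d1 \<Longrightarrow> dist (?A y) (?A x) < e"
    using cA e unfolding continuous_at_eps_delta by blast
  obtain d2 where d2: "d2 > 0" "\<And>y. dist y x < d2 \<Longrightarrow> dist (?B y) (?B x) < e"
    using cB e unfolding continuous_at_eps_delta by blast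
  define h where "h = min d1 d2 / 2"
  have h: "h > 0" "2 * h \<le> d1" "2 * h \<le> d2" using d1 d2 by (auto simp: h_def)
  have close: "dist (x + s *\<^sub>R axis a 1 + t *\<^sub>R axis b 1) x < 2 * h"
    if "0 < s" "s < h" "0 < t" "t < h" for s t :: real and a b :: 'a
  proof -
    have "norm (s *\<^sub>R axis a 1 + t *\<^sub>R axis b 1 :: real^'a) \<le> s + t"
      using norm_triangle_ineq[of "s *\<^sub>R axis a 1 :: real^'a" "t *\<^sub>R axis b 1"] that
      by (simp add: norm_axis_1)
    then show ?thesis using that by (simp add: dist_norm add.assoc)
  qed
  obtain s t where st: "0 < s" "s < h" "0 < t" "t < h" and
    A: "f (x + h *\<^sub>R axis i 1 + h *\<^sub>R axis j 1) - f (x + h *\<^sub>R axis i 1)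
      - f (x + h *\<^sub>R axis j 1) + f x = h * h * ?A (x + s *\<^sub>R axis i 1 + t *\<^sub>R axis j 1)"
    using second_difference_mvt[OF f h(1), of x i j] by blast
  obtain s' t' where st': "0 < s'" "s' < h" "0 < t'" "t' < h" and
    B: "f (x + h *\<^sub>R axis j 1 + h *\<^sub>R axis i 1) - f (x + h *\<^sub>R axis j 1)
      - f (x + h *\<^sub>R axis i 1) + f x = h * h * ?B (x + s' *\<^sub>R axis j 1 + t' *\<^sub>R axis i 1)"
    using second_difference_mvt[OF f h(1), of x j i] by blast
  have c: "x + h *\<^sub>R axis j 1 + h *\<^sub>R axis i 1 = x + h *\<^sub>R axis i 1 + h *\<^sub>R axis j 1"
    by (simp add: add_ac)
  have "h * h * ?A (x + s *\<^sub>R axis i 1 + t *\<^sub>R axis j 1) =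
      h * h * ?B (x + s' *\<^sub>R axis j 1 + t' *\<^sub>R axis i 1)"
    using A B unfolding c by linarith
  with h have eq: "?A (x + s *\<^sub>R axis i 1 + t *\<^sub>R axis j 1) = ?B (x + s' *\<^sub>R axis j 1 + t' *\<^sub>R axis i 1)"
    by simp
  have "dist (?A (x + s *\<^sub>R axis i 1 + t *\<^sub>R axis j 1)) (?A x) < e"
    using close[OF st] h by (intro d1) (meson less_le_trans)
  moreover have "dist (?B (x + s' *\<^sub>R axis j 1 + t' *\<^sub>R axis i 1)) (?B x) < e"
    using close[OF st'] h by (intro d2) (meson less_le_trans)
  ultimately show False
    unfolding eq e_def dist_real_def by (smt (verit) field_sum_of_halves)
qed

section \<open>Smoothness of the Christoffel symbols\<close>

lemma pseudo_riemannian_inverse: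
  assumes "pseudo_riemannian p q g"
  shows "g x ** inverse_metric g x = mat 1" "inverse_metric g x ** g x = mat 1"
proof -
  have "invertible (g x)"
    using assms has_signature_imp_invertible unfolding pseudo_riemannian_def by blast
  then show "g x ** inverse_metric g x = mat 1" "inverse_metric g x ** g x = mat 1"
    unfolding inverse_metric_def invertible_def matrix_inv_def by (metis (mono_tags, lifting) someI_ex)+
qed

text \<open>
  By Cramer's rule the entries of the inverse matrix are quotients of determinants, and
  nondegeneracy keeps the denominator away from zero.
\<close>

lemma smooth_inverse_metric:
  assumes g: "pseudo_riemannian p q g"
  shows "smooth (\<lambda>x. inverse_metric g x $ k $ l)"
proof -
  have nz: "det (g x) \<noteq> 0" for x
    using pseudo_riemannian_inverse[OF g, of x] invertible_det_nz invertible_def by blast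
  have "g x *v (inverse_metric g x *v axis l 1) = axis l 1" for x
    by (simp add: matrix_vector_mul_assoc pseudo_riemannian_inverse[OF g])
  then have "inverse_metric g x *v axis l 1 =
      (\<chi> k. det (\<chi> i j. if j = k then axis l 1 $ i else g x $ i $ j) / det (g x))" for x
    using cramer[OF nz] by blast
  then have eq: "inverse_metric g x $ k $ l =
      det (\<chi> i j. if j = k then axis l 1 $ i else g x $ i $ j) * inverse (det (g x))" for x
    by (simp add: matrix_vector_mul_component vec_eq_iff matrix_vector_mult_basis column_def divide_inverse)
  have "smooth (\<lambda>x. (\<chi> i j. if j = k then axis l 1 $ i else g x $ i $ j) $ a $ b)" for a b
    using g by (cases "b = k") (auto simp: pseudo_riemannian_def)
  then have "smooth (\<lambda>x. det (\<chi> i j. if j = k then axis l 1 $ i else g x $ i $ j))"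
    by (rule smooth_det)
  moreover have "smooth (\<lambda>x. det (g x))"
    using g by (intro smooth_det) (simp add: pseudo_riemannian_def)
  ultimately show ?thesis
    unfolding eq by (intro smooth_mult smooth_inverse nz)
qed

lemma smooth_metric: "pseudo_riemannian p q g \<Longrightarrow> smooth (\<lambda>x. g x $ i $ j)"
  by (simp add: pseudo_riemannian_def)

lemma smooth_christoffel:
  assumes g: "pseudo_riemannian p q g"
  shows "smooth (christoffel g i j k)"
  unfolding christoffel_def[abs_def]
  by (intro smooth_mult smooth_const smooth_sum smooth_inverse_metric[OF g] smooth_add smooth_diff
      smooth_partial smooth_metric[OF g])

section \<open>Triangularity of the curvature tensor and of its derivatives\<close>

text \<open>
  The restrictions of \<open>f\<close> to the coordinate lines through two points agreeing below \<open>k\<close> are the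
  same function of the line parameter.
\<close>

lemma depends_only_below_partial:
  assumes f: "\<And>x. f differentiable at x" and dep: "depends_only_below k f"
  shows "depends_only_below k (partial i f)"
  unfolding depends_only_below_def
proof (intro allI impI)
  fix x y :: "(real, 'a) vec" assume xy: "\<forall>l<k. x $ l = y $ l"
  have "f (x + s *\<^sub>R axis i 1) = f (y + s *\<^sub>R axis i 1)" for s
    using dep xy by (simp add: depends_only_below_def)
  then show "partial i f x = partial i f y"
    using has_derivative_along[OF f, of x i 0] has_derivative_along[OF f, of y i 0]
    by (simp add: DERIV_unique)
qed

lemma partial_eq_0_if_depends_only_below:
  assumes f: "\<And>x. f differentiable at x" and dep: "depends_only_below k f" and i: "\<not> i < k"
  shows "partial i f x = 0"
proof -
  have "f (x + s *\<^sub>R axis i 1) = f x" for s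
    using dep i unfolding depends_only_below_def by (auto simp: axis_def)
  then show ?thesis
    using has_derivative_along[OF f, of x i 0] by (simp add: DERIV_unique)
qed

lemma plane_wave_christoffel:
  assumes "generalized_plane_wave g"
  shows "\<not> (i < k \<and> j < k) \<Longrightarrow> christoffel g i j k x = 0"
    and "depends_only_below k (christoffel g i j k)"
proof -
  have 1: "(\<forall>x. christoffel g i j k x = 0)" if "\<not> (i < k \<and> j < k)"
    using assms that unfolding generalized_plane_wave_def cov_deriv_coord_field
    by (metis max_less_iff_conj)
  then show "\<not> (i < k \<and> j < k) \<Longrightarrow> christoffel g i j k x = 0" by blast
  show "depends_only_below k (christoffel g i j k)"
    using assms unfolding generalized_plane_wave_def cov_deriv_coord_field by simp
qed

text \<open>
  Coordinate fields commute, so the bracket term of the curvature drops out.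
\<close>

lemma curvature_coord_field:
  "curvature g (coord_field a) (coord_field b) (coord_field c) x $ k =
     partial a (christoffel g b c k) x - partial b (christoffel g a c k) x
     + (\<Sum>e\<in>UNIV. christoffel g a e k x * christoffel g b c e x)
     - (\<Sum>e\<in>UNIV. christoffel g b e k x * christoffel g a c e x)"
proof -
  have ite: "(if P then 1 else 0) * z = (if P then z else 0)"
    "z * (if P then 1 else 0) = (if P then z else 0)" for P and z :: real
    by auto
  have cf: "coord_field a x $ i = (if i = a then 1 else 0)" for a i :: 'a and x
    by (simp add: coord_field_def axis_def)
  have br: "lie_bracket (coord_field a) (coord_field b) = (\<lambda>x. 0)"
    by (simp add: lie_bracket_def fun_eq_iff vec_eq_iff coord_field_def)
  have z: "cov_deriv g (\<lambda>x. 0) Z x $ k = 0" for Z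
    by (simp add: cov_deriv_def)
  have c: "cov_deriv g (coord_field a) (cov_deriv g (coord_field b) (coord_field c)) x $ k =
     partial a (christoffel g b c k) x + (\<Sum>e\<in>UNIV. christoffel g a e k x * christoffel g b c e x)"
    for a b c
    by (subst cov_deriv_def) (simp add: cf ite cov_deriv_coord_field)
  show ?thesis
    unfolding curvature_def by (simp add: br z c)
qed

text \<open>
  The property that part two of the theorem asserts of \<open>\<nabla>\<^sup>\<nu>R\<close>, for tensor fields with \<open>n\<close> lower
  indices and one upper index. Smoothness is carried along because the next covariant derivative
  differentiates the components.
\<close>

definition triangular_tensor ::
  "nat \<Rightarrow> ('n list \<Rightarrow> 'n \<Rightarrow> real^('n::{finite,linorder}) \<Rightarrow> real) \<Rightarrow> bool" where
  "triangular_tensor n T \<longleftrightarrow> (\<forall>is k. length is = n \<longrightarrow>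
     (\<forall>x. T is k x \<noteq> 0 \<longrightarrow> (\<forall>a\<in>set is. a < k)) \<and> depends_only_below k (T is k) \<and> smooth (T is k))"

lemma triangular_tensorD:
  assumes "triangular_tensor n T" "length is = n"
  shows "T is k x \<noteq> 0 \<Longrightarrow> a \<in> set is \<Longrightarrow> a < k" "depends_only_below k (T is k)" "smooth (T is k)"
  using assms by (auto simp: triangular_tensor_def)

lemma depends_only_belowD:
  "depends_only_below k f \<Longrightarrow> (\<And>l. l < k \<Longrightarrow> x $ l = y $ l) \<Longrightarrow> f x = f y"
  by (auto simp: depends_only_below_def)

text \<open>
  Each of the three kinds of terms of \<open>\<nabla>\<^sub>j T\<close> is triangular. A partial derivative \<open>\<partial>\<^sub>j\<close> of a
  function of the coordinates below \<open>k\<close> vanishes unless \<open>j < k\<close>; in the two contractions with a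
  Christoffel symbol the summation index \<open>a\<close> is squeezed strictly between the lower indices of one
  factor and the upper index of the other, so strict inequalities compose. The same squeezing
  gives \<open>a < k\<close>, which is why no coordinate from \<open>x\<^sub>k\<close> on can enter.
\<close>

lemma triangular_tensor_deriv:
  assumes g: "pseudo_riemannian p q g" and w: "generalized_plane_wave g"
    and T: "triangular_tensor n T"
  shows "triangular_tensor (Suc n) (\<lambda>is. tensor_deriv g T (hd is) (tl is))"
  unfolding triangular_tensor_def
proof (intro allI impI conjI)
  fix "is" :: "'a list" and k
  assume "length is = Suc n"
  then obtain j js where is_eq: "is = j # js" and len: "length js = n" by (cases "is") auto
  note G0 = plane_wave_christoffel(1)[OF w] and Gd = plane_wave_christoffel(2)[OF w]
  note Td = triangular_tensorD(2)[OF T] and Ts = triangular_tensorD(3)[OF T]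
  note T0 = triangular_tensorD(1)[OF T]
  have dT: "T js k differentiable at x" for x
    by (rule smooth_differentiable[OF Ts[OF len]])
  show "smooth (tensor_deriv g T (hd is) (tl is) k)"
    unfolding tensor_deriv_def[abs_def] is_eq list.sel
    by (intro smooth_add smooth_diff smooth_sum smooth_mult smooth_partial smooth_christoffel[OF g] Ts)
      (simp_all add: len)
  show "depends_only_below k (tensor_deriv g T (hd is) (tl is) k)"
    unfolding depends_only_below_def
  proof (intro allI impI)
    fix x y :: "(real, 'a) vec" assume xy: "\<forall>l<k. x $ l = y $ l"
    have dep: "f x = f y" if "depends_only_below a f" "a \<le> k" for a f
      using that xy by (auto simp: depends_only_below_def)
    have 1: "partial j (T js k) x = partial j (T js k) y"
      by (rule dep[OF depends_only_below_partial[OF dT Td[OF len]]]) simp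
    have 2: "christoffel g j a k x * T js a x = christoffel g j a k y * T js a y" for a
    proof (cases "a < k")
      case True
      then show ?thesis using dep[OF Gd[of k j a]] dep[OF Td[OF len, of a]] by simp
    qed (simp add: G0)
    have 3: "christoffel g j (js ! r) a x * T (js[r := a]) k x =
        christoffel g j (js ! r) a y * T (js[r := a]) k y" if r: "r < length js" for r a
    proof (cases "a < k")
      case True
      then show ?thesis using dep[OF Gd[of a j "js ! r"]] dep[OF Td[of "js[r := a]" k]] len by simp
    next
      case False
      have "a \<in> set (js[r := a])" using r by (simp add: set_update_memI)
      then have "T (js[r := a]) k z = 0" for z using T0[of "js[r := a]" k z a] len False by auto
      then show ?thesis by simp
    qed
    show "tensor_deriv g T (hd is) (tl is) k x = tensor_deriv g T (hd is) (tl is) k y"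
      unfolding tensor_deriv_def is_eq list.sel 1 2 by (simp add: 3)
  qed
  fix x
  assume nz: "tensor_deriv g T (hd is) (tl is) k x \<noteq> 0"
  then consider "partial j (T js k) x \<noteq> 0" | "(\<Sum>a\<in>UNIV. christoffel g j a k x * T js a x) \<noteq> 0"
    | "(\<Sum>r<length js. \<Sum>a\<in>UNIV. christoffel g j (js ! r) a x * T (js[r := a]) k x) \<noteq> 0"
    unfolding tensor_deriv_def is_eq list.sel by linarith
  then show "\<forall>a\<in>set is. a < k"
  proof cases
    case 1
    then have "j < k" using partial_eq_0_if_depends_only_below[OF dT Td[OF len]] by blast
    moreover have "a < k" if "a \<in> set js" for a
    proof (rule ccontr)
      assume "\<not> a < k"
      then have "T js k = (\<lambda>x. 0)" using T0[OF len] that by blast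
      then show False using 1 by simp
    qed
    ultimately show ?thesis by (simp add: is_eq)
  next
    case 2
    then obtain a where "christoffel g j a k x \<noteq> 0" "T js a x \<noteq> 0"
      by (metis (no_types, lifting) mult_eq_0_iff sum.neutral)
    then have "j < k" "a < k" "\<forall>b\<in>set js. b < a" using G0 T0[OF len] by blast+
    then show ?thesis unfolding is_eq by (auto intro: less_trans)
  next
    case 3
    then obtain r where r: "r < length js"
      and "(\<Sum>a\<in>UNIV. christoffel g j (js ! r) a x * T (js[r := a]) k x) \<noteq> 0"
      by (metis (no_types, lifting) lessThan_iff sum.neutral)
    then obtain a where a: "christoffel g j (js ! r) a x \<noteq> 0" and Ta: "T (js[r := a]) k x \<noteq> 0"
      by (metis (no_types, lifting) mult_eq_0_iff sum.neutral)
    have lt: "b < k" if "b \<in> set (js[r := a])" for b using T0[OF _ Ta that] len by simp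
    have "a < k" using r by (intro lt) (simp add: set_update_memI)
    moreover have "j < a" "js ! r < a" using G0 a by blast+
    moreover have "b < k" if "b \<in> set js" for b
    proof -
      from that obtain s where s: "s < length js" "b = js ! s" by (auto simp: in_set_conv_nth)
      show ?thesis
      proof (cases "s = r")
        case True
        then show ?thesis using s \<open>js ! r < a\<close> \<open>a < k\<close> by simp
      next
        case False
        then have "b \<in> set (js[r := a])"
          using s by (metis length_list_update nth_list_update_neq nth_mem)
        then show ?thesis by (rule lt)
      qed
    qed
    ultimately show ?thesis unfolding is_eq by auto
  qed
qed

lemma triangular_nabla_curvature:
  assumes g: "pseudo_riemannian p q g" and w: "generalized_plane_wave g"
  shows "triangular_tensor (n + 3) (nabla_curvature g n)"
proof (induction n)
  case 0
  note G0 = plane_wave_christoffel(1)[OF w] and Gd = plane_wave_christoffel(2)[OF w]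
  have dG: "christoffel g i j k differentiable at x" for i j k x
    by (rule smooth_differentiable[OF smooth_christoffel[OF g]])
  let ?R = "\<lambda>a b c k x. partial a (christoffel g b c k) x - partial b (christoffel g a c k) x
     + (\<Sum>e\<in>UNIV. christoffel g a e k x * christoffel g b c e x)
     - (\<Sum>e\<in>UNIV. christoffel g b e k x * christoffel g a c e x)"
  have sm: "smooth (?R a b c k)" for a b c k
    by (intro smooth_add smooth_diff smooth_sum smooth_mult smooth_partial smooth_christoffel[OF g])
  have dp: "depends_only_below k (?R a b c k)" for a b c k
    unfolding depends_only_below_def
  proof (intro allI impI)
    fix x y :: "(real, 'a) vec" assume xy: "\<forall>l<k. x $ l = y $ l"
    have dep: "f x = f y" if "depends_only_below a f" "a \<le> k" for a f
      using that xy by (auto simp: depends_only_below_def)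
    have 1: "partial a (christoffel g b c k) x = partial a (christoffel g b c k) y" for a b
      by (rule dep[OF depends_only_below_partial[OF dG Gd]]) simp
    have 2: "christoffel g a e k x * christoffel g b c e x =
        christoffel g a e k y * christoffel g b c e y" for a b e
    proof (cases "e < k")
      case True
      then show ?thesis using dep[OF Gd[of k a e]] dep[OF Gd[of e b c]] by simp
    qed (simp add: G0)
    show "?R a b c k x = ?R a b c k y" by (simp only: 1 2)
  qed
  have P: "a < k \<and> b < k \<and> c < k" if "partial a (christoffel g b c k) x \<noteq> 0" for a b c k x
  proof -
    have "a < k" using that partial_eq_0_if_depends_only_below[OF dG Gd] by blast
    moreover have "b < k \<and> c < k"
    proof (rule ccontr)
      assume "\<not> (b < k \<and> c < k)"
      then have "christoffel g b c k = (\<lambda>x. 0)" using G0 by blast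
      then show False using that by simp
    qed
    ultimately show ?thesis by blast
  qed
  have S: "a < k \<and> b < k \<and> c < k"
    if "(\<Sum>e\<in>UNIV. christoffel g a e k x * christoffel g b c e x) \<noteq> 0" for a b c k x
  proof -
    from that obtain e where "christoffel g a e k x \<noteq> 0" "christoffel g b c e x \<noteq> 0"
      by (metis (no_types, lifting) mult_eq_0_iff sum.neutral)
    then have "a < k" "e < k" "b < e" "c < e" using G0 by blast+
    then show ?thesis by auto
  qed
  have nz: "a < k \<and> b < k \<and> c < k" if "?R a b c k x \<noteq> 0" for a b c k x
  proof -
    have "?R a b c k x = 0" if "\<not> (a < k \<and> b < k \<and> c < k)"
    proof -
      have "partial a (christoffel g b c k) x = 0" "partial b (christoffel g a c k) x = 0"
        "(\<Sum>e\<in>UNIV. christoffel g a e k x * christoffel g b c e x) = 0"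
        "(\<Sum>e\<in>UNIV. christoffel g b e k x * christoffel g a c e x) = 0"
        using P S that by blast+
      then show ?thesis by simp
    qed
    then show ?thesis using that by blast
  qed
  have R: "nabla_curvature g 0 [a, b, c] k = ?R a b c k" for a b c k
    by (simp add: curvature_coord_field fun_eq_iff)
  show ?case
    unfolding triangular_tensor_def
  proof (intro allI impI)
    fix "is" :: "'a list" and k
    assume "length is = 0 + 3"
    then obtain a b c where i: "is = [a, b, c]"
      by (auto simp: numeral_3_eq_3 length_Suc_conv)
    show "(\<forall>x. nabla_curvature g 0 is k x \<noteq> 0 \<longrightarrow> (\<forall>a\<in>set is. a < k)) \<and>
      depends_only_below k (nabla_curvature g 0 is k) \<and> smooth (nabla_curvature g 0 is k)"
      unfolding i R using nz sm dp by auto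
  qed
next
  case (Suc n)
  then show ?case using triangular_tensor_deriv[OF g w Suc.IH] by simp
qed

lemma curv_comp_triangular:
  assumes g: "pseudo_riemannian p q g" and w: "generalized_plane_wave g"
  shows "curv_comp g a b c k js x \<noteq> 0 \<Longrightarrow> i \<in> set ([a, b, c] @ js) \<Longrightarrow> i < k"
    and "depends_only_below k (curv_comp g a b c k js)"
  using triangular_tensorD[OF triangular_nabla_curvature[OF g w], of "js @ [a, b, c]" "length js"]
  unfolding curv_comp_def by auto

section \<open>Nilpotency and the Ricci tensor\<close>

text \<open>
  Each application of \<open>A\<close> clears at least one more of the leading components.
\<close>

lemma nilpotent_operator_if_strictly_triangular:
  fixes A :: "real^('n::{finite,linorder}) \<Rightarrow> real^('n::{finite,linorder})"
  assumes A: "\<And>x k. (\<And>a. a < k \<Longrightarrow> x $ a = 0) \<Longrightarrow> A x $ k = 0"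
  shows "nilpotent_operator A"
proof -
  have "(A ^^ n) x $ k = 0" if "card {a. a < k} < n" for n x k
    using that
  proof (induction n arbitrary: k)
    case (Suc n)
    have "(A ^^ n) x $ a = 0" if "a < k" for a
    proof (rule Suc.IH)
      have "{b. b < a} \<subset> {b. b < k}" using that by (auto intro: less_trans)
      then have "card {b. b < a} < card {b. b < k}" by (intro psubset_card_mono) auto
      then show "card {b. b < a} < n" using Suc.prems by linarith
    qed
    then show ?case by (simp add: A)
  qed simp
  moreover have "card {a. a < k} < CARD('n)" for k :: 'n
    by (intro psubset_card_mono) auto
  ultimately show ?thesis
    by (simp add: nilpotent_operator_def vec_eq_iff)
qed

lemma plane_wave_nilpotent:
  assumes g: "pseudo_riemannian p q g" and w: "generalized_plane_wave g"
  shows "nilpotent_osserman g" "nilpotent_ivanov_petrova g" "nilpotent_szabo g"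
proof -
  have R: "curv_comp g a b c k js x = 0" if "i \<in> set ([a, b, c] @ js)" "\<not> i < k" for a b c k js x i
    using curv_comp_triangular(1)[OF g w] that by blast
  show "nilpotent_osserman g"
    unfolding nilpotent_osserman_def
  proof (intro allI nilpotent_operator_if_strictly_triangular)
    fix P \<xi> x :: "(real, 'a) vec" and k assume x: "\<And>a. a < k \<Longrightarrow> x $ a = 0"
    have *: "x $ a * \<xi> $ b * \<xi> $ c * curv_comp g a b c k [] P = 0" for a b c
      using x[of a] R[of a a b c "[]" k P] by (cases "a < k") auto
    then show "jacobi_operator g P \<xi> x $ k = 0"
      by (simp only: jacobi_operator_def curvature_at_def vec_lambda_beta * sum.neutral_const)
  qed
  show "nilpotent_szabo g"
    unfolding nilpotent_szabo_def
  proof (intro allI nilpotent_operator_if_strictly_triangular)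
    fix P \<xi> x :: "(real, 'a) vec" and k assume x: "\<And>a. a < k \<Longrightarrow> x $ a = 0"
    have *: "\<xi> $ j * x $ a * \<xi> $ b * \<xi> $ c * curv_comp g a b c k [j] P = 0" for a b c j
      using x[of a] R[of a a b c "[j]" k P] by (cases "a < k") auto
    then show "szabo_operator g P \<xi> x $ k = 0"
      by (simp only: szabo_operator_def nabla_curvature_at_def vec_lambda_beta * sum.neutral_const)
  qed
  have "nilpotent_operator (skew_curvature_operator g P u v)" for P u v
  proof (rule nilpotent_operator_if_strictly_triangular)
    fix x :: "(real, 'a) vec" and k assume x: "\<And>a. a < k \<Longrightarrow> x $ a = 0"
    have *: "u $ a * v $ b * x $ c * curv_comp g a b c k [] P = 0" for a b c
      using x[of c] R[of c a b c "[]" k P] by (cases "c < k") auto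
    then show "skew_curvature_operator g P u v x $ k = 0"
      by (simp only: skew_curvature_operator_def curvature_at_def vec_lambda_beta * sum.neutral_const)
  qed
  then show "nilpotent_ivanov_petrova g"
    by (simp add: nilpotent_ivanov_petrova_def)
qed

lemma plane_wave_ricci:
  assumes g: "pseudo_riemannian p q g" and w: "generalized_plane_wave g"
  shows "ricci g i j x = 0"
proof -
  have "curv_comp g k i j k [] x = 0" for k
    using curv_comp_triangular(1)[OF g w, of k i j k "[]" x k] by auto
  then show ?thesis by (simp add: ricci_def)
qed

section \<open>Skew-symmetry of the curvature endomorphisms\<close>

text \<open>
  Skew-symmetry, with respect to \<open>g\<close>, of the endomorphisms obtained by fixing all but the last of
  \<open>n + 1\<close> lower indices.
\<close>

definition metric_skew ::
  "'n metric \<Rightarrow> nat \<Rightarrow> ('n list \<Rightarrow> 'n \<Rightarrow> (real^'n::finite) \<Rightarrow> real) \<Rightarrow> bool" where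
  "metric_skew g n T \<longleftrightarrow> (\<forall>js c d x. length js = n \<longrightarrow>
     (\<Sum>k\<in>UNIV. T (js @ [c]) k x * g x $ k $ d) + (\<Sum>k\<in>UNIV. T (js @ [d]) k x * g x $ k $ c) = 0)"

text \<open>
  Since \<open>\<nabla>g = 0\<close>, lowering the upper index commutes with \<open>\<nabla>\<close>. With
  \<open>S js c d\<close> the lowered tensor, the lowered derivative is \<open>\<partial>\<^sub>j S\<close> minus one Christoffel term for
  each index, and every one of these expressions is skew in \<open>c, d\<close> along with \<open>S\<close>.
\<close>

lemma metric_skew_tensor_deriv:
  assumes g: "pseudo_riemannian p q g"
    and sm: "\<And>is k. length is = Suc n \<Longrightarrow> smooth (T is k)"
    and sk: "metric_skew g n T"
  shows "metric_skew g (Suc n) (\<lambda>is. tensor_deriv g T (hd is) (tl is))"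
  unfolding metric_skew_def
proof (intro allI impI)
  fix is' :: "'a list" and c d and x :: "(real, 'a) vec"
  assume "length is' = Suc n"
  then obtain j js where is': "is' = j # js" and len: "length js = n" by (cases is') auto
  define S where "S js c d x = (\<Sum>k\<in>UNIV. T (js @ [c]) k x * g x $ k $ d)" for js c d x
  have S0: "S js c d x + S js d c x = 0" if "length js = n" for js c d x
    using sk that by (simp add: metric_skew_def S_def)
  define G where "G i k = christoffel g j i k x" for i k
  define U where "U c k = partial j (T (js @ [c]) k) x" for c k
  define h where "h a b = g x $ a $ b" for a b
  define t where "t c k = T (js @ [c]) k x" for c k
  have dT: "T (js @ [c]) k differentiable at x" for c k x
    by (rule smooth_differentiable[OF sm]) (simp add: len)
  have dg: "(\<lambda>x. g x $ a $ b) differentiable at x" for a b x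
    by (rule smooth_differentiable[OF smooth_metric[OF g]])
  have dS: "S js c d differentiable at x" for c d x
    unfolding S_def by (auto intro!: differentiable_sum differentiable_mult dT dg)
  have pS: "partial j (S js c d) x = (\<Sum>k\<in>UNIV. U c k * h k d)
      + (\<Sum>k\<in>UNIV. \<Sum>l\<in>UNIV. t c k * G k l * h l d) + (\<Sum>k\<in>UNIV. \<Sum>l\<in>UNIV. t c k * G d l * h k l)"
    for c d
  proof -
    have "partial j (S js c d) x =
        (\<Sum>k\<in>UNIV. partial j (\<lambda>x. T (js @ [c]) k x * g x $ k $ d) x)"
      unfolding S_def by (intro partial_sum differentiable_mult dT dg)
    also have "\<dots> = (\<Sum>k\<in>UNIV. U c k * h k d + t c k * ((\<Sum>l\<in>UNIV. G k l * h l d) + (\<Sum>l\<in>UNIV. G d l * h k l)))"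
      by (intro sum.cong refl)
        (simp only: partial_mult[OF dT dg] U_def h_def t_def G_def christoffel_metric[OF g])
    finally show ?thesis
      by (simp add: algebra_simps sum.distrib sum_distrib_left)
  qed
  have D: "(\<Sum>k\<in>UNIV. tensor_deriv g T j (js @ [c]) k x * h k d) =
      partial j (S js c d) x - (\<Sum>l\<in>UNIV. G d l * S js c l x)
      - (\<Sum>r<n. \<Sum>a\<in>UNIV. christoffel g j (js ! r) a x * S (js[r := a]) c d x)
      - (\<Sum>a\<in>UNIV. G c a * S js a d x)" for c d
  proof -
    have td: "tensor_deriv g T j (js @ [c]) k x = U c k + (\<Sum>a\<in>UNIV. G a k * t c a)
      - (\<Sum>r<n. \<Sum>a\<in>UNIV. christoffel g j (js ! r) a x * T (js[r := a] @ [c]) k x)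
      - (\<Sum>a\<in>UNIV. G c a * t a k)" for k
      by (simp add: tensor_deriv_def len U_def G_def t_def nth_append list_update_append)
    have 1: "(\<Sum>k\<in>UNIV. (\<Sum>a\<in>UNIV. G a k * t c a) * h k d) = (\<Sum>k\<in>UNIV. \<Sum>l\<in>UNIV. t c k * G k l * h l d)"
      unfolding sum_distrib_right by (subst sum.swap) (simp add: mult_ac)
    have 2: "(\<Sum>k\<in>UNIV. (\<Sum>r<n. \<Sum>a\<in>UNIV. christoffel g j (js ! r) a x * T (js[r := a] @ [c]) k x) * h k d)
      = (\<Sum>r<n. \<Sum>a\<in>UNIV. christoffel g j (js ! r) a x * S (js[r := a]) c d x)"
      unfolding sum_distrib_right S_def sum_distrib_left h_def
      by (subst sum.swap[where B = "{..<n}"], rule sum.cong, rule refl, subst sum.swap) (simp add: mult_ac)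
    have 3: "(\<Sum>k\<in>UNIV. (\<Sum>a\<in>UNIV. G c a * t a k) * h k d) = (\<Sum>a\<in>UNIV. G c a * S js a d x)"
      unfolding sum_distrib_right S_def sum_distrib_left h_def t_def
      by (subst sum.swap) (simp add: mult_ac)
    have 4: "(\<Sum>k\<in>UNIV. \<Sum>l\<in>UNIV. t c k * G d l * h k l) = (\<Sum>l\<in>UNIV. G d l * S js c l x)"
      unfolding sum_distrib_right S_def sum_distrib_left h_def t_def
      by (subst sum.swap) (simp add: mult_ac)
    have "(\<Sum>k\<in>UNIV. tensor_deriv g T j (js @ [c]) k x * h k d) = (\<Sum>k\<in>UNIV. U c k * h k d)
       + (\<Sum>k\<in>UNIV. (\<Sum>a\<in>UNIV. G a k * t c a) * h k d)
       - (\<Sum>k\<in>UNIV. (\<Sum>r<n. \<Sum>a\<in>UNIV. christoffel g j (js ! r) a x * T (js[r := a] @ [c]) k x) * h k d)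
       - (\<Sum>k\<in>UNIV. (\<Sum>a\<in>UNIV. G c a * t a k) * h k d)"
      unfolding td by (simp only: left_diff_distrib distrib_right sum.distrib sum_subtractf)
    then show ?thesis unfolding 1 2 3 4[symmetric] pS by linarith
  qed
  have "partial j (S js c d) x + partial j (S js d c) x = partial j (\<lambda>x. S js c d x + S js d c x) x"
    by (simp add: partial_add dS)
  also have "\<dots> = 0" using S0[OF len] by simp
  finally have e1: "partial j (S js c d) x + partial j (S js d c) x = 0" .
  have e2: "(\<Sum>l\<in>UNIV. G a l * S js b l x) + (\<Sum>l\<in>UNIV. G a l * S js l b x) = 0" for a b
    using S0[OF len] by (simp flip: sum.distrib distrib_left)
  have e3: "(\<Sum>r<n. \<Sum>a\<in>UNIV. christoffel g j (js ! r) a x * S (js[r := a]) c d x)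
     + (\<Sum>r<n. \<Sum>a\<in>UNIV. christoffel g j (js ! r) a x * S (js[r := a]) d c x) = 0"
    using S0 len by (simp flip: sum.distrib distrib_left)
  show "(\<Sum>k\<in>UNIV. tensor_deriv g T (hd (is' @ [c])) (tl (is' @ [c])) k x * g x $ k $ d) +
    (\<Sum>k\<in>UNIV. tensor_deriv g T (hd (is' @ [d])) (tl (is' @ [d])) k x * g x $ k $ c) = 0"
    using D[of c d] D[of d c] e1 e2[of c d] e2[of d c] e3 by (simp add: is' h_def)
qed

text \<open>
  With \<open>L b c d\<close> the Christoffel symbol with lowered index, the equation \<open>\<nabla>g = 0\<close> reads
  \<open>\<partial>\<^sub>b g\<^sub>c\<^sub>d = L b c d + L b d c\<close>. The lowered curvature is \<open>\<partial>\<^sub>a L b c d\<close> minus a quadratic term,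
  antisymmetrised in \<open>a, b\<close>. Symmetrising in \<open>c, d\<close> leaves the commutator of \<open>\<partial>\<^sub>a\<close> and \<open>\<partial>\<^sub>b\<close> on
  \<open>g\<^sub>c\<^sub>d\<close>, while the quadratic terms cancel by the symmetry of \<open>g\<close>.
\<close>

lemma metric_skew_curvature:
  assumes g: "pseudo_riemannian p q g"
  shows "metric_skew g 2 (nabla_curvature g 0)"
  unfolding metric_skew_def
proof (intro allI impI)
  fix js :: "'a list" and c d and x :: "(real, 'a) vec"
  assume "length js = 2"
  then obtain a b where js: "js = [a, b]" by (auto simp: numeral_2_eq_2 length_Suc_conv)
  define L where "L b c d y = (\<Sum>l\<in>UNIV. christoffel g b c l y * g y $ l $ d)" for b c d y
  have sym: "g y $ i $ k = g y $ k $ i" for y i k by (rule pseudo_riemannian_sym[OF g])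
  have dG: "christoffel g i j k differentiable at x" for i j k x
    by (rule smooth_differentiable[OF smooth_christoffel[OF g]])
  have dg: "(\<lambda>x. g x $ i $ k) differentiable at x" for i k x
    by (rule smooth_differentiable[OF smooth_metric[OF g]])
  have dL: "L b c d differentiable at x" for b c d x
    unfolding L_def by (auto intro!: differentiable_sum differentiable_mult dG dg)
  have dgL: "partial b (\<lambda>y. g y $ c $ d) y = L b c d y + L b d c y" for b c d y
    unfolding christoffel_metric[OF g] L_def using sym by simp
  define Q where "Q a b c d = (\<Sum>l\<in>UNIV. \<Sum>e\<in>UNIV. christoffel g b c l x * christoffel g a d e x * g x $ l $ e)"
    for a b c d
  have Qsym: "Q b a d c = Q a b c d" for a b c d
    unfolding Q_def by (subst sum.swap) (simp add: sym mult_ac)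
  have pL: "(\<Sum>l\<in>UNIV. (partial a (christoffel g b c l) x +
        (\<Sum>e\<in>UNIV. christoffel g a e l x * christoffel g b c e x)) * g x $ l $ d)
      = partial a (L b c d) x - Q a b c d" for a b c d
  proof -
    have "partial a (L b c d) x =
        (\<Sum>l\<in>UNIV. partial a (\<lambda>y. christoffel g b c l y * g y $ l $ d) x)"
      unfolding L_def by (intro partial_sum differentiable_mult dG dg)
    also have "\<dots> = (\<Sum>l\<in>UNIV. partial a (christoffel g b c l) x * g x $ l $ d +
        christoffel g b c l x * ((\<Sum>e\<in>UNIV. christoffel g a l e x * g x $ e $ d)
          + (\<Sum>e\<in>UNIV. christoffel g a d e x * g x $ l $ e)))"
      by (simp only: partial_mult[OF dG dg] christoffel_metric[OF g])
    also have "\<dots> = (\<Sum>l\<in>UNIV. partial a (christoffel g b c l) x * g x $ l $ d) +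
        (\<Sum>l\<in>UNIV. \<Sum>e\<in>UNIV. christoffel g b c l x * christoffel g a l e x * g x $ e $ d) + Q a b c d"
      by (simp add: algebra_simps sum.distrib sum_distrib_left Q_def)
    also have "(\<Sum>l\<in>UNIV. \<Sum>e\<in>UNIV. christoffel g b c l x * christoffel g a l e x * g x $ e $ d) =
        (\<Sum>l\<in>UNIV. (\<Sum>e\<in>UNIV. christoffel g a e l x * christoffel g b c e x) * g x $ l $ d)"
      unfolding sum_distrib_right by (subst sum.swap) (simp add: mult_ac)
    finally show ?thesis by (simp add: distrib_right sum.distrib)
  qed
  have R: "(\<Sum>l\<in>UNIV. nabla_curvature g 0 [a, b, c] l x * g x $ l $ d) =
      partial a (L b c d) x - Q a b c d - (partial b (L a c d) x - Q b a c d)" for c d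
    unfolding pL[symmetric]
    by (simp add: curvature_coord_field algebra_simps flip: sum_subtractf)
  have pp: "partial a (L b c d) x + partial a (L b d c) x = partial a (partial b (\<lambda>y. g y $ c $ d)) x"
    for a b
    unfolding dgL[abs_def] by (simp add: partial_add dL)
  have comm: "partial a (partial b (\<lambda>y. g y $ c $ d)) x = partial b (partial a (\<lambda>y. g y $ c $ d)) x"
    by (rule partial_commute[OF smooth_metric[OF g]])
  show "(\<Sum>k\<in>UNIV. nabla_curvature g 0 (js @ [c]) k x * g x $ k $ d) +
    (\<Sum>k\<in>UNIV. nabla_curvature g 0 (js @ [d]) k x * g x $ k $ c) = 0"
    using R[of c d] R[of d c] pp[of a b] pp[of b a] comm Qsym[of b a d c] Qsym[of b a c d]
    unfolding js by (simp del: nabla_curvature.simps)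
qed

lemma metric_skew_nabla_curvature:
  assumes g: "pseudo_riemannian p q g" and w: "generalized_plane_wave g"
  shows "metric_skew g (n + 2) (nabla_curvature g n)"
proof (induction n)
  case 0
  show ?case using metric_skew_curvature[OF g] by (simp only: add_0)
next
  case (Suc n)
  have "smooth (nabla_curvature g n is k)" if "length is = Suc (n + 2)" for "is" k
    using triangular_tensorD(3)[OF triangular_nabla_curvature[OF g w]] that by simp
  from metric_skew_tensor_deriv[OF g this Suc.IH] show ?case by simp
qed

lemma curv_comp_skew:
  assumes g: "pseudo_riemannian p q g" and w: "generalized_plane_wave g"
  shows "(\<Sum>k\<in>UNIV. curv_comp g a b c k js x * g x $ k $ d) +
    (\<Sum>k\<in>UNIV. curv_comp g a b d k js x * g x $ k $ c) = 0"
  using metric_skew_nabla_curvature[OF g w, of "length js", unfolded metric_skew_def,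
    rule_format, of "js @ [a, b]" c x d]
  by (simp add: curv_comp_def)

section \<open>Parallel translation\<close>

lemma wf_finite_linorder: "wf {(a, b :: 'n :: {finite,linorder}). a < b}"
proof (rule finite_acyclic_wf)
  have "trans {(a, b :: 'n). a < b}" by (auto simp: trans_def)
  then show "acyclic {(a, b :: 'n). a < b}" by (simp add: acyclic_def trancl_id)
qed simp

lemma finite_linorder_induct [case_names less]:
  fixes k :: "'n::{finite,linorder}"
  assumes "\<And>k. (\<And>a. a < k \<Longrightarrow> P a) \<Longrightarrow> P k"
  shows "P k"
proof (rule wf_induct_rule[OF wf_finite_linorder, where P = P and a = k])
  show "P k" if "\<And>a. (a, k) \<in> {(a, b). a < b} \<Longrightarrow> P a" for k
    by (rule assms) (simp add: that)
qed

text \<open>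
  Solves a triangular system one coordinate at a time: \<open>P f k r\<close> says that \<open>r\<close> is an admissible
  \<open>k\<close>-th component, given the components of \<open>f\<close> below \<open>k\<close>.
\<close>

lemma finite_linorder_dependent_choice:
  fixes P :: "('n::{finite,linorder} \<Rightarrow> 'b) \<Rightarrow> 'n \<Rightarrow> 'b \<Rightarrow> bool"
  assumes "\<And>f g k r. (\<And>a. a < k \<Longrightarrow> f a = g a) \<Longrightarrow> P f k r = P g k r"
    and "\<And>k f. (\<And>a. a < k \<Longrightarrow> P f a (f a)) \<Longrightarrow> \<exists>r. P f k r"
  shows "\<exists>f. \<forall>k. P f k (f k)"
proof (rule dependent_wf_choice[OF wf_finite_linorder])
  show "P f k r = P g k r" if "\<And>a. (a, k) \<in> {(a, b). a < b} \<Longrightarrow> f a = g a" for f g k r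
    by (rule assms(1)) (simp add: that)
  show "\<exists>r. P f k r" if "\<And>a. (a, k) \<in> {(a, b). a < b} \<Longrightarrow> P f a (f a)" for k f
    by (rule assms(2)) (simp add: that)
qed

lemma has_vector_derivative_vec_iff:
  fixes f :: "real \<Rightarrow> real^'n::finite"
  shows "(f has_vector_derivative v) (at t within S) \<longleftrightarrow>
    (\<forall>k. ((\<lambda>t. f t $ k) has_real_derivative v $ k) (at t within S))"
  unfolding has_vector_derivative_def has_derivative_componentwise_within[of f]
    has_field_derivative_def
  by (simp add: Basis_vec_def inner_axis mult_commute_abs)

lemma at_within_interval_neq_bot:
  fixes S :: "real set"
  assumes "is_interval S" "interior S \<noteq> {}" "t \<in> S"
  shows "at t within S \<noteq> bot"
proof -
  have "S \<noteq> {x}" for x using assms(2) by auto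
  then have "t islimpt S"
    using assms by (intro connected_imp_perfect) (auto simp: is_interval_connected)
  then show ?thesis using trivial_limit_within by blast
qed

lemma zero_derivative_imp_eq:
  fixes f :: "real \<Rightarrow> real"
  assumes "convex S" "\<And>t. t \<in> S \<Longrightarrow> (f has_real_derivative 0) (at t within S)" "s \<in> S" "t \<in> S"
  shows "f s = f t"
  using has_field_derivative_zero_constant[OF assms(1,2)] assms(3,4) by force

lemma parallel_along_iff:
  "parallel_along g S \<gamma> V \<longleftrightarrow> (\<forall>t\<in>S. \<forall>k. ((\<lambda>t. V t $ k) has_real_derivative
     - (\<Sum>i\<in>UNIV. \<Sum>j\<in>UNIV. christoffel g i j k (\<gamma> t)
         * vector_derivative \<gamma> (at t within S) $ i * V t $ j)) (at t within S))"
  unfolding parallel_along_def has_vector_derivative_vec_iff christoffel_map_def by simp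

text \<open>
  The derivative of \<open>V\<^sub>k\<close> involves only the components below \<open>k\<close>. If those agree for \<open>V\<close> and
  \<open>W\<close>, then \<open>V\<^sub>k - W\<^sub>k\<close> is constant.
\<close>

lemma parallel_along_unique:
  assumes w: "generalized_plane_wave g" and S: "convex S" "s \<in> S" "t \<in> S"
    and V: "parallel_along g S \<gamma> V" and W: "parallel_along g S \<gamma> W" and eq: "V s = W s"
  shows "V t = W t"
proof -
  have "\<forall>t\<in>S. V t $ k = W t $ k" for k
  proof (induction k rule: finite_linorder_induct)
    case (less k)
    let ?G = "\<lambda>V t i j. christoffel g i j k (\<gamma> t) * vector_derivative \<gamma> (at t within S) $ i * V t $ j"
    have G: "?G V t i j = ?G W t i j" if "t \<in> S" for t i j
      using less that plane_wave_christoffel(1)[OF w, of i k j] by (cases "j < k") auto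
    have "((\<lambda>t. V t $ k - W t $ k) has_real_derivative 0) (at t within S)" if t: "t \<in> S" for t
    proof -
      have sG: "(\<Sum>i\<in>UNIV. \<Sum>j\<in>UNIV. ?G V t i j) = (\<Sum>i\<in>UNIV. \<Sum>j\<in>UNIV. ?G W t i j)"
        by (intro sum.cong refl G t)
      have "((\<lambda>t. V t $ k) has_real_derivative - (\<Sum>i\<in>UNIV. \<Sum>j\<in>UNIV. ?G W t i j)) (at t within S)"
        using V t unfolding parallel_along_iff sG[symmetric] by blast
      moreover have "((\<lambda>t. W t $ k) has_real_derivative - (\<Sum>i\<in>UNIV. \<Sum>j\<in>UNIV. ?G W t i j)) (at t within S)"
        using W t unfolding parallel_along_iff by blast
      ultimately show ?thesis using DERIV_diff by fastforce
    qed
    from zero_derivative_imp_eq[OF S(1) this S(2)] eq show ?case by force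
  qed
  then show ?thesis using S by (simp add: vec_eq_iff)
qed

lemma smooth_curve_onE:
  assumes \<gamma>: "smooth_curve_on S \<gamma>" and S: "is_interval S" "interior S \<noteq> {}"
  obtains u where "\<And>t. t \<in> S \<Longrightarrow> (\<gamma> has_vector_derivative u t) (at t within S)"
    "\<And>t. t \<in> S \<Longrightarrow> vector_derivative \<gamma> (at t within S) = u t" "continuous_on S u" "continuous_on S \<gamma>"
proof -
  obtain D where D0: "\<And>t. t \<in> S \<Longrightarrow> D 0 t = \<gamma> t"
    and D: "\<And>r t. t \<in> S \<Longrightarrow> (D r has_vector_derivative D (Suc r) t) (at t within S)"
    using \<gamma> unfolding smooth_curve_on_def by blast
  have 1: "(\<gamma> has_vector_derivative D 1 t) (at t within S)" if "t \<in> S" for t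
    by (rule has_vector_derivative_transform[OF that]) (use D0 D[of t 0] that in auto)
  have c: "continuous_on S (D r)" for r
    using D by (intro continuous_on_vector_derivative) auto
  show thesis
  proof
    show "vector_derivative \<gamma> (at t within S) = D 1 t" if "t \<in> S" for t
      by (rule vector_derivative_within[OF at_within_interval_neq_bot[OF S that] 1[OF that]])
    show "continuous_on S \<gamma>" using c[of 0] D0 by (simp cong: continuous_on_cong)
  qed (use 1 c in auto)
qed

lemma continuous_on_christoffel:
  assumes "pseudo_riemannian p q g" "continuous_on S \<gamma>"
  shows "continuous_on S (\<lambda>t. christoffel g i j k (\<gamma> t))"
proof -
  have "continuous_on UNIV (christoffel g i j k)"
    using smooth_continuous[OF smooth_christoffel[OF assms(1)]] continuous_at_imp_continuous_on by blast
  then show ?thesis using assms(2) by (rule continuous_on_compose2) simp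
qed

text \<open>
  Given the components below \<open>k\<close>, the equation for \<open>V\<^sub>k\<close> prescribes its derivative, so an
  antiderivative solves it on the whole interval.
\<close>

lemma parallel_along_exists:
  assumes g: "pseudo_riemannian p q g" and w: "generalized_plane_wave g"
    and \<gamma>: "smooth_curve_on {0..1} \<gamma>"
  shows "\<exists>V. parallel_along g {0..1} \<gamma> V \<and> V 0 = v"
proof -
  let ?I = "{0..1::real}"
  have I: "is_interval ?I" "interior ?I \<noteq> {}" by (auto simp: is_interval_cc)
  obtain u where u: "\<And>t. t \<in> ?I \<Longrightarrow> vector_derivative \<gamma> (at t within ?I) = u t"
    and cu: "continuous_on ?I u" and c\<gamma>: "continuous_on ?I \<gamma>"
    using smooth_curve_onE[OF \<gamma> I] by metis
  \<comment> \<open>By triangularity the sum may be cut off at \<open>j < k\<close>, so that literally only earlier components enter.\<close>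
  let ?F = "\<lambda>f k t. - (\<Sum>i\<in>UNIV. \<Sum>j\<in>UNIV. christoffel g i j k (\<gamma> t) * u t $ i
      * (if j < k then f j t else 0))"
  have "\<exists>f. \<forall>k. (\<forall>t\<in>?I. (f k has_real_derivative ?F f k t) (at t within ?I)) \<and> f k 0 = v $ k"
  proof (rule finite_linorder_dependent_choice)
    fix f f' :: "'a \<Rightarrow> real \<Rightarrow> real" and k and r :: "real \<Rightarrow> real"
    assume "\<And>a. a < k \<Longrightarrow> f a = f' a"
    then have "(if j < k then f j t else 0) = (if j < k then f' j t else 0)" for j t by simp
    then show "((\<forall>t\<in>?I. (r has_real_derivative ?F f k t) (at t within ?I)) \<and> r 0 = v $ k) =
      ((\<forall>t\<in>?I. (r has_real_derivative ?F f' k t) (at t within ?I)) \<and> r 0 = v $ k)"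
      by (simp only:)
  next
    fix k and f :: "'a \<Rightarrow> real \<Rightarrow> real"
    assume IH: "\<And>a. a < k \<Longrightarrow> (\<forall>t\<in>?I. (f a has_real_derivative ?F f a t) (at t within ?I)) \<and> f a 0 = v $ a"
    have "continuous_on ?I (\<lambda>t. if j < k then f j t else 0)" for j
    proof (cases "j < k")
      case True
      have "continuous_on ?I (f j)"
        by (rule DERIV_continuous_on) (use IH[OF True] in blast)
      with True show ?thesis by simp
    qed simp
    then have "continuous_on ?I (?F f k)"
      by (intro continuous_intros continuous_on_christoffel[OF g c\<gamma>] cu)
    then obtain r where r: "\<And>t. t \<in> ?I \<Longrightarrow> (r has_vector_derivative ?F f k t) (at t within ?I)"
      using antiderivative_continuous by blast
    have "((\<lambda>t. r t + (v $ k - r 0)) has_real_derivative ?F f k t) (at t within ?I)" if "t \<in> ?I" for t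
      using DERIV_add[OF r[OF that, folded has_real_derivative_iff_has_vector_derivative] DERIV_const] by simp
    then show "\<exists>r. (\<forall>t\<in>?I. (r has_real_derivative ?F f k t) (at t within ?I)) \<and> r 0 = v $ k"
      by (intro exI[of _ "\<lambda>t. r t + (v $ k - r 0)"]) simp
  qed
  then obtain f where f: "\<And>k t. t \<in> ?I \<Longrightarrow> (f k has_real_derivative ?F f k t) (at t within ?I)"
    and f0: "\<And>k. f k 0 = v $ k" by blast
  define V where "V t = (\<chi> k. f k t)" for t
  have eq: "christoffel g i j k (\<gamma> t) * u t $ i * (if j < k then f j t else 0)
      = christoffel g i j k (\<gamma> t) * u t $ i * f j t" for i j k t
    using plane_wave_christoffel(1)[OF w, of i k j] by (cases "j < k") auto
  have "parallel_along g ?I \<gamma> V"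
    using f[unfolded eq] by (simp add: parallel_along_iff u V_def)
  moreover have "V 0 = v" by (simp add: V_def f0 vec_eq_iff)
  ultimately show ?thesis by blast
qed

lemma parallel_translation_eq:
  assumes w: "generalized_plane_wave g" and V: "parallel_along g {0..1} \<gamma> V"
  shows "parallel_translation g \<gamma> (V 0) = V 1"
  unfolding parallel_translation_def
proof (rule the_equality)
  fix z assume "\<exists>W. parallel_along g {0..1} \<gamma> W \<and> W 0 = V 0 \<and> W 1 = z"
  then obtain W where W: "parallel_along g {0..1} \<gamma> W" "W 0 = V 0" "W 1 = z" by blast
  have "W 1 = V 1" by (rule parallel_along_unique[OF w _ _ _ W(1) V W(2)]) auto
  then show "z = V 1" using W by simp
qed (use V in blast)

lemma christoffel_map_linear: "linear (christoffel_map g P u)"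
  by (rule linearI)
    (simp_all add: christoffel_map_def vec_eq_iff distrib_left sum.distrib sum_distrib_left mult_ac)

lemma linear_parallel_translation:
  assumes g: "pseudo_riemannian p q g" and w: "generalized_plane_wave g"
    and \<gamma>: "smooth_curve_on {0..1} \<gamma>"
  shows "linear (parallel_translation g \<gamma>)"
proof (rule linearI)
  fix v w' :: "(real, 'a) vec" and c :: real
  obtain V where V: "parallel_along g {0..1} \<gamma> V" "V 0 = v"
    using parallel_along_exists[OF g w \<gamma>] by blast
  obtain W where W: "parallel_along g {0..1} \<gamma> W" "W 0 = w'"
    using parallel_along_exists[OF g w \<gamma>] by blast
  have "parallel_along g {0..1} \<gamma> (\<lambda>t. V t + W t)"
    unfolding parallel_along_def
  proof
    fix t :: real assume t: "t \<in> {0..1}"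
    from has_vector_derivative_add[OF V(1)[unfolded parallel_along_def, rule_format, OF t]
        W(1)[unfolded parallel_along_def, rule_format, OF t]]
    show "((\<lambda>t. V t + W t) has_vector_derivative - christoffel_map g (\<gamma> t)
        (vector_derivative \<gamma> (at t within {0..1})) (V t + W t)) (at t within {0..1})"
      by (simp add: linear_add[OF christoffel_map_linear])
  qed
  from parallel_translation_eq[OF w this] parallel_translation_eq[OF w V(1)] parallel_translation_eq[OF w W(1)]
  show "parallel_translation g \<gamma> (v + w') = parallel_translation g \<gamma> v + parallel_translation g \<gamma> w'"
    by (simp add: V W)
  have "parallel_along g {0..1} \<gamma> (\<lambda>t. c *\<^sub>R V t)"
    unfolding parallel_along_def
  proof
    fix t :: real assume "t \<in> {0..1}"
    then have "(V has_vector_derivative - christoffel_map g (\<gamma> t)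
        (vector_derivative \<gamma> (at t within {0..1})) (V t)) (at t within {0..1})"
      using V(1) by (simp add: parallel_along_def)
    from bounded_linear.has_vector_derivative[OF bounded_linear_scaleR_right[of c] this]
    show "((\<lambda>t. c *\<^sub>R V t) has_vector_derivative - christoffel_map g (\<gamma> t)
        (vector_derivative \<gamma> (at t within {0..1})) (c *\<^sub>R V t)) (at t within {0..1})"
      by (simp add: linear_scale[OF christoffel_map_linear])
  qed
  from parallel_translation_eq[OF w this] parallel_translation_eq[OF w V(1)]
  show "parallel_translation g \<gamma> (c *\<^sub>R v) = c *\<^sub>R parallel_translation g \<gamma> v"
    by (simp add: V)
qed

text \<open>
  Starting from \<open>\<partial>\<^sub>i\<close>, the components below \<open>i\<close> stay zero, and then the derivative of the
  \<open>i\<close>-th one, being a combination of these, vanishes as well.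
\<close>

lemma parallel_translation_unipotent:
  assumes g: "pseudo_riemannian p q g" and w: "generalized_plane_wave g"
    and \<gamma>: "smooth_curve_on {0..1} \<gamma>" and k: "k \<le> i"
  shows "parallel_translation g \<gamma> (axis i 1) $ k = axis i 1 $ k"
proof -
  let ?I = "{0..1::real}"
  obtain V where V: "parallel_along g ?I \<gamma> V" and V0: "V 0 = axis i 1"
    using parallel_along_exists[OF g w \<gamma>] by blast
  have "k \<le> i \<longrightarrow> (\<forall>t\<in>?I. V t $ k = axis i 1 $ k)"
  proof (induction k rule: finite_linorder_induct)
    case (less k)
    show ?case
    proof (intro impI ballI)
      fix t assume k: "k \<le> i" and t: "t \<in> ?I"
      have "V s $ j = 0" if "j < k" "s \<in> ?I" for j s
        using less[OF that(1)] that k by (auto simp: axis_def)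
      then have G: "christoffel g a j k (\<gamma> s) * vector_derivative \<gamma> (at s within ?I) $ a * V s $ j = 0"
        if "s \<in> ?I" for a j s
        using plane_wave_christoffel(1)[OF w, of a k j] that by (cases "j < k") auto
      have "((\<lambda>t. V t $ k) has_real_derivative 0) (at s within ?I)" if s: "s \<in> ?I" for s
      proof -
        have "((\<lambda>t. V t $ k) has_real_derivative - (\<Sum>a\<in>UNIV. \<Sum>j\<in>UNIV. christoffel g a j k (\<gamma> s)
            * vector_derivative \<gamma> (at s within ?I) $ a * V s $ j)) (at s within ?I)"
          using V s unfolding parallel_along_iff by blast
        then show ?thesis by (simp only: G[OF s] sum.neutral_const minus_zero)
      qed
      from zero_derivative_imp_eq[OF _ this t, of 0] V0 show "V t $ k = axis i 1 $ k" by simp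
    qed
  qed
  with k have "V 1 $ k = axis i 1 $ k" by simp
  then show ?thesis using parallel_translation_eq[OF w V] by (simp add: V0)
qed

lemma parallel_translation_axis:
  assumes g: "pseudo_riemannian p q g" and w: "generalized_plane_wave g"
    and \<gamma>: "smooth_curve_on {0..1} \<gamma>"
  shows "\<exists>a. parallel_translation g \<gamma> (axis i 1) = axis i 1 + (\<Sum>j | j > i. a j *\<^sub>R axis j 1)"
proof -
  define H where "H = parallel_translation g \<gamma> (axis i 1)"
  have H: "H $ k = axis i 1 $ k" if "k \<le> i" for k
    unfolding H_def by (rule parallel_translation_unipotent[OF g w \<gamma> that])
  have s: "(\<Sum>j | j > i. h $ j *\<^sub>R axis j 1) $ k = (if i < k then h $ k else 0)"
    for h :: "(real, 'a) vec" and k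
  proof -
    have "(\<Sum>j | j > i. h $ j *\<^sub>R axis j 1) $ k = (\<Sum>j | j > i. if k = j then h $ j else 0)"
      unfolding sum_component by (intro sum.cong refl) (simp add: axis_def)
    then show ?thesis by simp
  qed
  have "H $ k = (axis i 1 + (\<Sum>j | j > i. H $ j *\<^sub>R axis j 1)) $ k" for k
  proof (cases "i < k")
    case True
    then show ?thesis by (simp only: s vector_add_component) (simp add: axis_def)
  next
    case False
    then show ?thesis using H[of k] by (simp only: s vector_add_component) simp
  qed
  then have "H = axis i 1 + (\<Sum>j | j > i. H $ j *\<^sub>R axis j 1)"
    by (rule vec_eq_iff[THEN iffD2, rule_format])
  then show ?thesis unfolding H_def[symmetric] by (rule exI[of _ "\<lambda>j. H $ j"])
qed

lemma holonomy_unipotent: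
  assumes g: "pseudo_riemannian p q g" and w: "generalized_plane_wave g" and H: "H \<in> holonomy g P"
  shows "linear H \<and> row_matrix H \<in> unipotent_upper"
proof -
  from H obtain \<gamma> where \<gamma>: "smooth_curve_on {0..1} \<gamma>" and H: "H = parallel_translation g \<gamma>"
    by (auto simp: holonomy_def)
  have *: "H (axis i 1) $ k = (if k = i then 1 else 0)" if "k \<le> i" for i k
    unfolding H using parallel_translation_unipotent[OF g w \<gamma> that] by (simp add: axis_def)
  have "row_matrix H \<in> unipotent_upper"
    unfolding unipotent_upper_def row_matrix_def using * by simp
  moreover have "linear H" unfolding H by (rule linear_parallel_translation[OF g w \<gamma>])
  ultimately show ?thesis by blast
qed

section \<open>Geodesics\<close>

text \<open>
  Existence of \<open>n\<close> successive derivatives on the line; as for \<open>cdiff\<close>, the recursion on \<open>n\<close> is what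
  makes the closure properties inductive.
\<close>

primrec rdiff :: "nat \<Rightarrow> (real \<Rightarrow> real) \<Rightarrow> bool" where
  "rdiff 0 h \<longleftrightarrow> True"
| "rdiff (Suc n) h \<longleftrightarrow> (\<exists>h'. (\<forall>t. (h has_real_derivative h' t) (at t)) \<and> rdiff n h')"

definition real_smooth :: "(real \<Rightarrow> real) \<Rightarrow> bool" where
  "real_smooth h \<longleftrightarrow> (\<forall>n. rdiff n h)"

lemma rdiff_const: "rdiff n (\<lambda>t. c)"
proof (induction n arbitrary: c)
  case (Suc n)
  then show ?case by (auto intro!: exI[of _ "\<lambda>t. 0"])
qed simp

lemma rdiff_ident: "rdiff n (\<lambda>t. t)"
  by (cases n) (auto intro!: exI[of _ "\<lambda>t. 1"] rdiff_const)

lemma rdiff_mono: "rdiff (Suc n) h \<Longrightarrow> rdiff n h"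
proof (induction n arbitrary: h)
  case (Suc n)
  from Suc.prems obtain h' where "\<forall>t. (h has_real_derivative h' t) (at t)" "rdiff (Suc n) h'"
    unfolding rdiff.simps(2)[of "Suc n"] by blast
  with Suc.IH show ?case by auto
qed simp

lemma rdiff_add: "rdiff n f \<Longrightarrow> rdiff n h \<Longrightarrow> rdiff n (\<lambda>t. f t + h t)"
proof (induction n arbitrary: f h)
  case (Suc n)
  then obtain f' h' where "\<And>t. (f has_real_derivative f' t) (at t)" "rdiff n f'"
    "\<And>t. (h has_real_derivative h' t) (at t)" "rdiff n h'" by auto
  then show ?case using Suc.IH by (auto intro!: exI[of _ "\<lambda>t. f' t + h' t"] DERIV_add)
qed simp

lemma rdiff_mult: "rdiff n f \<Longrightarrow> rdiff n h \<Longrightarrow> rdiff n (\<lambda>t. f t * h t)"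
proof (induction n arbitrary: f h)
  case (Suc n)
  then obtain f' h' where d: "\<And>t. (f has_real_derivative f' t) (at t)" "rdiff n f'"
    "\<And>t. (h has_real_derivative h' t) (at t)" "rdiff n h'" by auto
  have "rdiff n f" "rdiff n h" by (rule rdiff_mono[OF Suc.prems(1)], rule rdiff_mono[OF Suc.prems(2)])
  then have "rdiff n (\<lambda>t. f' t * h t + h' t * f t)" using d by (intro rdiff_add Suc.IH)
  moreover have "((\<lambda>t. f t * h t) has_real_derivative f' t * h t + h' t * f t) (at t)" for t
    using d by (intro DERIV_mult)
  ultimately show ?case
    unfolding rdiff.simps(2) by (intro exI[of _ "\<lambda>t. f' t * h t + h' t * f t"]) blast
qed simp

lemma rdiff_sum: "(\<And>a. a \<in> A \<Longrightarrow> rdiff n (f a)) \<Longrightarrow> rdiff n (\<lambda>t. \<Sum>a\<in>A. f a t)"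
  by (induction A rule: infinite_finite_induct) (auto intro: rdiff_const rdiff_add)

lemma has_derivative_along_curve:
  fixes F :: "real^'n::finite \<Rightarrow> real"
  assumes F: "F differentiable at (c t)" and c: "(c has_vector_derivative v) (at t within S)"
  shows "((\<lambda>t. F (c t)) has_real_derivative (\<Sum>k\<in>UNIV. partial k F (c t) * v $ k)) (at t within S)"
proof -
  let ?D = "frechet_derivative F (at (c t))"
  have D: "(F has_derivative ?D) (at (c t))" using F by (rule differentiable_has_derivative)
  have l: "linear ?D" using D by (rule has_derivative_linear)
  have "?D v = ?D (\<Sum>k\<in>UNIV. v $ k *\<^sub>R axis k 1)"
    using basis_expansion[of v] by (simp only: scalar_mult_eq_scaleR)
  also have "\<dots> = (\<Sum>k\<in>UNIV. partial k F (c t) * v $ k)"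
    by (simp add: linear_sum[OF l] linear_scale[OF l] partial_def mult.commute)
  finally have "(\<lambda>h. ?D (h *\<^sub>R v)) = (*) (\<Sum>k\<in>UNIV. partial k F (c t) * v $ k)"
    by (simp add: linear_scale[OF l] fun_eq_iff)
  moreover have "((\<lambda>t. F (c t)) has_derivative (\<lambda>h. ?D (h *\<^sub>R v))) (at t within S)"
    using has_derivative_compose[OF c[unfolded has_vector_derivative_def] D] .
  ultimately show ?thesis by (simp add: has_field_derivative_def)
qed

lemma rdiff_compose:
  assumes "smooth F" "\<And>k. rdiff n (\<lambda>t. c t $ k)"
  shows "rdiff n (\<lambda>t. F (c t))"
  using assms
proof (induction n arbitrary: F)
  case (Suc n)
  have "\<forall>k. \<exists>h'. (\<forall>t. ((\<lambda>t. c t $ k) has_real_derivative h' t) (at t)) \<and> rdiff n h'"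
    using Suc.prems(2) by simp
  from choice[OF this] obtain v where v: "\<And>k t. ((\<lambda>t. c t $ k) has_real_derivative v k t) (at t)"
    and rv: "\<And>k. rdiff n (v k)" by blast
  have "(c has_vector_derivative (\<chi> k. v k t)) (at t)" for t
    by (simp add: has_vector_derivative_vec_iff v)
  from has_derivative_along_curve[OF smooth_differentiable[OF Suc.prems(1)] this]
  have 1: "((\<lambda>t. F (c t)) has_real_derivative (\<Sum>k\<in>UNIV. partial k F (c t) * v k t)) (at t)" for t
    by simp
  have rc: "rdiff n (\<lambda>t. c t $ k)" for k by (rule rdiff_mono[OF Suc.prems(2)])
  have "rdiff n (\<lambda>t. partial k F (c t))" for k
    by (rule Suc.IH[of "partial k F", OF smooth_partial[OF Suc.prems(1)] rc])
  then have "rdiff n (\<lambda>t. \<Sum>k\<in>UNIV. partial k F (c t) * v k t)"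
    using rv by (intro rdiff_sum rdiff_mult)
  with 1 show ?case
    unfolding rdiff.simps(2) by (intro exI[of _ "\<lambda>t. \<Sum>k\<in>UNIV. partial k F (c t) * v k t"]) blast
qed simp

lemma real_smooth_arith:
  shows real_smooth_const: "real_smooth (\<lambda>t. c)"
    and real_smooth_ident: "real_smooth (\<lambda>t. t)"
    and real_smooth_add: "real_smooth f \<Longrightarrow> real_smooth h \<Longrightarrow> real_smooth (\<lambda>t. f t + h t)"
    and real_smooth_mult: "real_smooth f \<Longrightarrow> real_smooth h \<Longrightarrow> real_smooth (\<lambda>t. f t * h t)"
    and real_smooth_sum: "(\<And>a. a \<in> A \<Longrightarrow> real_smooth (k a)) \<Longrightarrow> real_smooth (\<lambda>t. \<Sum>a\<in>A. k a t)"
    and real_smooth_compose: "smooth F \<Longrightarrow> (\<And>i. real_smooth (\<lambda>t. \<gamma> t $ i)) \<Longrightarrow> real_smooth (\<lambda>t. F (\<gamma> t))"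
  by (simp_all add: real_smooth_def rdiff_const rdiff_ident rdiff_add rdiff_mult rdiff_sum rdiff_compose)

lemma real_smooth_deriv:
  assumes "real_smooth h"
  shows "(h has_real_derivative deriv h t) (at t)" "real_smooth (deriv h)"
proof -
  have "\<exists>h'. (\<forall>t. (h has_real_derivative h' t) (at t)) \<and> rdiff n h'" for n
    using assms rdiff.simps(2) unfolding real_smooth_def by blast
  then have *: "(\<forall>t. (h has_real_derivative deriv h t) (at t)) \<and> rdiff n (deriv h)" for n
    by (metis DERIV_imp_deriv ext)
  then show "(h has_real_derivative deriv h t) (at t)" "real_smooth (deriv h)"
    by (auto simp: real_smooth_def)
qed

lemma real_smooth_antiderivative:
  assumes h: "real_smooth h"
  obtains H where "real_smooth H" "\<And>t. (H has_real_derivative h t) (at t)"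
proof -
  have "isCont h t" for t
    using real_smooth_deriv(1)[OF h] DERIV_isCont by blast
  then obtain H where H: "\<And>t. (H has_vector_derivative h t) (at t)"
    using einterval_antiderivative[of "-\<infinity>" "\<infinity>" h] by auto
  have "rdiff n H" for n
    using h H by (cases n) (auto simp: real_smooth_def has_real_derivative_iff_has_vector_derivative)
  then show thesis
    using H that by (auto simp: real_smooth_def has_real_derivative_iff_has_vector_derivative)
qed

lemma smooth_curve_on_UNIV:
  assumes "\<And>k. real_smooth (\<lambda>t. \<gamma> t $ k)"
  shows "smooth_curve_on UNIV \<gamma>"
proof -
  define D where "D r t = (\<chi> k. (deriv ^^ r) (\<lambda>t. \<gamma> t $ k) t)" for r t
  have s: "real_smooth ((deriv ^^ r) (\<lambda>t. \<gamma> t $ k))" for r k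
    by (induction r) (auto simp: assms real_smooth_deriv)
  have "D 0 t = \<gamma> t" for t by (simp add: D_def vec_eq_iff)
  moreover have "(D r has_vector_derivative D (Suc r) t) (at t)" for r t
    unfolding has_vector_derivative_vec_iff using real_smooth_deriv(1)[OF s] by (simp add: D_def)
  ultimately show ?thesis unfolding smooth_curve_on_def by auto
qed

text \<open>
  The first-order form of the geodesic equation, with the velocity as a second unknown.
\<close>

lemma geodesic_on_iff:
  assumes S: "is_interval S" "interior S \<noteq> {}"
  shows "geodesic_on g S \<gamma> \<longleftrightarrow> smooth_curve_on S \<gamma> \<and>
    (\<exists>u. \<forall>t\<in>S. (\<gamma> has_vector_derivative u t) (at t within S) \<and>
      (u has_vector_derivative - christoffel_map g (\<gamma> t) (u t) (u t)) (at t within S))"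
    (is "_ \<longleftrightarrow> _ \<and> ?R")
proof (intro iffI conjI)
  let ?v = "\<lambda>t. vector_derivative \<gamma> (at t within S)"
  assume l: "geodesic_on g S \<gamma>"
  then show sm: "smooth_curve_on S \<gamma>" by (simp add: geodesic_on_def)
  obtain u where "\<And>t. t \<in> S \<Longrightarrow> (\<gamma> has_vector_derivative u t) (at t within S)"
    "\<And>t. t \<in> S \<Longrightarrow> vector_derivative \<gamma> (at t within S) = u t"
    using smooth_curve_onE[OF sm S] by metis
  then have "\<forall>t\<in>S. (\<gamma> has_vector_derivative ?v t) (at t within S)" by simp
  then show ?R using l unfolding geodesic_on_def parallel_along_def by (intro exI[of _ ?v]) blast
next
  let ?v = "\<lambda>t. vector_derivative \<gamma> (at t within S)"
  assume r: "smooth_curve_on S \<gamma> \<and> ?R"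
  then obtain u where u: "\<And>t. t \<in> S \<Longrightarrow> (\<gamma> has_vector_derivative u t) (at t within S)"
    and du: "\<And>t. t \<in> S \<Longrightarrow> (u has_vector_derivative - christoffel_map g (\<gamma> t) (u t) (u t)) (at t within S)"
    by blast
  have v: "?v t = u t" if "t \<in> S" for t
    by (rule vector_derivative_within[OF at_within_interval_neq_bot[OF S that] u[OF that]])
  have "(?v has_vector_derivative - christoffel_map g (\<gamma> t) (?v t) (?v t)) (at t within S)"
    if t: "t \<in> S" for t
    using has_vector_derivative_transform[OF t _ du[OF t], of ?v] v t by simp
  then show "geodesic_on g S \<gamma>" using r by (simp add: geodesic_on_def parallel_along_def)
qed

lemma geodesic_on_subset:
  assumes "geodesic_on g UNIV \<gamma>" and S: "is_interval S" "interior S \<noteq> {}"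
  shows "geodesic_on g S \<gamma>"
proof -
  have 1: "smooth_curve_on UNIV \<gamma>" and
    2: "\<exists>u. \<forall>t. (\<gamma> has_vector_derivative u t) (at t) \<and>
      (u has_vector_derivative - christoffel_map g (\<gamma> t) (u t) (u t)) (at t)"
    using assms(1) by (auto simp: geodesic_on_iff is_interval_univ)
  have "smooth_curve_on S \<gamma>"
    using 1 unfolding smooth_curve_on_def
    by (metis UNIV_I has_vector_derivative_at_within)
  with 2 show ?thesis
    unfolding geodesic_on_iff[OF S] using has_vector_derivative_at_within by blast
qed

text \<open>
  The geodesic equation for the \<open>k\<close>-th coordinate prescribes its second derivative in terms of the
  coordinates below \<open>k\<close>, so it is solved on all of the line by integrating twice. The two constants
  of integration can be fitted to any conditions \<open>C k\<close> that an affine correction can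
  meet. Initial conditions give completeness, conditions at the two ends give the geodesic joining
  two points.
\<close>

lemma geodesic_exists:
  fixes g :: "'n::{finite,linorder} metric" and C :: "'n \<Rightarrow> (real \<Rightarrow> real) \<Rightarrow> bool"
  assumes g: "pseudo_riemannian p q g" and w: "generalized_plane_wave g"
    and C: "\<And>k h. real_smooth h \<Longrightarrow> \<exists>a b. C k (\<lambda>t. h t + (a + b * t))"
  shows "\<exists>\<gamma>. geodesic_on g UNIV \<gamma> \<and> (\<forall>k. C k (\<lambda>t. \<gamma> t $ k))"
proof -
  \<comment> \<open>Components from \<open>k\<close> on are replaced by zero, to make the dependence on the earlier ones literal.\<close>
  let ?x = "\<lambda>f k t. \<chi> l. if l < k then f l t else (0::real)"
  let ?v = "\<lambda>f k i. if i < k then deriv (f i) else (\<lambda>t. 0::real)"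
  let ?F = "\<lambda>f k t. - (\<Sum>i\<in>UNIV. \<Sum>j\<in>UNIV. christoffel g i j k (?x f k t) * ?v f k i t * ?v f k j t)"
  let ?P = "\<lambda>f k r. real_smooth r \<and> C k r \<and> (\<forall>t. (deriv r has_real_derivative ?F f k t) (at t))"
  have "\<exists>f. \<forall>k. ?P f k (f k)"
  proof (rule finite_linorder_dependent_choice)
    fix f f' :: "'n \<Rightarrow> real \<Rightarrow> real" and k and r :: "real \<Rightarrow> real"
    assume "\<And>a. a < k \<Longrightarrow> f a = f' a"
    then have "?x f k t = ?x f' k t" "?v f k i t = ?v f' k i t" for i t
      by (auto simp: vec_eq_iff)
    then show "?P f k r = ?P f' k r" by (simp only:)
  next
    fix k and f :: "'n \<Rightarrow> real \<Rightarrow> real"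
    assume IH: "\<And>a. a < k \<Longrightarrow> ?P f a (f a)"
    have sv: "real_smooth (?v f k i)" for i
      using IH[of i] by (auto intro: real_smooth_const real_smooth_deriv)
    have sx: "real_smooth (\<lambda>t. ?x f k t $ i)" for i
      using IH[of i] by (cases "i < k") (auto intro: real_smooth_const)
    have "real_smooth (\<lambda>t. christoffel g i j k (?x f k t))" for i j
      by (rule real_smooth_compose[of "christoffel g i j k" "?x f k", OF smooth_christoffel[OF g] sx])
    then have "real_smooth (\<lambda>t. (-1) * (\<Sum>i\<in>UNIV. \<Sum>j\<in>UNIV. christoffel g i j k (?x f k t) * ?v f k i t * ?v f k j t))"
      by (intro real_smooth_mult real_smooth_const real_smooth_sum sv)
    then have "real_smooth (?F f k)" by simp
    then obtain H where H: "real_smooth H" "\<And>t. (H has_real_derivative ?F f k t) (at t)"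
      using real_smooth_antiderivative by blast
    obtain K where K: "real_smooth K" "\<And>t. (K has_real_derivative H t) (at t)"
      using real_smooth_antiderivative[OF H(1)] by blast
    obtain a b where ab: "C k (\<lambda>t. K t + (a + b * t))" using C[OF K(1)] by blast
    let ?r = "\<lambda>t. K t + (a + b * t)"
    have "real_smooth ?r"
      by (intro real_smooth_add real_smooth_mult real_smooth_const real_smooth_ident K(1))
    moreover have "(?r has_real_derivative H t + b) (at t)" for t
      by (auto intro!: derivative_eq_intros K)
    then have "deriv ?r = (\<lambda>t. H t + b)" by (auto intro: DERIV_imp_deriv)
    then have "(deriv ?r has_real_derivative ?F f k t) (at t)" for t
      using DERIV_add[OF H(2) DERIV_const, of b t] by simp
    ultimately have "?P f k ?r" using ab by blast
    then show "\<exists>r. ?P f k r" by blast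
  qed
  then obtain f where f: "\<And>k. real_smooth (f k)" "\<And>k. C k (f k)"
    and df: "\<And>k t. (deriv (f k) has_real_derivative ?F f k t) (at t)" by blast
  define \<gamma> where "\<gamma> t = (\<chi> k. f k t)" for t
  define u where "u t = (\<chi> k. deriv (f k) t)" for t
  have "christoffel g i j k (?x f k t) * ?v f k i t * ?v f k j t
      = christoffel g i j k (\<gamma> t) * u t $ i * u t $ j" for i j k t
  proof (cases "i < k \<and> j < k")
    case True
    have "christoffel g i j k (?x f k t) = christoffel g i j k (\<gamma> t)"
      by (rule depends_only_belowD[OF plane_wave_christoffel(2)[OF w]]) (simp add: \<gamma>_def)
    with True show ?thesis by (simp add: u_def)
  qed (simp add: plane_wave_christoffel(1)[OF w])
  then have "(u has_vector_derivative - christoffel_map g (\<gamma> t) (u t) (u t)) (at t)" for t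
    unfolding has_vector_derivative_vec_iff using df by (simp add: christoffel_map_def u_def)
  moreover have "(\<gamma> has_vector_derivative u t) (at t)" for t
    unfolding has_vector_derivative_vec_iff using real_smooth_deriv(1)[OF f(1)] by (simp add: \<gamma>_def u_def)
  moreover have "smooth_curve_on UNIV \<gamma>" using f(1) by (intro smooth_curve_on_UNIV) (simp add: \<gamma>_def)
  ultimately have "geodesic_on g UNIV \<gamma>"
    by (subst geodesic_on_iff) (auto simp: is_interval_univ)
  moreover have "\<forall>k. C k (\<lambda>t. \<gamma> t $ k)" using f(2) by (simp add: \<gamma>_def)
  ultimately show ?thesis by blast
qed

text \<open>
  Uniqueness for both the initial and the boundary value problem, one coordinate at a time: when
  two geodesics agree below \<open>k\<close>, their \<open>k\<close>-th coordinates have the same second derivative.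
\<close>

lemma geodesic_difference_affine:
  fixes \<gamma> \<eta> :: "real \<Rightarrow> (real, 'n::{finite,linorder}) vec"
  assumes w: "generalized_plane_wave g" and S: "convex S" "t0 \<in> S"
    and d\<gamma>: "\<forall>t\<in>S. (\<gamma> has_vector_derivative u t) (at t within S) \<and>
      (u has_vector_derivative - christoffel_map g (\<gamma> t) (u t) (u t)) (at t within S)"
    and d\<eta>: "\<forall>t\<in>S. (\<eta> has_vector_derivative v t) (at t within S) \<and>
      (v has_vector_derivative - christoffel_map g (\<eta> t) (v t) (v t)) (at t within S)"
    and eq: "\<forall>a<k. \<forall>t\<in>S. \<gamma> t $ a = \<eta> t $ a \<and> u t $ a = v t $ a"
    and t: "t \<in> S"
  shows "u t $ k - v t $ k = u t0 $ k - v t0 $ k"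
    and "\<gamma> t $ k - \<eta> t $ k = \<gamma> t0 $ k - \<eta> t0 $ k + (u t0 $ k - v t0 $ k) * (t - t0)"
proof -
  have \<gamma>: "(\<gamma> has_vector_derivative u t) (at t within S)"
      "(u has_vector_derivative - christoffel_map g (\<gamma> t) (u t) (u t)) (at t within S)"
    and \<eta>: "(\<eta> has_vector_derivative v t) (at t within S)"
      "(v has_vector_derivative - christoffel_map g (\<eta> t) (v t) (v t)) (at t within S)"
    if "t \<in> S" for t
    using d\<gamma> d\<eta> that by blast+
  have G: "christoffel_map g (\<gamma> t) (u t) (u t) $ k = christoffel_map g (\<eta> t) (v t) (v t) $ k"
    if "t \<in> S" for t
  proof -
    have "christoffel g i j k (\<gamma> t) * u t $ i * u t $ j = christoffel g i j k (\<eta> t) * v t $ i * v t $ j" for i j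
    proof (cases "i < k \<and> j < k")
      case True
      have "christoffel g i j k (\<gamma> t) = christoffel g i j k (\<eta> t)"
        by (rule depends_only_belowD[OF plane_wave_christoffel(2)[OF w]]) (use eq that in blast)
      with True eq that show ?thesis by simp
    qed (simp add: plane_wave_christoffel(1)[OF w])
    then show ?thesis by (simp add: christoffel_map_def)
  qed
  have "((\<lambda>t. u t $ k - v t $ k) has_real_derivative 0) (at t within S)" if "t \<in> S" for t
    using DERIV_diff[OF \<gamma>(2)[OF that, unfolded has_vector_derivative_vec_iff, rule_format, of k]
        \<eta>(2)[OF that, unfolded has_vector_derivative_vec_iff, rule_format, of k]] G[OF that] by simp
  from zero_derivative_imp_eq[OF S(1) this]
  have c: "u t $ k - v t $ k = u t0 $ k - v t0 $ k" if "t \<in> S" for t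
    using that S(2) by blast
  then show "u t $ k - v t $ k = u t0 $ k - v t0 $ k" using t by blast
  let ?c = "u t0 $ k - v t0 $ k"
  have "((\<lambda>t. \<gamma> t $ k - \<eta> t $ k - ?c * t) has_real_derivative 0) (at t within S)" if "t \<in> S" for t
    using DERIV_diff[OF DERIV_diff[OF \<gamma>(1)[OF that, unfolded has_vector_derivative_vec_iff, rule_format, of k]
        \<eta>(1)[OF that, unfolded has_vector_derivative_vec_iff, rule_format, of k]]
        DERIV_cmult[OF DERIV_ident, of ?c]] c[OF that] by simp
  from zero_derivative_imp_eq[OF S(1) this t S(2)]
  show "\<gamma> t $ k - \<eta> t $ k = \<gamma> t0 $ k - \<eta> t0 $ k + ?c * (t - t0)"
    by (simp add: algebra_simps)
qed

lemma plane_wave_complete: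
  assumes g: "pseudo_riemannian p q g" and w: "generalized_plane_wave g"
  shows "complete_metric g"
  unfolding complete_metric_def
proof (intro allI impI)
  fix S :: "real set" and \<gamma> :: "real \<Rightarrow> (real, 'a) vec"
  assume *: "is_interval S \<and> interior S \<noteq> {} \<and> geodesic_on g S \<gamma>"
  then have S: "is_interval S" "interior S \<noteq> {}" and cS: "convex S" by (auto simp: is_interval_convex)
  then obtain t0 where t0: "t0 \<in> S" using interior_subset by blast
  obtain u where \<gamma>: "\<forall>t\<in>S. (\<gamma> has_vector_derivative u t) (at t within S) \<and>
      (u has_vector_derivative - christoffel_map g (\<gamma> t) (u t) (u t)) (at t within S)"
    using * geodesic_on_iff[OF S, of g \<gamma>] by blast
  have "\<exists>a b. h t0 + (a + b * t0) = \<gamma> t0 $ k \<and> deriv (\<lambda>t. h t + (a + b * t)) t0 = u t0 $ k"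
    if h: "real_smooth h" for k h
  proof -
    \<comment> \<open>The slope corrects the velocity at \<open>t0\<close>, the constant term the position.\<close>
    let ?b = "u t0 $ k - deriv h t0"
    have "((\<lambda>t. h t + (\<gamma> t0 $ k - h t0 - ?b * t0 + ?b * t)) has_real_derivative deriv h t0 + ?b) (at t0)"
      by (auto intro!: derivative_eq_intros real_smooth_deriv(1)[OF h])
    then have "deriv (\<lambda>t. h t + (\<gamma> t0 $ k - h t0 - ?b * t0 + ?b * t)) t0 = u t0 $ k"
      by (simp add: DERIV_imp_deriv)
    then show ?thesis by (intro exI[of _ "\<gamma> t0 $ k - h t0 - ?b * t0"] exI[of _ ?b]) simp
  qed
  from geodesic_exists[OF g w, of "\<lambda>k h. h t0 = \<gamma> t0 $ k \<and> deriv h t0 = u t0 $ k", OF this]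
  obtain \<eta> where \<eta>: "geodesic_on g UNIV \<eta>" and
    init: "\<And>k. \<eta> t0 $ k = \<gamma> t0 $ k" "\<And>k. deriv (\<lambda>t. \<eta> t $ k) t0 = u t0 $ k"
    by blast
  have "\<exists>v. \<forall>t. (\<eta> has_vector_derivative v t) (at t) \<and>
      (v has_vector_derivative - christoffel_map g (\<eta> t) (v t) (v t)) (at t)"
    using \<eta> by (simp add: geodesic_on_iff is_interval_univ)
  then obtain v where v: "\<And>t. (\<eta> has_vector_derivative v t) (at t)"
      "\<And>t. (v has_vector_derivative - christoffel_map g (\<eta> t) (v t) (v t)) (at t)"
    by blast
  have "((\<lambda>t. \<eta> t $ k) has_real_derivative v t0 $ k) (at t0)" for k
    using v(1)[of t0] by (simp add: has_vector_derivative_vec_iff)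
  then have "deriv (\<lambda>t. \<eta> t $ k) t0 = v t0 $ k" for k by (rule DERIV_imp_deriv)
  with init(2) have i: "v t0 $ k = u t0 $ k" for k by simp
  have v': "\<forall>t\<in>S. (\<eta> has_vector_derivative v t) (at t within S) \<and>
      (v has_vector_derivative - christoffel_map g (\<eta> t) (v t) (v t)) (at t within S)"
    by (intro ballI conjI v[THEN has_vector_derivative_at_within])
  have "\<forall>t\<in>S. \<gamma> t $ k = \<eta> t $ k \<and> u t $ k = v t $ k" for k
  proof (induction k rule: finite_linorder_induct)
    case (less k)
    then have lo: "\<forall>a<k. \<forall>t\<in>S. \<gamma> t $ a = \<eta> t $ a \<and> u t $ a = v t $ a" by blast
    show ?case
    proof
      fix t assume t: "t \<in> S"
      show "\<gamma> t $ k = \<eta> t $ k \<and> u t $ k = v t $ k"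
        using geodesic_difference_affine[OF w cS t0 \<gamma> v' lo t] i[of k] init(1)[of k] by simp
    qed
  qed
  then have "\<forall>t\<in>S. \<eta> t = \<gamma> t" by (simp add: vec_eq_iff)
  with \<eta> show "\<exists>\<eta>. geodesic_on g UNIV \<eta> \<and> (\<forall>t\<in>S. \<eta> t = \<gamma> t)"
    by blast
qed

lemma plane_wave_strongly_convex:
  assumes g: "pseudo_riemannian p q g" and w: "generalized_plane_wave g"
  shows "strongly_geodesically_convex g"
  unfolding strongly_geodesically_convex_def
proof (intro allI)
  fix P Q :: "(real, 'a) vec"
  let ?I = "{0..1::real}"
  have I: "is_interval ?I" "interior ?I \<noteq> {}" "convex ?I" by (auto simp: is_interval_cc)
  \<comment> \<open>The affine correction interpolates the errors at \<open>0\<close> and \<open>1\<close>.\<close>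
  have "\<exists>a b. h 0 + (a + b * 0) = P $ k \<and> h 1 + (a + b * 1) = Q $ k" for h :: "real \<Rightarrow> real" and k
    by (intro exI[of _ "P $ k - h 0"] exI[of _ "Q $ k - h 1 - (P $ k - h 0)"]) simp
  from geodesic_exists[OF g w, of "\<lambda>k h. h 0 = P $ k \<and> h 1 = Q $ k", OF this]
  obtain \<gamma> where \<gamma>: "geodesic_on g UNIV \<gamma>" "\<gamma> 0 = P" "\<gamma> 1 = Q" by (auto simp: vec_eq_iff)
  have \<gamma>I: "geodesic_on g ?I \<gamma>" using geodesic_on_subset[OF \<gamma>(1) I(1,2)] .
  obtain u where u: "\<forall>t\<in>?I. (\<gamma> has_vector_derivative u t) (at t within ?I) \<and>
      (u has_vector_derivative - christoffel_map g (\<gamma> t) (u t) (u t)) (at t within ?I)"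
    using \<gamma>I geodesic_on_iff[OF I(1,2), of g \<gamma>] by blast
  have uniq: "\<eta> t = \<gamma> t" if \<eta>: "geodesic_on g ?I \<eta>" "\<eta> 0 = P" "\<eta> 1 = Q" and t: "t \<in> ?I" for \<eta> t
  proof -
    obtain v where v: "\<forall>t\<in>?I. (\<eta> has_vector_derivative v t) (at t within ?I) \<and>
        (v has_vector_derivative - christoffel_map g (\<eta> t) (v t) (v t)) (at t within ?I)"
      using \<eta>(1) geodesic_on_iff[OF I(1,2), of g \<eta>] by blast
    have "\<forall>t\<in>?I. \<gamma> t $ k = \<eta> t $ k \<and> u t $ k = v t $ k" for k
    proof (induction k rule: finite_linorder_induct)
      case (less k)
      then have lo: "\<forall>a<k. \<forall>t\<in>?I. \<gamma> t $ a = \<eta> t $ a \<and> u t $ a = v t $ a" by blast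
      have 0: "0 \<in> ?I" and 1: "1 \<in> ?I" by auto
      note d = geodesic_difference_affine[OF w I(3) 0 u v lo]
      have "\<gamma> 0 $ k = \<eta> 0 $ k" "\<gamma> 1 $ k = \<eta> 1 $ k" using \<gamma>(2,3) \<eta>(2,3) by simp_all
      then have z: "u 0 $ k - v 0 $ k = 0" "\<gamma> 0 $ k - \<eta> 0 $ k = 0" using d(2)[OF 1] by simp_all
      show ?case
      proof
        fix t assume "t \<in> ?I"
        from d[OF this, unfolded z] show "\<gamma> t $ k = \<eta> t $ k \<and> u t $ k = v t $ k" by simp
      qed
    qed
    then have "\<eta> t $ k = \<gamma> t $ k" for k using t by metis
    then show ?thesis by (simp only: vec_eq_iff) blast
  qed
  have "geodesic_on g ?I \<gamma> \<and> \<gamma> 0 = P \<and> \<gamma> 1 = Q \<and>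
      (\<forall>\<eta>. geodesic_on g ?I \<eta> \<and> \<eta> 0 = P \<and> \<eta> 1 = Q \<longrightarrow> (\<forall>t\<in>?I. \<eta> t = \<gamma> t))"
    by (intro conjI allI impI ballI \<gamma>I \<gamma>(2,3), elim conjE, rule uniq)
  then show "\<exists>\<gamma>. geodesic_on g ?I \<gamma> \<and> \<gamma> 0 = P \<and> \<gamma> 1 = Q \<and>
      (\<forall>\<eta>. geodesic_on g ?I \<eta> \<and> \<eta> 0 = P \<and> \<eta> 1 = Q \<longrightarrow> (\<forall>t\<in>?I. \<eta> t = \<gamma> t))"
    by (rule exI[where x = \<gamma>])
qed

section \<open>A basis adapted to the flag in which the metric is monomial\<close>

lemma finite_linorder_induct_down [case_names less]:
  fixes k :: "'n::{finite,linorder}"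
  assumes "\<And>k. (\<And>a. k < a \<Longrightarrow> P a) \<Longrightarrow> P k"
  shows "P k"
proof (induction "card {a. k < a}" arbitrary: k rule: less_induct)
  case less
  show ?case
  proof (rule assms)
    fix a assume "k < a"
    then have "{b. a < b} \<subset> {b. k < b}" by (auto intro: less_trans)
    then show "P a" by (intro less psubset_card_mono) auto
  qed
qed

text \<open>
  The basis vector \<open>e i\<close> equals \<open>\<partial>\<^sub>i\<close> up to later coordinate vectors. Such bases respect the
  flag of the subspaces spanned by \<open>\<partial>\<^sub>k, \<dots>, \<partial>\<^sub>m\<close>, and in them a triangular tensor stays
  triangular.
\<close>

definition flag_basis :: "('n \<Rightarrow> real^('n::{finite,linorder})) \<Rightarrow> bool" where
  "flag_basis e \<longleftrightarrow> (\<forall>i. e i $ i = 1 \<and> (\<forall>l<i. e i $ l = 0))"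

lemma vec_eq_sum_axis:
  fixes v :: "real^'n::finite"
  shows "v = (\<Sum>l\<in>UNIV. v $ l *\<^sub>R axis l 1)"
  using basis_expansion[of v] by (simp only: scalar_mult_eq_scaleR)

text \<open>
  Solves \<open>e k = \<partial>\<^sub>k + \<dots>\<close> for \<open>\<partial>\<^sub>k\<close>, so that values of \<open>f\<close> on coordinate vectors can be found by
  descending induction.
\<close>

lemma linear_functional_axis_flag:
  assumes e: "flag_basis e" and f: "linear f"
  shows "f (axis k 1) = (f (e k) - (\<Sum>l | k < l. e k $ l * f (axis l 1)) :: real)"
proof -
  have "f (e k) = (\<Sum>l\<in>UNIV. e k $ l * f (axis l 1))"
    by (subst vec_eq_sum_axis) (simp add: linear_sum[OF f] linear_scale[OF f])
  also have "\<dots> = (\<Sum>l\<in>insert k {l. k < l}. e k $ l * f (axis l 1))"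
  proof (rule sum.mono_neutral_right)
    show "\<forall>i\<in>UNIV - insert k {l. k < l}. e k $ i * f (axis i 1) = 0"
      using e by (auto simp: flag_basis_def not_less)
  qed auto
  also have "\<dots> = f (axis k 1) + (\<Sum>l | k < l. e k $ l * f (axis l 1))"
    using e by (simp add: flag_basis_def)
  finally show ?thesis by simp
qed

lemma linear_functional_vanish_flag:
  assumes e: "flag_basis e" and f: "linear (f :: (real, 'n::{finite,linorder}) vec \<Rightarrow> real)"
    and z: "\<And>j. i < j \<Longrightarrow> f (e j) = 0" and j: "i < j"
  shows "f (axis j 1) = 0"
  using j
proof (induction j rule: finite_linorder_induct_down)
  case (less k)
  then have "f (axis l 1) = 0" if "k < l" for l using that by (meson less_trans)
  then show ?case using linear_functional_axis_flag[OF e f, of k] z[OF less.prems] by simp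
qed

lemma linear_functional_eq_0_flag:
  assumes e: "flag_basis e" and f: "linear (f :: (real, 'n::{finite,linorder}) vec \<Rightarrow> real)"
    and z: "\<And>j. f (e j) = 0"
  shows "f v = 0"
proof -
  have a: "f (axis k 1) = 0" for k
  proof (induction k rule: finite_linorder_induct_down)
    case (less k)
    then show ?case using linear_functional_axis_flag[OF e f, of k] z by simp
  qed
  show ?thesis by (subst vec_eq_sum_axis) (simp add: linear_sum[OF f] linear_scale[OF f] a)
qed

text \<open>
  Each \<open>e i\<close> with \<open>i \<in> S\<close> is orthogonal to all basis vectors but its partner \<open>e (w i)\<close>.
\<close>

definition monomial_on ::
  "('v \<Rightarrow> 'v \<Rightarrow> real) \<Rightarrow> ('n \<Rightarrow> 'v) \<Rightarrow> ('n \<Rightarrow> 'n) \<Rightarrow> 'n set \<Rightarrow> bool" where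
  "monomial_on B e w S \<longleftrightarrow>
     (\<forall>i\<in>S. w i \<in> S \<and> w (w i) = i \<and> (\<forall>j. j \<noteq> w i \<longrightarrow> B (e i) (e j) = 0))"

text \<open>
  One step of Gram-Schmidt for an indefinite form that may only add later basis vectors to
  earlier ones. Let \<open>m\<close> be the last index outside \<open>S\<close> and \<open>j\<close> the last one with
  \<open>B (e m) (e j) \<noteq> 0\<close>. If \<open>j = m\<close>, split off the anisotropic vector \<open>e m\<close>. If \<open>j < m\<close>, then \<open>e m\<close>
  is isotropic; make \<open>e j\<close> isotropic too by adding a multiple of \<open>e m\<close>, and split off the
  hyperbolic plane. Correcting \<open>e i\<close> by a multiple of \<open>e j\<close> is called for only if
  \<open>B (e m) (e i) \<noteq> 0\<close>, hence only if \<open>i < j\<close>, so the flag is respected.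
\<close>

lemma monomial_flag_basis_step:
  fixes B :: "real^('n::{finite,linorder}) \<Rightarrow> real^('n::{finite,linorder}) \<Rightarrow> real"
  assumes B: "bilinear B" and sym: "\<And>u v. B u v = B v u" and nd: "\<And>u. u \<noteq> 0 \<Longrightarrow> \<exists>v. B u v \<noteq> 0"
    and e: "flag_basis e" and w: "monomial_on B e w S" and S: "S \<noteq> UNIV"
  shows "\<exists>e' w' S'. flag_basis e' \<and> monomial_on B e' w' S' \<and> S \<subset> S'"
proof -
  note B_simps = bilinear_ladd[OF B] bilinear_radd[OF B] bilinear_lsub[OF B] bilinear_rsub[OF B]
    bilinear_lmul[OF B] bilinear_rmul[OF B]
  have linB: "linear (B u)" for u using B by (simp add: bilinear_def)
  have e1: "e i $ i = 1" and e0: "l < i \<Longrightarrow> e i $ l = 0" for i l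
    using e by (auto simp: flag_basis_def)
  have wS: "w i \<in> S" "w (w i) = i" and w0: "j \<noteq> w i \<Longrightarrow> B (e i) (e j) = 0" if "i \<in> S" for i j
    using w that by (auto simp: monomial_on_def)
  have out: "B (e i) (e j) = 0" "B (e j) (e i) = 0" if "i \<in> S" "j \<notin> S" for i j
    using w0[OF that(1), of j] wS(1)[OF that(1)] that(2) sym[of "e i" "e j"] by auto
  define m where "m = Max (- S)"
  have mS: "m \<notin> S" and m_max: "\<And>i. i \<notin> S \<Longrightarrow> i \<le> m"
    using Max_in[of "- S"] Max_ge[of "- S"] S by (auto simp: m_def)
  define J where "J = {j. B (e m) (e j) \<noteq> 0}"
  have "J \<noteq> {}"
  proof
    assume "J = {}"
    then have "B (e m) v = 0" for v
      using linear_functional_eq_0_flag[OF e linB] by (simp add: J_def)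
    moreover have "e m \<noteq> 0" using e1[of m] by auto
    ultimately show False using nd by blast
  qed
  define j where "j = Max J"
  have "j \<in> J" using Max_in[of J] \<open>J \<noteq> {}\<close> by (simp add: j_def)
  then have b: "B (e m) (e j) \<noteq> 0" by (simp add: J_def)
  have jS: "j \<notin> S" using out(2)[OF _ mS] b by blast
  have j_max: "B (e m) (e i) = 0" if "j < i" for i
    using Max_ge[of J i] that by (fastforce simp: J_def j_def)
  have jm: "j \<le> m" using m_max jS by blast
  show ?thesis
  proof (cases "j = m")
    case True
    define c where "c i = B (e m) (e i) / B (e m) (e m)" for i
    define e' where "e' i = (if i \<in> insert m S then e i else e i - c i *\<^sub>R e m)" for i
    have "flag_basis e'"
      unfolding flag_basis_def
    proof (intro allI conjI impI)
      fix i l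
      have "i < m" if "i \<notin> insert m S" using that m_max by force
      then show "e' i $ i = 1" "l < i \<Longrightarrow> e' i $ l = 0"
        using e1 e0 by (auto simp: e'_def)
    qed
    moreover have "monomial_on B e' (w(m := m)) (insert m S)"
      unfolding monomial_on_def
    proof (intro ballI conjI allI impI)
      fix i assume i: "i \<in> insert m S"
      show "(w(m := m)) i \<in> insert m S" "(w(m := m)) ((w(m := m)) i) = i"
        using i wS mS by auto
      fix l assume l: "l \<noteq> (w(m := m)) i"
      show "B (e' i) (e' l) = 0"
      proof (cases "i = m")
        case i: True
        then have "l \<noteq> m" using l by simp
        then show ?thesis
          using out(2)[OF _ mS, of l] b True i by (auto simp: e'_def c_def B_simps)
      next
        case False
        then have "i \<in> S" "l \<noteq> w i" using i l by auto
        then show ?thesis using w0[of i l] out(1)[of i m] mS by (auto simp: e'_def B_simps)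
      qed
    qed
    ultimately show ?thesis using mS by (intro exI[of _ e'] exI[of _ "w(m := m)"] exI[of _ "insert m S"]) auto
  next
    case False
    then have jlt: "j < m" using jm by simp
    have mm: "B (e m) (e m) = 0" by (rule j_max[OF jlt])
    let ?b = "B (e m) (e j)"
    \<comment> \<open>The coefficient solves \<open>B f f = 0\<close>.\<close>
    define f where "f = e j - (B (e j) (e j) / (2 * ?b)) *\<^sub>R e m"
    have Bmf: "B (e m) f = ?b" "B f (e m) = ?b"
      using mm sym[of f "e m"] by (simp_all add: f_def B_simps)
    have Bff: "B f f = 0"
      using b mm sym[of "e j" "e m"] by (simp add: f_def B_simps field_simps)
    have f1: "f $ j = 1" "\<And>l. l < j \<Longrightarrow> f $ l = 0"
      using e1 e0 jlt by (auto simp: f_def)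
    \<comment> \<open>Making \<open>e i\<close> orthogonal to \<open>e m\<close> by means of \<open>f\<close> and then to \<open>f\<close> by means of \<open>e m\<close>: as both are
    isotropic, the second correction does not spoil the first.\<close>
    define h where "h i = e i - (B (e m) (e i) / ?b) *\<^sub>R f" for i
    define r where "r i = h i - (B f (h i) / ?b) *\<^sub>R e m" for i
    have rm: "B (e m) (r i) = 0" for i
      using b by (simp add: r_def h_def B_simps mm Bmf)
    have rf: "B f (r i) = 0" for i
      using b by (simp add: r_def B_simps Bmf)
    define e' where "e' i = (if i \<in> S \<or> i = m then e i else if i = j then f else r i)" for i
    have "flag_basis e'"
      unfolding flag_basis_def
    proof (intro allI conjI impI)
      fix i l
      have r: "r i $ x = e i $ x" if "i \<notin> S" "i \<noteq> m" "i \<noteq> j" "x \<le> i" for x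
      proof -
        have "i < m" using that m_max by force
        then have "e m $ x = 0" using that e0 by simp
        moreover have "B (e m) (e i) * f $ x = 0"
        proof (cases "i < j")
          case True
          then show ?thesis using f1 that by simp
        next
          case False
          then show ?thesis using j_max[of i] that by simp
        qed
        ultimately show ?thesis by (auto simp: r_def h_def)
      qed
      show "e' i $ i = 1" using r[of i] e1 f1 by (auto simp: e'_def)
      show "e' i $ l = 0" if "l < i" using r[of l] e0 f1 that by (auto simp: e'_def)
    qed
    moreover have "monomial_on B e' (w(m := j, j := m)) (S \<union> {j, m})"
      unfolding monomial_on_def
    proof (intro ballI conjI allI impI)
      let ?w = "w(m := j, j := m)"
      fix i assume i: "i \<in> S \<union> {j, m}"
      show "?w i \<in> S \<union> {j, m}" "?w (?w i) = i"
        using i wS mS jS False by auto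
      fix l assume l: "l \<noteq> ?w i"
      have Sf: "B (e a) f = 0" "B f (e a) = 0" if "a \<in> S" for a
        using out[OF that mS] out[OF that jS] by (simp_all add: f_def B_simps)
      have Sr: "B (e a) (r x) = 0" if "a \<in> S" "x \<notin> S" for a x
        using out[OF that(1) mS] out[OF that] Sf[OF that(1)] by (simp add: r_def h_def B_simps)
      consider "i \<in> S" | "i = j" | "i = m" using i by blast
      then show "B (e' i) (e' l) = 0"
      proof cases
        case 1
        then have "i \<noteq> m" "i \<noteq> j" using mS jS by blast+
        then have "l \<noteq> w i" using l by simp
        then show ?thesis
          using w0[OF 1, of l] out(1)[OF 1 mS] Sf(1)[OF 1] Sr[OF 1, of l] 1 by (auto simp: e'_def)
      next
        case 2
        then have "l \<noteq> m" using l by simp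
        then show ?thesis
          using 2 jS False Sf(2)[of l] Bff rf[of l] by (auto simp: e'_def)
      next
        case 3
        then have "l \<noteq> j" using l False by simp
        then show ?thesis
          using 3 mS mm out(2)[OF _ mS, of l] rm[of l] by (auto simp: e'_def)
      qed
    qed
    ultimately show ?thesis
      using mS by (intro exI[of _ e'] exI[of _ "w(m := j, j := m)"] exI[of _ "S \<union> {j, m}"]) auto
  qed
qed

lemma monomial_flag_basis_exists:
  fixes B :: "real^('n::{finite,linorder}) \<Rightarrow> real^('n::{finite,linorder}) \<Rightarrow> real"
  assumes B: "bilinear B" and sym: "\<And>u v. B u v = B v u" and nd: "\<And>u. u \<noteq> 0 \<Longrightarrow> \<exists>v. B u v \<noteq> 0"
  shows "\<exists>e w. flag_basis e \<and> monomial_on B e w UNIV"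
proof -
  have "\<exists>e w. flag_basis e \<and> monomial_on B e w UNIV"
    if "flag_basis e" "monomial_on B e w S" for e w S
    using that
  proof (induction "card (- S)" arbitrary: e w S rule: less_induct)
    case less
    show ?case
    proof (cases "S = UNIV")
      case False
      obtain e' w' S' where e': "flag_basis e'" "monomial_on B e' w' S'" and "S \<subset> S'"
        using monomial_flag_basis_step[OF B sym nd less.prems False] by blast
      then have "card (- S') < card (- S)" by (intro psubset_card_mono) auto
      from less.hyps[OF this e'] show ?thesis .
    qed (use less.prems in blast)
  qed
  moreover have "flag_basis (\<lambda>i. axis i 1 :: (real, 'n) vec)" by (auto simp: flag_basis_def axis_def)
  moreover have "monomial_on B (\<lambda>i. axis i 1) id {}" by (simp add: monomial_on_def)
  ultimately show ?thesis by blast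
qed

text \<open>
  A Bruhat-type decomposition of a symmetric matrix: the columns of \<open>A\<close> are a monomial basis
  adapted to the flag and \<open>C\<close> is its inverse, both triangular. The inverse of the metric is
  monomial in the dual basis with the same involution \<open>w\<close>.
\<close>

lemma symmetric_triangular_congruence:
  fixes G H :: "((real, 'n::{finite,linorder}) vec, 'n) vec"
  assumes sym: "transpose G = G" and H: "G ** H = mat 1"
  obtains A C :: "((real, 'n) vec, 'n) vec" and w :: "'n \<Rightarrow> 'n" where
    "A ** C = mat 1" "\<And>l i. A $ l $ i \<noteq> 0 \<Longrightarrow> i \<le> l" "\<And>l i. C $ i $ l \<noteq> 0 \<Longrightarrow> l \<le> i"
    "\<And>i. w (w i) = i"
    "\<And>i j. (transpose A ** G ** A) $ i $ j \<noteq> 0 \<longleftrightarrow> j = w i"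
    "\<And>i j. (C ** H ** transpose C) $ i $ j \<noteq> 0 \<Longrightarrow> j = w i"
proof -
  define B where "B u v = u \<bullet> (G *v v)" for u v
  have bil: "bilinear B"
    by (auto simp: bilinear_def B_def intro!: linearI
        simp: inner_add_left inner_add_right matrix_vector_right_distrib matrix_vector_mult_scaleR)
  have symB: "B u v = B v u" for u v
    unfolding B_def by (metis dot_lmul_matrix inner_commute sym transpose_matrix_vector)
  have nd: "\<exists>v. B u v \<noteq> 0" if "u \<noteq> 0" for u
  proof -
    have "B u (H *v u) = u \<bullet> u" by (simp add: B_def matrix_vector_mul_assoc H)
    then show ?thesis using that by (metis inner_eq_zero_iff)
  qed
  obtain e w where e: "flag_basis e" and w: "monomial_on B e w UNIV"
    using monomial_flag_basis_exists[OF bil symB nd] by blast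
  have linB: "linear (B u)" for u using bil by (simp add: bilinear_def)
  have ww: "w (w i) = i" and B0: "j \<noteq> w i \<Longrightarrow> B (e i) (e j) = 0" for i j
    using w by (auto simp: monomial_on_def)
  have e0: "e i \<noteq> 0" for i
  proof -
    have "e i $ i = 1" using e by (simp add: flag_basis_def)
    then show ?thesis by auto
  qed
  have Bw: "B (e i) (e (w i)) \<noteq> 0" for i
  proof
    assume z: "B (e i) (e (w i)) = 0"
    have "B (e i) (e j) = 0" for j using z B0 by (cases "j = w i") auto
    then have "B (e i) v = 0" for v using linear_functional_eq_0_flag[OF e linB] by blast
    then show False using nd e0 by blast
  qed
  define A :: "((real, 'n) vec, 'n) vec" where "A = (\<chi> l i. e i $ l)"
  \<comment> \<open>The rows of \<open>C\<close> are the dual basis, which monomiality makes explicit: pairing with \<open>e (w i)\<close>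
    detects exactly the coefficient of \<open>e i\<close>.\<close>
  define C :: "((real, 'n) vec, 'n) vec" where
    "C = (\<chi> i l. B (e (w i)) (axis l 1) / B (e (w i)) (e i))"
  have CA: "(C ** A) $ i $ j = (if i = j then 1 else 0)" for i j
  proof -
    have "(C ** A) $ i $ j = (\<Sum>l\<in>UNIV. e j $ l * B (e (w i)) (axis l 1)) / B (e (w i)) (e i)"
      by (simp add: matrix_matrix_mult_def A_def C_def sum_divide_distrib mult.commute)
    also have "(\<Sum>l\<in>UNIV. e j $ l * B (e (w i)) (axis l 1)) = B (e (w i)) (e j)"
      by (subst (3) vec_eq_sum_axis) (simp add: linear_sum[OF linB] linear_scale[OF linB])
    finally show ?thesis using Bw[of "w i"] B0[of j "w i"] by (auto simp: ww)
  qed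
  then have "C ** A = mat 1" by (simp add: vec_eq_iff mat_def)
  then have AC: "A ** C = mat 1" using matrix_left_right_inverse by blast
  let ?M = "transpose A ** G ** A"
  have M: "?M $ i $ j = B (e i) (e j)" for i j
  proof -
    have "?M = transpose A ** (G ** A)" by (simp add: matrix_mul_assoc)
    then show ?thesis
      by (simp add: matrix_matrix_mult_def transpose_def A_def B_def inner_vec_def matrix_vector_mult_def)
  qed
  have M_iff: "?M $ i $ j \<noteq> 0 \<longleftrightarrow> j = w i" for i j
    unfolding M using Bw B0 by blast
  let ?L = "C ** H ** transpose C"
  have "?M ** ?L = transpose A ** (G ** ((A ** C) ** H)) ** transpose C"
    by (simp add: matrix_mul_assoc)
  also have "\<dots> = transpose (C ** A)"
    by (simp add: AC H matrix_transpose_mul)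
  also have "\<dots> = mat 1" by (simp add: \<open>C ** A = mat 1\<close>)
  finally have prod: "?M ** ?L = mat 1" .
  have "?L $ i $ j = 0" if "j \<noteq> w i" for i j
  proof -
    have "(\<Sum>k\<in>UNIV. ?M $ (w i) $ k * ?L $ k $ j) = (mat 1 :: ((real, 'n) vec, 'n) vec) $ w i $ j"
      unfolding prod[symmetric] by (subst (3) matrix_matrix_mult_def) simp
    also have "\<dots> = 0" using that by (simp add: mat_def)
    also have "(\<Sum>k\<in>UNIV. ?M $ (w i) $ k * ?L $ k $ j) = (\<Sum>k\<in>{i}. ?M $ (w i) $ k * ?L $ k $ j)"
      by (rule sum.mono_neutral_right) (use M_iff[of "w i"] ww in auto)
    finally show ?thesis using M_iff[of "w i" i] by (simp add: ww)
  qed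
  moreover have "i \<le> l" if "A $ l $ i \<noteq> 0" for l i
    using that e by (force simp: A_def flag_basis_def not_less[symmetric])
  moreover have "l \<le> i" if "C $ i $ l \<noteq> 0" for l i
  proof (rule ccontr)
    assume "\<not> l \<le> i"
    then have "i < l" by simp
    moreover have "B (e (w i)) (e j) = 0" if "i < j" for j using B0[of j "w i"] that ww by auto
    ultimately have "B (e (w i)) (axis l 1) = 0" by (intro linear_functional_vanish_flag[OF e linB])
    then show False using that by (simp add: C_def)
  qed
  ultimately show thesis using that[OF AC _ _ ww M_iff] by blast
qed

text \<open>
  A monomial matrix only permutes and scales the rows of the transformed \<open>N\<close>, and the product is
  skew. So the entry at \<open>(k, c)\<close> is, up to a nonzero factor, the entry of the product at \<open>(w k, c)\<close>, which
  is minus the one at \<open>(c, w k)\<close>, and this comes from the entry of \<open>N\<close> at \<open>(w c, w k)\<close>.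
\<close>

lemma skew_in_monomial_basis:
  fixes G A C N :: "((real, 'n::finite) vec, 'n) vec"
  assumes sym: "transpose G = G" and skew: "transpose (G ** N) = - (G ** N)"
    and AC: "A ** C = mat 1" and ww: "\<And>i. w (w i) = i"
    and M: "\<And>i j. (transpose A ** G ** A) $ i $ j \<noteq> 0 \<longleftrightarrow> j = w i"
    and nz: "(C ** N ** A) $ k $ c \<noteq> 0"
  shows "(C ** N ** A) $ (w c) $ (w k) \<noteq> 0"
proof -
  let ?M = "transpose A ** G ** A" and ?N = "C ** N ** A"
  have row: "(?M ** ?N) $ i $ j = ?M $ i $ w i * ?N $ w i $ j" for i j
  proof -
    have "(?M ** ?N) $ i $ j = (\<Sum>k\<in>UNIV. ?M $ i $ k * ?N $ k $ j)"
      by (subst matrix_matrix_mult_def) simp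
    also have "\<dots> = (\<Sum>k\<in>{w i}. ?M $ i $ k * ?N $ k $ j)"
      by (rule sum.mono_neutral_right) (use M in auto)
    finally show ?thesis by simp
  qed
  have "?M ** ?N = transpose A ** G ** (A ** C) ** N ** A"
    by (simp add: matrix_mul_assoc)
  then have MN: "?M ** ?N = transpose A ** (G ** N) ** A"
    by (simp add: AC matrix_mul_assoc)
  have "transpose (?M ** ?N) = transpose A ** transpose (G ** N) ** A"
    unfolding MN by (simp add: matrix_transpose_mul transpose_transpose matrix_mul_assoc)
  also have "\<dots> = - (?M ** ?N)"
    unfolding skew MN by (simp add: vec_eq_iff matrix_matrix_mult_def sum_negf)
  finally have "transpose (?M ** ?N) $ w k $ c = - (?M ** ?N) $ w k $ c" by simp
  then have "(?M ** ?N) $ c $ w k = - (?M ** ?N) $ w k $ c"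
    by (simp only: transpose_def vec_lambda_beta)
  then have "?M $ c $ w c * ?N $ w c $ w k = - (?M $ w k $ k * ?N $ k $ c)"
    by (simp only: row ww)
  moreover have "?M $ w k $ k \<noteq> 0" using M ww by simp
  ultimately show ?thesis using nz by auto
qed

section \<open>Weyl invariants\<close>

lemma nonzero_sum_imp_nonzero_term:
  fixes f :: "'a \<Rightarrow> real"
  assumes "sum f S \<noteq> 0"
  shows "\<exists>x. f x \<noteq> 0"
proof (rule ccontr)
  assume "\<not> ?thesis"
  then have "sum f S = 0" by (intro sum.neutral) blast
  with assms show False ..
qed

lemma sum_PiE_insert:
  fixes h :: "('a \<Rightarrow> 'b) \<Rightarrow> real"
  assumes "finite Z" "x \<notin> Z" "finite T"
  shows "(\<Sum>\<rho>\<in>PiE (insert x Z) (\<lambda>_. T). h \<rho>) = (\<Sum>\<rho>\<in>PiE Z (\<lambda>_. T). \<Sum>r\<in>T. h (\<rho>(x := r)))"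
proof -
  have "(\<Sum>\<rho>\<in>PiE (insert x Z) (\<lambda>_. T). h \<rho>) =
      (\<Sum>(r, \<rho>)\<in>T \<times> PiE Z (\<lambda>_. T). h (\<rho>(x := r)))"
    unfolding PiE_insert_eq
    using sum.reindex[OF inj_combinator[OF assms(2), where T = "\<lambda>_. T"], of h]
    by (simp add: case_prod_beta)
  also have "\<dots> = (\<Sum>r\<in>T. \<Sum>\<rho>\<in>PiE Z (\<lambda>_. T). h (\<rho>(x := r)))"
    by (simp add: sum.cartesian_product)
  finally show ?thesis by (subst sum.swap)
qed

text \<open>
  If \<open>x\<close> and \<open>y\<close> enter a product only through their own weights and the factor \<open>v\<close>, the sum over
  these two variables splits off, and it must be nonzero for some values of the others.
\<close>

lemma nonzero_sum_PiE_extract: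
  fixes W :: "'a \<Rightarrow> 'b::finite \<Rightarrow> real"
  assumes X: "finite X" "x \<in> X" "y \<in> X" "x \<noteq> y"
    and rest: "\<And>\<rho> r s. rest (\<rho>(x := r, y := s)) = rest \<rho>"
    and nz: "(\<Sum>\<rho>\<in>PiE X (\<lambda>_. UNIV). (\<Prod>z\<in>X. W z (\<rho> z)) * (v \<rho> * rest \<rho>)) \<noteq> 0"
  obtains \<rho> where "\<And>z. z \<in> X \<Longrightarrow> z \<noteq> x \<Longrightarrow> z \<noteq> y \<Longrightarrow> W z (\<rho> z) \<noteq> 0"
    "(\<Sum>r\<in>UNIV. \<Sum>s\<in>UNIV. W x r * W y s * v (\<rho>(x := r, y := s))) \<noteq> 0"
proof -
  define Z where "Z = X - {x, y}"
  have Z: "finite Z" "x \<notin> Z" "y \<notin> insert x Z" and XZ: "X = insert y (insert x Z)"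
    using X by (auto simp: Z_def)
  let ?F = "\<lambda>\<rho>. (\<Prod>z\<in>X. W z (\<rho> z)) * (v \<rho> * rest \<rho>)"
  have F: "?F (\<rho>(x := r, y := s)) = (\<Prod>z\<in>Z. W z (\<rho> z)) * rest \<rho> * (W x r * W y s * v (\<rho>(x := r, y := s)))"
    for \<rho> r s
  proof -
    have "(\<Prod>z\<in>X. W z ((\<rho>(x := r, y := s)) z)) = W y s * (W x r * (\<Prod>z\<in>Z. W z (\<rho> z)))"
    proof -
      have "(\<Prod>z\<in>Z. W z ((\<rho>(x := r, y := s)) z)) = (\<Prod>z\<in>Z. W z (\<rho> z))"
        using Z by (intro prod.cong) auto
      then show ?thesis unfolding XZ using Z X(4) by simp
    qed
    then show ?thesis by (simp add: rest mult_ac)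
  qed
  have "(\<Sum>\<rho>\<in>PiE X (\<lambda>_. UNIV). h \<rho>) =
      (\<Sum>\<rho>\<in>PiE Z (\<lambda>_. UNIV). \<Sum>r\<in>UNIV. \<Sum>s\<in>UNIV. h (\<rho>(x := r, y := s)))"
    for h :: "('a \<Rightarrow> 'b) \<Rightarrow> real"
    unfolding XZ sum_PiE_insert[OF finite.insertI[OF Z(1)] Z(3) finite] sum_PiE_insert[OF Z(1,2) finite]
    by (rule refl)
  then have "(\<Sum>\<rho>\<in>PiE X (\<lambda>_. UNIV). ?F \<rho>) =
      (\<Sum>\<rho>\<in>PiE Z (\<lambda>_. UNIV). \<Sum>r\<in>UNIV. \<Sum>s\<in>UNIV. ?F (\<rho>(x := r, y := s)))" .
  also have "\<dots> = (\<Sum>\<rho>\<in>PiE Z (\<lambda>_. UNIV). (\<Prod>z\<in>Z. W z (\<rho> z)) * rest \<rho> *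
      (\<Sum>r\<in>UNIV. \<Sum>s\<in>UNIV. W x r * W y s * v (\<rho>(x := r, y := s))))"
    unfolding F by (simp only: sum_distrib_left)
  finally have "(\<Sum>\<rho>\<in>PiE Z (\<lambda>_. UNIV). (\<Prod>z\<in>Z. W z (\<rho> z)) * rest \<rho> *
      (\<Sum>r\<in>UNIV. \<Sum>s\<in>UNIV. W x r * W y s * v (\<rho>(x := r, y := s)))) \<noteq> 0"
    using nz by (simp only:) blast
  from nonzero_sum_imp_nonzero_term[OF this] obtain \<rho> where "(\<Prod>z\<in>Z. W z (\<rho> z)) * rest \<rho> *
      (\<Sum>r\<in>UNIV. \<Sum>s\<in>UNIV. W x r * W y s * v (\<rho>(x := r, y := s))) \<noteq> 0" by blast
  then show thesis
    using Z by (intro that[of \<rho>]) (auto simp: Z_def)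
qed

text \<open>
  A slot is an occurrence of an index name, \<open>(True, n)\<close> the upper and \<open>(False, n)\<close> the lower one.
  The weight is the entry of the change of basis that links the old index \<open>r\<close> in the slot with the
  new index \<open>\<tau> n\<close>.
\<close>

definition slot_weight :: "real^'n^'n \<Rightarrow> real^'n^'n \<Rightarrow> ('c \<Rightarrow> 'n) \<Rightarrow> bool \<times> 'c \<Rightarrow> 'n::finite \<Rightarrow> real"
  where "slot_weight A C \<tau> z r = (if fst z then C $ \<tau> (snd z) $ r else A $ r $ \<tau> (snd z))"

text \<open>
  Invariance of full contractions, as an expansion: inserting \<open>A ** C = mat 1\<close> at every contracted
  pair turns a sum over one index per name into a sum over a new index \<open>\<tau> n\<close> per name and
  independent old indices \<open>\<rho>\<close> in the two slots of that name.
\<close>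

lemma contraction_change_of_basis:
  fixes A C :: "real^'n^'n::finite" and F :: "('c \<Rightarrow> 'n) \<Rightarrow> ('c \<Rightarrow> 'n) \<Rightarrow> real"
  assumes AC: "A ** C = mat 1" and N: "finite N"
  shows "(\<Sum>\<sigma>\<in>PiE N (\<lambda>_. UNIV). F \<sigma> \<sigma>) =
    (\<Sum>\<tau>\<in>PiE N (\<lambda>_. UNIV). \<Sum>\<rho>\<in>PiE (UNIV \<times> N) (\<lambda>_. UNIV).
      (\<Prod>z\<in>UNIV \<times> N. slot_weight A C \<tau> z (\<rho> z))
      * F (\<lambda>n. \<rho> (True, n)) (\<lambda>n. \<rho> (False, n)))"
proof -
  let ?P = "PiE N (\<lambda>_. UNIV) :: ('c \<Rightarrow> 'n) set"
  let ?Q = "PiE (UNIV \<times> N) (\<lambda>_. UNIV) :: (bool \<times> 'c \<Rightarrow> 'n) set"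
  have fQ: "finite ?Q" using N by (intro finite_PiE) auto
  have pr: "(\<Prod>z\<in>UNIV \<times> N. slot_weight A C \<tau> z (\<rho> z)) =
      (\<Prod>n\<in>N. A $ \<rho> (False, n) $ \<tau> n * C $ \<tau> n $ \<rho> (True, n))" for \<tau> \<rho>
    unfolding prod.cartesian_product'
    by (simp add: UNIV_bool prod.distrib slot_weight_def mult.commute)
  have delta: "(\<Sum>r\<in>UNIV. A $ a $ r * C $ r $ b) = (if a = b then 1 else 0)" for a b
    using arg_cong[OF AC, of "\<lambda>M. M $ a $ b"] by (simp add: matrix_matrix_mult_def mat_def)
  have eq: "(\<Sum>\<tau>\<in>?P. \<Prod>n\<in>N. A $ \<rho> (False, n) $ \<tau> n * C $ \<tau> n $ \<rho> (True, n)) =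
      (if \<forall>n\<in>N. \<rho> (False, n) = \<rho> (True, n) then 1 else 0)" for \<rho>
  proof -
    have "(\<Sum>\<tau>\<in>?P. \<Prod>n\<in>N. A $ \<rho> (False, n) $ \<tau> n * C $ \<tau> n $ \<rho> (True, n)) =
        (\<Prod>n\<in>N. \<Sum>r\<in>UNIV. A $ \<rho> (False, n) $ r * C $ r $ \<rho> (True, n))"
      by (rule prod_sum_PiE[symmetric]) (use N in auto)
    also have "\<dots> = (\<Prod>n\<in>N. if \<rho> (False, n) = \<rho> (True, n) then 1 else 0)"
      by (simp only: delta)
    also have "\<dots> = (if \<forall>n\<in>N. \<rho> (False, n) = \<rho> (True, n) then 1 else 0)"
      using N by (auto intro!: prod_zero)
    finally show ?thesis .
  qed
  have "(\<Sum>\<tau>\<in>?P. \<Sum>\<rho>\<in>?Q. (\<Prod>z\<in>UNIV \<times> N. slot_weight A C \<tau> z (\<rho> z))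
      * F (\<lambda>n. \<rho> (True, n)) (\<lambda>n. \<rho> (False, n))) =
    (\<Sum>\<rho>\<in>?Q. (\<Sum>\<tau>\<in>?P. \<Prod>n\<in>N. A $ \<rho> (False, n) $ \<tau> n * C $ \<tau> n $ \<rho> (True, n))
      * F (\<lambda>n. \<rho> (True, n)) (\<lambda>n. \<rho> (False, n)))"
    unfolding pr sum_distrib_right by (rule sum.swap)
  also have "\<dots> = (\<Sum>\<rho>\<in>?Q. if \<forall>n\<in>N. \<rho> (False, n) = \<rho> (True, n)
      then F (\<lambda>n. \<rho> (True, n)) (\<lambda>n. \<rho> (False, n)) else 0)"
    unfolding eq by (intro sum.cong) auto
  also have "\<dots> = (\<Sum>\<rho> | \<rho> \<in> ?Q \<and> (\<forall>n\<in>N. \<rho> (False, n) = \<rho> (True, n)).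
      F (\<lambda>n. \<rho> (True, n)) (\<lambda>n. \<rho> (False, n)))"
    using fQ by (rule sum.inter_filter[symmetric])
  also have "\<dots> = (\<Sum>\<sigma>\<in>?P. F \<sigma> \<sigma>)"
  proof (rule sum.reindex_bij_witness[of _ "\<lambda>\<sigma> (u, n). \<sigma> n" "\<lambda>\<rho> n. \<rho> (True, n)"])
    fix \<rho> assume "\<rho> \<in> {\<rho>. \<rho> \<in> ?Q \<and> (\<forall>n\<in>N. \<rho> (False, n) = \<rho> (True, n))}"
    then have \<rho>: "\<rho> \<in> ?Q" "\<forall>n\<in>N. \<rho> (False, n) = \<rho> (True, n)" by auto
    have "\<rho> (False, n) = \<rho> (True, n)" for n
    proof (cases "n \<in> N")
      case False
      then show ?thesis using PiE_arb[OF \<rho>(1), of "(False, n)"] PiE_arb[OF \<rho>(1), of "(True, n)"] by simp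
    qed (use \<rho>(2) in blast)
    then have "\<rho> (u, n) = \<rho> (True, n)" for u n by (cases u) auto
    note u = this
    show "(\<lambda>(u, n). \<rho> (True, n)) = \<rho>" by (rule ext, clarify, rule u[symmetric])
    show "(\<lambda>n. \<rho> (True, n)) \<in> ?P" using \<rho>(1) by (auto simp: PiE_def extensional_def)
    have "(\<lambda>n. \<rho> (False, n)) = (\<lambda>n. \<rho> (True, n))" by (rule ext, rule u)
    then show "F (\<lambda>n. \<rho> (True, n)) (\<lambda>n. \<rho> (True, n)) = F (\<lambda>n. \<rho> (True, n)) (\<lambda>n. \<rho> (False, n))"
      by simp
  next
    fix \<sigma> assume "\<sigma> \<in> ?P"
    then show "(\<lambda>(u, n). \<sigma> n) \<in> {\<rho>. \<rho> \<in> ?Q \<and> (\<forall>n\<in>N. \<rho> (False, n) = \<rho> (True, n))}"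
      by (auto simp: PiE_def extensional_def)
  qed simp
  finally show ?thesis by (rule sym)
qed

text \<open>
  The value of a factor when the upper and the lower slot of a name may hold different indices.
\<close>

fun split_value :: "'n::finite metric \<Rightarrow> real^'n \<Rightarrow> (bool \<times> nat \<Rightarrow> 'n) \<Rightarrow> factor \<Rightarrow> real" where
  "split_value g P \<rho> (Curv a b c k js) =
     curv_comp g (\<rho> (False, a)) (\<rho> (False, b)) (\<rho> (False, c)) (\<rho> (True, k)) (map (\<lambda>n. \<rho> (False, n)) js) P"
| "split_value g P \<rho> (GUp i j) = inverse_metric g P $ \<rho> (True, i) $ \<rho> (True, j)"
| "split_value g P \<rho> (GLow i j) = g P $ \<rho> (False, i) $ \<rho> (False, j)"

definition slots :: "factor \<Rightarrow> (bool \<times> nat) set" where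
  "slots f = {True} \<times> set (upper_names f) \<union> {False} \<times> set (lower_names f)"

lemma split_value_cong:
  assumes "\<And>z. z \<in> slots f \<Longrightarrow> \<rho> z = \<rho>' z"
  shows "split_value g P \<rho> f = split_value g P \<rho>' f"
  using assms by (cases f) (auto simp: slots_def cong: map_cong)

lemma split_value_diagonal: "split_value g P (\<lambda>(u, n). \<sigma> n) f = factor_value g P \<sigma> f"
  by (cases f) simp_all

lemma monomial_value_split:
  fixes g :: "'n::finite metric"
  assumes AC: "A ** C = mat 1" and nz: "monomial_value g fs P \<noteq> 0"
    and N: "N = set (concat (map upper_names fs))"
  obtains \<tau> where "(\<Sum>\<rho>\<in>PiE (UNIV \<times> N) (\<lambda>_. UNIV).
      (\<Prod>z\<in>UNIV \<times> N. slot_weight A C \<tau> z (\<rho> z))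
      * prod_list (map (split_value g P \<rho>) fs)) \<noteq> 0"
proof -
  define F where "F \<sigma> \<sigma>' = prod_list (map (split_value g P (\<lambda>(u, n). if u then \<sigma> n else \<sigma>' n)) fs)"
    for \<sigma> \<sigma>'
  have "F \<sigma> \<sigma> = prod_list (map (factor_value g P \<sigma>) fs)" for \<sigma>
  proof -
    have "split_value g P (\<lambda>(u, n). \<sigma> n) = factor_value g P \<sigma>"
      by (rule ext, rule split_value_diagonal)
    then show ?thesis by (simp add: F_def)
  qed
  then have "monomial_value g fs P = (\<Sum>\<sigma>\<in>PiE N (\<lambda>_. UNIV). F \<sigma> \<sigma>)"
    by (simp add: monomial_value_def N)
  moreover have "finite N" by (simp add: N)
  ultimately have "(\<Sum>\<tau>\<in>PiE N (\<lambda>_. UNIV). \<Sum>\<rho>\<in>PiE (UNIV \<times> N) (\<lambda>_. UNIV).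
      (\<Prod>z\<in>UNIV \<times> N. slot_weight A C \<tau> z (\<rho> z))
      * F (\<lambda>n. \<rho> (True, n)) (\<lambda>n. \<rho> (False, n))) \<noteq> 0"
    using nz contraction_change_of_basis[OF AC, of N F] by simp
  from nonzero_sum_imp_nonzero_term[OF this] obtain \<tau> where "(\<Sum>\<rho>\<in>PiE (UNIV \<times> N) (\<lambda>_. UNIV).
      (\<Prod>z\<in>UNIV \<times> N. slot_weight A C \<tau> z (\<rho> z))
      * F (\<lambda>n. \<rho> (True, n)) (\<lambda>n. \<rho> (False, n))) \<noteq> 0"
    by blast
  moreover have "(\<lambda>(u, n). if u then \<rho> (True, n) else \<rho> (False, n)) = \<rho>" for \<rho> :: "bool \<times> nat \<Rightarrow> 'n"
    by (auto simp: fun_eq_iff)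
  ultimately show thesis using that by (simp add: F_def)
qed

lemma slots_disjoint:
  assumes "distinct (concat (map upper_names (xs @ f # ys)))"
    and "distinct (concat (map lower_names (xs @ f # ys)))"
    and "f' \<in> set xs \<union> set ys"
  shows "slots f \<inter> slots f' = {}"
  using assms by (fastforce simp: slots_def)

text \<open>
  In a Weyl monomial the factors occupy disjoint sets of slots. Hence if the term of \<open>\<tau>\<close> in the
  expansion is nonzero, so is the partial sum over two chosen slots of any single factor, for
  suitable indices in its other slots.
\<close>

lemma isolate_factor:
  fixes g :: "'n::finite metric"
  assumes fs: "weyl_monomial fs" and N: "N = set (concat (map upper_names fs))"
    and nz: "(\<Sum>\<rho>\<in>PiE (UNIV \<times> N) (\<lambda>_. UNIV).
      (\<Prod>z\<in>UNIV \<times> N. slot_weight A C \<tau> z (\<rho> z))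
      * prod_list (map (split_value g P \<rho>) fs)) \<noteq> 0"
    and f: "f \<in> set fs" and xy: "x \<in> slots f" "y \<in> slots f" "x \<noteq> y"
  obtains \<rho> where
    "\<And>z. z \<in> slots f \<Longrightarrow> z \<noteq> x \<Longrightarrow> z \<noteq> y \<Longrightarrow> slot_weight A C \<tau> z (\<rho> z) \<noteq> 0"
    "(\<Sum>r\<in>UNIV. \<Sum>s\<in>UNIV. slot_weight A C \<tau> x r * slot_weight A C \<tau> y s * split_value g P (\<rho>(x := r, y := s)) f) \<noteq> 0"
proof -
  let ?W = "slot_weight A C \<tau>"
  obtain xs ys where split: "fs = xs @ f # ys" using f by (meson split_list)
  have dist: "distinct (concat (map upper_names (xs @ f # ys)))"
    "distinct (concat (map lower_names (xs @ f # ys)))"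
    and low: "N = set (concat (map lower_names fs))"
    using fs by (simp_all only: weyl_monomial_def split N)
  define rest where "rest \<rho> = prod_list (map (split_value g P \<rho>) xs) * prod_list (map (split_value g P \<rho>) ys)"
    for \<rho>
  have rest: "rest (\<rho>(x := r, y := s)) = rest \<rho>" for \<rho> r s
  proof -
    have "split_value g P (\<rho>(x := r, y := s)) f' = split_value g P \<rho> f'" if "f' \<in> set xs \<union> set ys" for f'
      using slots_disjoint[OF dist that] xy by (intro split_value_cong) auto
    then show ?thesis unfolding rest_def by (simp cong: map_cong)
  qed
  have sub: "slots f \<subseteq> UNIV \<times> N"
  proof -
    have "set (upper_names f) \<subseteq> N" using f by (auto simp: N)
    moreover have "set (lower_names f) \<subseteq> N" using f by (auto simp: low)
    ultimately show ?thesis by (auto simp: slots_def)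
  qed
  have fin: "finite (UNIV \<times> N :: (bool \<times> nat) set)" by (simp add: N)
  have x: "x \<in> UNIV \<times> N" and y: "y \<in> UNIV \<times> N" using xy sub by auto
  have "(\<Sum>\<rho>\<in>PiE (UNIV \<times> N) (\<lambda>_. UNIV). (\<Prod>z\<in>UNIV \<times> N. ?W z (\<rho> z)) * (split_value g P \<rho> f * rest \<rho>)) \<noteq> 0"
    using nz by (simp add: split rest_def mult_ac)
  from nonzero_sum_PiE_extract[OF fin x y xy(3) rest this]
  obtain \<rho> where "\<And>z. z \<in> UNIV \<times> N \<Longrightarrow> z \<noteq> x \<Longrightarrow> z \<noteq> y \<Longrightarrow> ?W z (\<rho> z) \<noteq> 0"
    "(\<Sum>r\<in>UNIV. \<Sum>s\<in>UNIV. ?W x r * ?W y s * split_value g P (\<rho>(x := r, y := s)) f) \<noteq> 0"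
    by blast
  with sub that show thesis by blast
qed

text \<open>
  The weight of the basis vector \<open>e i\<close> under a one-parameter group of boosts of the monomial metric;
  it is odd under the involution \<open>w\<close>. The exponential growth in the position of \<open>i\<close> lets a single
  later index outweigh \<open>K - 1\<close> earlier ones.
\<close>

definition boost_weight :: "nat \<Rightarrow> ('n \<Rightarrow> 'n) \<Rightarrow> 'n::{finite,linorder} \<Rightarrow> int" where
  "boost_weight K w i = int (K ^ card {a. a < i}) - int (K ^ card {a. a < w i})"

definition factor_weight :: "('n \<Rightarrow> int) \<Rightarrow> (nat \<Rightarrow> 'n) \<Rightarrow> factor \<Rightarrow> int" where
  "factor_weight b \<tau> f = (\<Sum>n\<leftarrow>upper_names f. b (\<tau> n)) - (\<Sum>n\<leftarrow>lower_names f. b (\<tau> n))"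

text \<open>
  Every name occurs once in an upper and once in a lower slot.
\<close>

lemma sum_factor_weight:
  assumes "weyl_monomial fs"
  shows "(\<Sum>f\<leftarrow>fs. factor_weight b \<tau> f) = 0"
proof -
  have "(\<Sum>f\<leftarrow>fs. factor_weight b \<tau> f) =
      (\<Sum>n\<leftarrow>concat (map upper_names fs). b (\<tau> n)) - (\<Sum>n\<leftarrow>concat (map lower_names fs). b (\<tau> n))"
    by (induction fs) (auto simp: factor_weight_def)
  also have "\<dots> = 0"
    using assms unfolding weyl_monomial_def by (simp only: sum_list_distinct_conv_sum_set)
  finally show ?thesis .
qed

lemma boost_weight_involution:
  "w (w i) = i \<Longrightarrow> boost_weight K w (w i) = - boost_weight K w i"
  by (simp add: boost_weight_def)

text \<open>
  All lower indices lie before \<open>k\<close>, so \<open>K ^ k\<close> dominates the positive parts of their weights. The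
  remaining negative part of the weight of \<open>k\<close>, which is \<open>K ^ (w k)\<close> up to sign, is
  beaten by the negative part of the weight of \<open>c\<close>.
\<close>

lemma boost_weight_curvature:
  assumes less: "\<And>i. i \<in> set ([a, b, c] @ js) \<Longrightarrow> i < k" and wk: "w k < w c"
    and K: "K \<ge> 3 + length js"
  shows "boost_weight K w k > boost_weight K w a + boost_weight K w b + boost_weight K w c
    + (\<Sum>j\<leftarrow>js. boost_weight K w j)"
proof -
  let ?r = "\<lambda>i. card {a. a < i}"
  have mono: "?r i < ?r j" if "i < j" for i j :: 'a
    using that by (intro psubset_card_mono) (auto intro: less_trans)
  obtain m where m: "?r k = Suc m"
    using mono[of a k] less by (cases "?r k") auto
  have K1: "K \<ge> 1" using K by simp
  have le: "int (K ^ ?r i) \<le> int (K ^ m)" if "i \<in> set ([a, b, c] @ js)" for i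
    using mono[OF less[OF that]] m K1 by (simp add: power_increasing)
  have bw: "boost_weight K w i \<le> int (K ^ m)" if "i \<in> set ([a, b, c] @ js)" for i
    using le[OF that] unfolding boost_weight_def by linarith
  have "(\<Sum>j\<leftarrow>js. boost_weight K w j) \<le> (\<Sum>j\<leftarrow>js. int (K ^ m))"
    by (rule sum_list_mono) (use bw in auto)
  then have js: "(\<Sum>j\<leftarrow>js. boost_weight K w j) \<le> int (length js) * int (K ^ m)"
    by (simp add: sum_list_triv)
  have "int (K ^ ?r (w k)) < int (K ^ ?r (w c))"
    using mono[OF wk] K by (simp add: power_strict_increasing)
  then have c: "boost_weight K w c + int (K ^ ?r (w k)) < int (K ^ m)"
    using le[of c] by (simp add: boost_weight_def)
  have "int (3 + length js) * int (K ^ m) \<le> int K * int (K ^ m)"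
    using K by (intro mult_right_mono) auto
  then have "(3 + int (length js)) * int (K ^ m) \<le> int (K ^ ?r k)"
    by (simp add: m)
  then show ?thesis
    using js c bw[of a] bw[of b] by (simp add: boost_weight_def[of K w k] algebra_simps)
qed

text \<open>
  Expand the contraction in a monomial basis and take a nonzero term. Monomiality makes the weight
  of each metric factor zero. For a curvature factor, triangularity puts its lower indices before the
  upper index \<open>k\<close>, and skew-symmetry turns the nonzero entry \<open>(k, i\<^sub>3)\<close> of the curvature
  endomorphism into a nonzero entry \<open>(w i\<^sub>3, w k)\<close>, to which triangularity applies again; so its
  weight is positive. But the weights of all factors add up to zero.
\<close>

lemma plane_wave_vsi_monomial:
  fixes g :: "'n::{finite,linorder} metric"
  assumes g: "pseudo_riemannian p q g" and wv: "generalized_plane_wave g" and fs: "weyl_monomial fs"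
  shows "monomial_value g fs P = 0"
proof (rule ccontr)
  assume nz: "monomial_value g fs P \<noteq> 0"
  let ?G = "g P" and ?H = "inverse_metric g P"
  have symG: "transpose ?G = ?G" using g by (simp add: pseudo_riemannian_def)
  obtain A C w where AC: "A ** C = mat 1"
    and A: "\<And>l i. A $ l $ i \<noteq> 0 \<Longrightarrow> i \<le> l" and C: "\<And>l i. C $ i $ l \<noteq> 0 \<Longrightarrow> l \<le> i"
    and ww: "\<And>i. w (w i) = i"
    and M: "\<And>i j. (transpose A ** ?G ** A) $ i $ j \<noteq> 0 \<longleftrightarrow> j = w i"
    and L: "\<And>i j. (C ** ?H ** transpose C) $ i $ j \<noteq> 0 \<Longrightarrow> j = w i"
    using symmetric_triangular_congruence[OF symG pseudo_riemannian_inverse(1)[OF g]] by metis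
  define N where "N = set (concat (map upper_names fs))"
  obtain \<tau> where \<tau>: "(\<Sum>\<rho>\<in>PiE (UNIV \<times> N) (\<lambda>_. UNIV).
      (\<Prod>z\<in>UNIV \<times> N. slot_weight A C \<tau> z (\<rho> z)) * prod_list (map (split_value g P \<rho>) fs)) \<noteq> 0"
    using monomial_value_split[OF AC nz N_def] by blast
  note iso = isolate_factor[OF fs N_def \<tau>]
  have dist: "distinct (upper_names f)" "distinct (lower_names f)" if "f \<in> set fs" for f
    using fs that by (auto simp: weyl_monomial_def distinct_concat_iff)
  \<comment> \<open>Three curvature indices and all derivative indices of any one factor have to be outweighed.\<close>
  define K where "K = 3 + sum_list (map (\<lambda>f. length (lower_names f)) fs)"
  define b where "b = boost_weight K w"
  have weight: "0 \<le> factor_weight b \<tau> f \<and> ((\<exists>a b c k js. f = Curv a b c k js) \<longrightarrow> 0 < factor_weight b \<tau> f)"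
    if f: "f \<in> set fs" for f
  proof (cases f)
    case (GUp i j)
    have "i \<noteq> j" using dist(1)[OF f] GUp by simp
    then obtain \<rho> where "(\<Sum>r\<in>UNIV. \<Sum>s\<in>UNIV. slot_weight A C \<tau> (True, i) r *
        slot_weight A C \<tau> (True, j) s * split_value g P (\<rho>((True, i) := r, (True, j) := s)) f) \<noteq> 0"
      using iso[OF f, of "(True, i)" "(True, j)"] by (auto simp: GUp slots_def)
    then have "(\<Sum>r\<in>UNIV. \<Sum>s\<in>UNIV. C $ \<tau> i $ r * C $ \<tau> j $ s * ?H $ r $ s) \<noteq> 0"
      using \<open>i \<noteq> j\<close> by (simp add: GUp slot_weight_def)
    also have "(\<Sum>r\<in>UNIV. \<Sum>s\<in>UNIV. C $ \<tau> i $ r * C $ \<tau> j $ s * ?H $ r $ s) =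
        (C ** ?H ** transpose C) $ \<tau> i $ \<tau> j"
      by (subst sum.swap) (simp add: matrix_matrix_mult_def transpose_def sum_distrib_left sum_distrib_right mult_ac)
    finally have "\<tau> j = w (\<tau> i)" by (rule L)
    then show ?thesis
      using boost_weight_involution[of w "\<tau> i" K] ww by (simp add: GUp factor_weight_def b_def)
  next
    case (GLow i j)
    have "i \<noteq> j" using dist(2)[OF f] GLow by simp
    then obtain \<rho> where "(\<Sum>r\<in>UNIV. \<Sum>s\<in>UNIV. slot_weight A C \<tau> (False, i) r *
        slot_weight A C \<tau> (False, j) s * split_value g P (\<rho>((False, i) := r, (False, j) := s)) f) \<noteq> 0"
      using iso[OF f, of "(False, i)" "(False, j)"] by (auto simp: GLow slots_def)
    then have "(\<Sum>r\<in>UNIV. \<Sum>s\<in>UNIV. A $ r $ \<tau> i * A $ s $ \<tau> j * ?G $ r $ s) \<noteq> 0"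
      using \<open>i \<noteq> j\<close> by (simp add: GLow slot_weight_def)
    also have "(\<Sum>r\<in>UNIV. \<Sum>s\<in>UNIV. A $ r $ \<tau> i * A $ s $ \<tau> j * ?G $ r $ s) =
        (transpose A ** ?G ** A) $ \<tau> i $ \<tau> j"
      by (subst sum.swap) (simp add: matrix_matrix_mult_def transpose_def sum_distrib_left sum_distrib_right mult_ac)
    finally have "\<tau> j = w (\<tau> i)" using M by blast
    then show ?thesis
      using boost_weight_involution[of w "\<tau> i" K] ww by (simp add: GLow factor_weight_def b_def)
  next
    case (Curv i1 i2 i3 k js)
    have d: "i3 \<noteq> i1" "i3 \<noteq> i2" "i3 \<notin> set js" using dist(2)[OF f] Curv by auto
    obtain \<rho> where \<rho>: "\<And>z. z \<in> slots f \<Longrightarrow> z \<noteq> (True, k) \<Longrightarrow> z \<noteq> (False, i3) \<Longrightarrow>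
        slot_weight A C \<tau> z (\<rho> z) \<noteq> 0"
      and \<rho>nz: "(\<Sum>r\<in>UNIV. \<Sum>s\<in>UNIV. slot_weight A C \<tau> (True, k) r *
        slot_weight A C \<tau> (False, i3) s * split_value g P (\<rho>((True, k) := r, (False, i3) := s)) f) \<noteq> 0"
      using iso[OF f, of "(True, k)" "(False, i3)"] by (auto simp: Curv slots_def)
    let ?\<rho> = "\<lambda>n. \<rho> (False, n)"
    define R :: "((real, 'n) vec, 'n) vec" where
      "R = (\<chi> r s. curv_comp g (?\<rho> i1) (?\<rho> i2) s r (map ?\<rho> js) P)"
    have up: "\<tau> n \<le> ?\<rho> n" if "n \<in> set ([i1, i2] @ js)" for n
      using \<rho>[of "(False, n)"] that d by (intro A) (auto simp: slots_def Curv slot_weight_def)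
    have R0: "x < r" if "R $ r $ s \<noteq> 0" "x \<in> set ([?\<rho> i1, ?\<rho> i2, s] @ map ?\<rho> js)" for r s x
      using curv_comp_triangular(1)[OF g wv, of "?\<rho> i1" "?\<rho> i2" s r "map ?\<rho> js" P x] that
      by (simp add: R_def)
    have map: "map (\<lambda>n. (\<rho>((True, k) := r, (False, i3) := s)) (False, n)) js = map ?\<rho> js" for r s
      using d(3) by (intro map_cong) auto
    have *: "\<exists>r s. C $ x $ r \<noteq> 0 \<and> R $ r $ s \<noteq> 0 \<and> A $ s $ y \<noteq> 0"
      if "(C ** R ** A) $ x $ y \<noteq> 0" for x y
    proof (rule ccontr)
      assume "\<not> ?thesis"
      then have z: "C $ x $ r * R $ r $ s * A $ s $ y = 0" for r s by auto
      have "(C ** R ** A) $ x $ y = 0"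
        by (simp only: matrix_matrix_mult_def vec_lambda_beta sum_distrib_right z sum.neutral_const)
      then show False using that by blast
    qed
    have tri: "\<tau> n < x" if h: "(C ** R ** A) $ x $ y \<noteq> 0" "n \<in> set ([i1, i2] @ js)" for x y n
    proof -
      obtain r s where rs: "C $ x $ r \<noteq> 0" "R $ r $ s \<noteq> 0" using *[OF h(1)] by blast
      have "?\<rho> n < r" by (rule R0[OF rs(2)]) (use h(2) in auto)
      then show ?thesis using up[OF h(2)] C[OF rs(1)] by simp
    qed
    have tri': "y < x" if h: "(C ** R ** A) $ x $ y \<noteq> 0" for x y
    proof -
      obtain r s where rs: "C $ x $ r \<noteq> 0" "R $ r $ s \<noteq> 0" "A $ s $ y \<noteq> 0" using *[OF h] by blast
      have "s < r" by (rule R0[OF rs(2)]) auto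
      then show ?thesis using A[OF rs(3)] C[OF rs(1)] by simp
    qed
    have "(\<Sum>r\<in>UNIV. \<Sum>s\<in>UNIV. C $ \<tau> k $ r * A $ s $ \<tau> i3 * R $ r $ s) \<noteq> 0"
      using \<rho>nz d by (simp add: Curv slot_weight_def R_def map del: fun_upd_apply) (simp add: R_def)
    also have "(\<Sum>r\<in>UNIV. \<Sum>s\<in>UNIV. C $ \<tau> k $ r * A $ s $ \<tau> i3 * R $ r $ s) =
        (C ** R ** A) $ \<tau> k $ \<tau> i3"
      by (subst sum.swap) (simp add: matrix_matrix_mult_def sum_distrib_left sum_distrib_right mult_ac)
    finally have R1: "(C ** R ** A) $ \<tau> k $ \<tau> i3 \<noteq> 0" .
    have "transpose (?G ** R) = - (?G ** R)"
    proof -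
      have "(?G ** R) $ x $ y + (?G ** R) $ y $ x = 0" for x y
        using curv_comp_skew[OF g wv, of "?\<rho> i1" "?\<rho> i2" y "map ?\<rho> js" P x]
          pseudo_riemannian_sym[OF g, of P]
        by (simp add: matrix_matrix_mult_def R_def mult.commute)
      then show ?thesis by (simp add: vec_eq_iff transpose_def eq_neg_iff_add_eq_0)
    qed
    from skew_in_monomial_basis[OF symG this AC ww M R1]
    have wk: "w (\<tau> k) < w (\<tau> i3)" by (rule tri')
    have less: "i < \<tau> k" if "i \<in> set ([\<tau> i1, \<tau> i2, \<tau> i3] @ map \<tau> js)" for i
      using that tri[OF R1] tri'[OF R1] by auto
    have "length (lower_names f) \<le> sum_list (map (\<lambda>f. length (lower_names f)) fs)"
      using f by (intro member_le_sum_list) auto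
    then have "K \<ge> 3 + length (map \<tau> js)" by (simp add: K_def Curv)
    from boost_weight_curvature[where a = "\<tau> i1" and b = "\<tau> i2" and c = "\<tau> i3" and js = "map \<tau> js",
        OF less wk this]
    have "0 < factor_weight b \<tau> f" by (simp add: factor_weight_def Curv b_def o_def)
    then show ?thesis by simp
  qed
  have "\<forall>x\<in>set (map (factor_weight b \<tau>) fs). x = 0"
    using sum_factor_weight[OF fs, of b \<tau>] weight
    by (subst sum_list_nonneg_eq_0_iff[symmetric]) auto
  moreover obtain f where "f \<in> set fs" "\<exists>a b c k js. f = Curv a b c k js"
    using fs unfolding weyl_monomial_def by blast
  ultimately show False using weight[of f] by force
qed

lemma plane_wave_vsi:
  assumes g: "pseudo_riemannian p q g" and w: "generalized_plane_wave g"
  shows "vsi g"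
  unfolding vsi_def
proof (intro allI impI)
  fix W P assume "weyl_invariant g W"
  then obtain cs :: "(real \<times> factor list) list" where cs: "\<forall>(c, fs) \<in> set cs. weyl_monomial fs"
    and W: "W = (\<lambda>P. \<Sum>(c, fs)\<leftarrow>cs. c * monomial_value g fs P)"
    unfolding weyl_invariant_def by blast
  have "map (\<lambda>(c, fs). c * monomial_value g fs P) cs = map (\<lambda>_. 0) cs"
    using cs plane_wave_vsi_monomial[OF g w] by (intro map_cong) auto
  then show "W P = 0" unfolding W by (simp only:) (induction cs, auto)
qed


section \<open>Geometry of generalized plane wave manifolds\<close>

theorem theorem1p1:
  fixes g :: "'n::{finite,linorder} metric" and p q :: nat
  assumes "pseudo_riemannian p q g" and "p + q = CARD('n)"
    and "generalized_plane_wave g"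
  shows "(complete_metric g \<and> strongly_geodesically_convex g) \<and>
    (\<forall>i\<^sub>1 i\<^sub>2 i\<^sub>3 js k.
       (\<not> k > Max (set ([i\<^sub>1, i\<^sub>2, i\<^sub>3] @ js)) \<longrightarrow> (\<forall>x. curv_comp g i\<^sub>1 i\<^sub>2 i\<^sub>3 k js x = 0)) \<and>
       depends_only_below k (curv_comp g i\<^sub>1 i\<^sub>2 i\<^sub>3 k js)) \<and>
    (nilpotent_osserman g \<and> nilpotent_ivanov_petrova g \<and> nilpotent_szabo g) \<and>
    (ricci_flat g \<and> einstein g) \<and>
    vsi g \<and>
    (\<forall>\<gamma>. smooth_curve_on {0..1} \<gamma> \<longrightarrow>
       (\<forall>i. \<exists>a :: 'n \<Rightarrow> real.
          parallel_translation g \<gamma> (axis i 1) = axis i 1 + (\<Sum>j | j > i. a j *\<^sub>R axis j 1))) \<and>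
    (\<forall>P. \<forall>H\<in>holonomy g P. linear H \<and> row_matrix H \<in> unipotent_upper)"
proof (intro conjI allI impI ballI)
  note g = assms(1) and w = assms(3)
  show "complete_metric g" by (rule plane_wave_complete[OF g w])
  show "strongly_geodesically_convex g" by (rule plane_wave_strongly_convex[OF g w])
  show "curv_comp g i\<^sub>1 i\<^sub>2 i\<^sub>3 k js x = 0" if "\<not> k > Max (set ([i\<^sub>1, i\<^sub>2, i\<^sub>3] @ js))" for i\<^sub>1 i\<^sub>2 i\<^sub>3 js k x
  proof (rule ccontr)
    assume "curv_comp g i\<^sub>1 i\<^sub>2 i\<^sub>3 k js x \<noteq> 0"
    then have "\<forall>i\<in>set ([i\<^sub>1, i\<^sub>2, i\<^sub>3] @ js). i < k"
      using curv_comp_triangular(1)[OF g w] by blast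
    with that show False by (subst (asm) Max_less_iff) auto
  qed
  show "depends_only_below k (curv_comp g i\<^sub>1 i\<^sub>2 i\<^sub>3 k js)" for i\<^sub>1 i\<^sub>2 i\<^sub>3 js k
    by (rule curv_comp_triangular(2)[OF g w])
  show "nilpotent_osserman g" "nilpotent_ivanov_petrova g" "nilpotent_szabo g"
    by (rule plane_wave_nilpotent[OF g w])+
  show "ricci_flat g" "einstein g"
    by (auto simp: ricci_flat_def einstein_def plane_wave_ricci[OF g w] intro: exI[of _ 0])
  show "vsi g" by (rule plane_wave_vsi[OF g w])
  show "\<exists>a. parallel_translation g \<gamma> (axis i 1) = axis i 1 + (\<Sum>j | j > i. a j *\<^sub>R axis j 1)"
    if "smooth_curve_on {0..1} \<gamma>" for \<gamma> i
    by (rule parallel_translation_axis[OF g w that])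
  show "linear H" "row_matrix H \<in> unipotent_upper" if "H \<in> holonomy g P" for P H
    using holonomy_unipotent[OF g w that] by blast+
qed

end
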